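(* Let $k$ be a field, let $d>1$ and $n>1$ be integers, let $\mathfrak n=(X_1,\ldots,X_d)\subset k[X_1,\ldots,X_d]$, and let $R=k[X_1,\ldots,X_d]/\mathfrak n^n$. Let $M$ be a finitely generated nonfree $R$-module. Then $$\beta_{i+1}(M)-\beta_i(M)\ \geq\ \binom{d+n-1}{d-1}-1\ >\ d-1\qquad\text{for all } i\geq 2 .$$
   Context: $R$ is an artinian local ring with residue field $k$, and $\beta_i(M)=\dim_k\operatorname{Tor}_i^R(k,M)$ is the $i$-th Betti number of $M$ over $R$. *)

theory Defs
  imports
    "HOL-Algebra.Ideal_Product"
    "HOL-Algebra.QuotRing"
    "HOL-Algebra.Algebraic_Closure_Type"
    "HOL-Library.Poly_Mapping"
    "Jordan_Normal_Form.Missing_VectorSpace"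
begin

hide_const (open) Multiset.mult Polynomial.smult Modules.module

section \<open>The ring \<open>k[X\<^sub>1,\<dots>,X\<^sub>d]/\<nn>\<^sup>n\<close>\<close>

text \<open>
  A polynomial is a finitely supported map from monomials to coefficients, a monomial a
  finitely supported map from variables to exponents. The variables are indexed by
  \<open>0, \<dots>, d - 1\<close>.
\<close>

type_synonym 'k mpoly = "(nat \<Rightarrow>\<^sub>0 nat) \<Rightarrow>\<^sub>0 'k"

definition mpoly_ring :: "nat \<Rightarrow> 'k::field mpoly ring"
  where "mpoly_ring d =
    ring_of_type_algebra \<lparr> carrier := {p. \<forall>m \<in> Poly_Mapping.keys p. Poly_Mapping.keys m \<subseteq> {..<d}} \<rparr>"

definition mpoly_var :: "nat \<Rightarrow> 'k::field mpoly"
  where "mpoly_var i = Poly_Mapping.single (Poly_Mapping.single i 1) 1"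

definition vars_ideal :: "nat \<Rightarrow> 'k::field mpoly set"
  where "vars_ideal d = Idl\<^bsub>mpoly_ring d\<^esub> (mpoly_var ` {..<d})"

text \<open>The ideal power is taken in the semiring of ideals, whose product is the ideal product.\<close>

definition truncated_mpoly_ring :: "nat \<Rightarrow> nat \<Rightarrow> 'k::field mpoly set ring"
  where "truncated_mpoly_ring d n =
    mpoly_ring d Quot (vars_ideal d [^]\<^bsub>ideals_set (mpoly_ring d)\<^esub> n)"


section \<open>Modules over a commutative ring\<close>

text \<open>
  The record type of modules extends that of rings. Its multiplicative fields carry no meaning
  for modules and are given dummy values, as in \<^const>\<open>ring.func_space\<close>.
\<close>

definition fin_gen_module :: "('a, 'b) ring_scheme \<Rightarrow> ('a, 'm, 'c) module_scheme \<Rightarrow> bool"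
  where "fin_gen_module R M \<longleftrightarrow> module R M \<and>
    (\<exists>A \<subseteq> carrier M. finite A \<and> LinearCombinations.module.span R M A = carrier M)"

definition free_module :: "('a, 'b) ring_scheme \<Rightarrow> ('a, 'm, 'c) module_scheme \<Rightarrow> bool"
  where "free_module R M \<longleftrightarrow> module R M \<and>
    (\<exists>B \<subseteq> carrier M. \<not> LinearCombinations.module.lin_dep R M B \<and>
       LinearCombinations.module.span R M B = carrier M)"

definition quot_module :: "('a, 'm, 'c) module_scheme \<Rightarrow> 'm set \<Rightarrow> ('a, 'm set) module"
  where "quot_module M N =
    \<lparr> carrier = a_rcosets\<^bsub>M\<^esub> N,
      mult = (\<lambda>A B. N),
      one = N,
      zero = N,
      add = set_add M,
      smult = (\<lambda>r A. \<Union>x\<in>A. N +>\<^bsub>M\<^esub> (r \<odot>\<^bsub>M\<^esub> x)) \<rparr>"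

definition free_module_on :: "('a, 'b) ring_scheme \<Rightarrow> 's set \<Rightarrow> ('a, 's \<Rightarrow> 'a) module"
  where "free_module_on R S =
    \<lparr> carrier = {f. (\<forall>s \<in> S. f s \<in> carrier R) \<and> (\<forall>s. s \<notin> S \<longrightarrow> f s = \<zero>\<^bsub>R\<^esub>) \<and>
                    finite {s. f s \<noteq> \<zero>\<^bsub>R\<^esub>}},
      mult = (\<lambda>f g s. \<zero>\<^bsub>R\<^esub>),
      one = (\<lambda>s. \<zero>\<^bsub>R\<^esub>),
      zero = (\<lambda>s. \<zero>\<^bsub>R\<^esub>),
      add = (\<lambda>f g s. f s \<oplus>\<^bsub>R\<^esub> g s),
      smult = (\<lambda>r f s. r \<otimes>\<^bsub>R\<^esub> f s) \<rparr>"

definition free_gen :: "('a, 'b) ring_scheme \<Rightarrow> 's \<Rightarrow> 's \<Rightarrow> 'a"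
  where "free_gen R s = (\<lambda>t. if t = s then \<one>\<^bsub>R\<^esub> else \<zero>\<^bsub>R\<^esub>)"


section \<open>Tensor products\<close>

text \<open>
  \<open>N \<otimes>\<^sub>R M\<close> is the free \<open>R\<close>-module on \<open>N \<times> M\<close> modulo the submodule generated by the
  relations of \<open>R\<close>-bilinearity.
\<close>

definition tensor_relations ::
  "('a, 'b) ring_scheme \<Rightarrow> ('a, 'n, 'c) module_scheme \<Rightarrow> ('a, 'm, 'e) module_scheme
    \<Rightarrow> ('n \<times> 'm \<Rightarrow> 'a) set"
  where "tensor_relations R N M =
    (let L = free_module_on R (carrier N \<times> carrier M); g = free_gen R in
       {g (x \<oplus>\<^bsub>N\<^esub> x', y) \<ominus>\<^bsub>L\<^esub> (g (x, y) \<oplus>\<^bsub>L\<^esub> g (x', y)) | x x' y.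
          x \<in> carrier N \<and> x' \<in> carrier N \<and> y \<in> carrier M}
     \<union> {g (x, y \<oplus>\<^bsub>M\<^esub> y') \<ominus>\<^bsub>L\<^esub> (g (x, y) \<oplus>\<^bsub>L\<^esub> g (x, y')) | x y y'.
          x \<in> carrier N \<and> y \<in> carrier M \<and> y' \<in> carrier M}
     \<union> {g (r \<odot>\<^bsub>N\<^esub> x, y) \<ominus>\<^bsub>L\<^esub> r \<odot>\<^bsub>L\<^esub> g (x, y) | r x y.
          r \<in> carrier R \<and> x \<in> carrier N \<and> y \<in> carrier M}
     \<union> {g (x, r \<odot>\<^bsub>M\<^esub> y) \<ominus>\<^bsub>L\<^esub> r \<odot>\<^bsub>L\<^esub> g (x, y) | r x y.
          r \<in> carrier R \<and> x \<in> carrier N \<and> y \<in> carrier M})"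

definition tensor_submodule ::
  "('a, 'b) ring_scheme \<Rightarrow> ('a, 'n, 'c) module_scheme \<Rightarrow> ('a, 'm, 'e) module_scheme
    \<Rightarrow> ('n \<times> 'm \<Rightarrow> 'a) set"
  where "tensor_submodule R N M =
    LinearCombinations.module.span R (free_module_on R (carrier N \<times> carrier M))
      (tensor_relations R N M)"

definition tensor_product ::
  "('a, 'b) ring_scheme \<Rightarrow> ('a, 'n, 'c) module_scheme \<Rightarrow> ('a, 'm, 'e) module_scheme
    \<Rightarrow> ('a, ('n \<times> 'm \<Rightarrow> 'a) set) module"
  where "tensor_product R N M =
    quot_module (free_module_on R (carrier N \<times> carrier M)) (tensor_submodule R N M)"

definition pure_tensor ::
  "('a, 'b) ring_scheme \<Rightarrow> ('a, 'n, 'c) module_scheme \<Rightarrow> ('a, 'm, 'e) module_scheme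
    \<Rightarrow> 'n \<Rightarrow> 'm \<Rightarrow> ('n \<times> 'm \<Rightarrow> 'a) set"
  where "pure_tensor R N M x y =
    tensor_submodule R N M +>\<^bsub>free_module_on R (carrier N \<times> carrier M)\<^esub> free_gen R (x, y)"

text \<open>
  The map \<open>id \<otimes> f : N \<otimes>\<^sub>R M \<rightarrow> N \<otimes>\<^sub>R M'\<close> induced by an \<open>R\<close>-linear map \<open>f : M \<rightarrow> M'\<close>. Pure
  tensors generate, so the conditions determine it on the carrier of \<open>N \<otimes>\<^sub>R M\<close>.
\<close>

definition tensor_map ::
  "('a, 'b) ring_scheme \<Rightarrow> ('a, 'n, 'c) module_scheme \<Rightarrow> ('a, 'm, 'e) module_scheme
    \<Rightarrow> ('a, 'l, 'f) module_scheme \<Rightarrow> ('m \<Rightarrow> 'l)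
    \<Rightarrow> ('n \<times> 'm \<Rightarrow> 'a) set \<Rightarrow> ('n \<times> 'l \<Rightarrow> 'a) set"
  where "tensor_map R N M M' f =
    (SOME h. h \<in> module_hom R (tensor_product R N M) (tensor_product R N M') \<and>
       (\<forall>x \<in> carrier N. \<forall>y \<in> carrier M. h (pure_tensor R N M x y) = pure_tensor R N M' x (f y)))"


section \<open>Free resolutions and Tor\<close>

text \<open>\<open>\<cdots> \<rightarrow> F 2 \<rightarrow> F 1 \<rightarrow> F 0 \<rightarrow> M \<rightarrow> 0\<close> with \<open>d i : F (i + 1) \<rightarrow> F i\<close> and \<open>e : F 0 \<rightarrow> M\<close>.\<close>

definition free_resolution ::
  "('a, 'b) ring_scheme \<Rightarrow> ('a, 'm, 'c) module_scheme \<Rightarrow> (nat \<Rightarrow> ('a, 'f) module)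
    \<Rightarrow> (nat \<Rightarrow> 'f \<Rightarrow> 'f) \<Rightarrow> ('f \<Rightarrow> 'm) \<Rightarrow> bool"
  where "free_resolution R M F d e \<longleftrightarrow>
    (\<forall>i. free_module R (F i)) \<and>
    (\<forall>i. d i \<in> module_hom R (F (Suc i)) (F i)) \<and>
    e \<in> module_hom R (F 0) M \<and>
    e ` carrier (F 0) = carrier M \<and>
    a_kernel (F 0) M e = d 0 ` carrier (F 1) \<and>
    (\<forall>i. a_kernel (F (Suc i)) (F i) (d i) = d (Suc i) ` carrier (F (Suc (Suc i))))"

text \<open>
  Tor does not depend on the resolution, so one is chosen. The underlying sets of its modules
  have to live in a fixed type: \<open>('a + 'm) list\<close> has cardinality
  \<open>max(\<aleph>\<^sub>0, |'a|, |'m|)\<close>, hence is large enough for a free resolution of every module with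
  scalars in \<open>'a\<close> and elements in \<open>'m\<close>.
\<close>

definition chosen_resolution ::
  "('a, 'b) ring_scheme \<Rightarrow> ('a, 'm, 'c) module_scheme
    \<Rightarrow> (nat \<Rightarrow> ('a, ('a + 'm) list) module) \<times> (nat \<Rightarrow> ('a + 'm) list \<Rightarrow> ('a + 'm) list)
       \<times> (('a + 'm) list \<Rightarrow> 'm)"
  where "chosen_resolution R M = (SOME (F, d, e). free_resolution R M F d e)"

text \<open>
  Homology in degree \<open>i\<close> of a complex \<open>\<cdots> \<rightarrow> C 1 \<rightarrow> C 0 \<rightarrow> 0\<close> with \<open>d i : C (i + 1) \<rightarrow> C i\<close>.
\<close>

definition homology ::
  "(nat \<Rightarrow> ('a, 'c) module) \<Rightarrow> (nat \<Rightarrow> 'c \<Rightarrow> 'c) \<Rightarrow> nat \<Rightarrow> ('a, 'c set) module"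
  where "homology C d i =
    quot_module
      ((C i) \<lparr> carrier :=
         (case i of 0 \<Rightarrow> carrier (C 0) | Suc j \<Rightarrow> a_kernel (C (Suc j)) (C j) (d j)) \<rparr>)
      (d i ` carrier (C (Suc i)))"

definition Tor ::
  "('a, 'b) ring_scheme \<Rightarrow> nat \<Rightarrow> ('a, 'n, 'c) module_scheme \<Rightarrow> ('a, 'm, 'e) module_scheme
    \<Rightarrow> ('a, ('n \<times> ('a + 'm) list \<Rightarrow> 'a) set set) module"
  where "Tor R i N M =
    (let (F, d, e) = chosen_resolution R M
     in homology (\<lambda>j. tensor_product R N (F j)) (\<lambda>j. tensor_map R N (F (Suc j)) (F j) (d j)) i)"


section \<open>Betti numbers over a local ring\<close>

definition max_ideal :: "('a, 'b) ring_scheme \<Rightarrow> 'a set"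
  where "max_ideal R = (THE \<mm>. maximalideal \<mm> R)"

definition residue_field :: "('a, 'b) ring_scheme \<Rightarrow> 'a set ring"
  where "residue_field R = R Quot max_ideal R"

definition residue_field_module :: "('a, 'b) ring_scheme \<Rightarrow> ('a, 'a set) module"
  where "residue_field_module R =
    \<lparr> carrier = carrier (residue_field R),
      mult = monoid.mult (residue_field R),
      one = one (residue_field R),
      zero = zero (residue_field R),
      add = add (residue_field R),
      smult = (\<lambda>r x. (max_ideal R +>\<^bsub>R\<^esub> r) \<otimes>\<^bsub>residue_field R\<^esub> x) \<rparr>"

text \<open>
  An \<open>R\<close>-module annihilated by the maximal ideal, such as \<open>Tor\<^sup>R\<^sub>i(k, M)\<close>, as a vector space over
  the residue field \<open>k\<close>: a residue class acts through any of its representatives.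
\<close>

definition residue_vectorspace ::
  "('a, 'b) ring_scheme \<Rightarrow> ('a, 'm, 'c) module_scheme \<Rightarrow> ('a set, 'm) module"
  where "residue_vectorspace R V =
    \<lparr> carrier = carrier V,
      mult = monoid.mult V,
      one = one V,
      zero = zero V,
      add = add V,
      smult = (\<lambda>c v. (SOME r. r \<in> c) \<odot>\<^bsub>V\<^esub> v) \<rparr>"

definition betti :: "('a, 'b) ring_scheme \<Rightarrow> ('a, 'm, 'c) module_scheme \<Rightarrow> nat \<Rightarrow> nat"
  where "betti R M i =
    vectorspace.dim (residue_field R) (residue_vectorspace R (Tor R i (residue_field_module R) M))"

end

theory Submission imports Defs "HOL-Library.Function_Algebras" begin

text \<open>
  Write \<open>\<nn>\<close> for the ideal of the variables in the polynomial ring, \<open>\<mm>\<close> for its image in \<open>R\<close>, which is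
  the maximal ideal, and \<open>E\<close> for the number of monomials of degree \<open>n\<close>. A finitely generated \<open>M\<close> has a free resolution \<open>\<cdots> \<rightarrow> R\<^sup>r\<^sup>(\<^sup>1\<^sup>) \<rightarrow> R\<^sup>r\<^sup>(\<^sup>0\<^sup>)\<close> whose matrices have all entries in \<open>\<mm>\<close>
  (\<open>minimal_resolution_exists\<close>), and then \<open>\<beta>\<^sub>i(M) = r(i)\<close> for \<open>i \<ge> 1\<close> (\<open>betti_eq_rank\<close>). Since Tor is
  computed from some other, unspecified resolution, the latter rests on a description of
  \<open>Tor\<^sub>i(k, M)\<close> by numbers of generators that passes from one resolution to another along chain maps
  (\<open>tor_generated_transfer\<close>, \<open>betti_eqI\<close>).

  The inequality comes from a single step of the resolution (\<open>rank_growth\<close>). Let \<open>i \<ge> 2\<close> and let \<open>A\<close>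
  be the matrix of \<open>R\<^sup>r\<^sup>(\<^sup>i\<^sup>) \<rightarrow> R\<^sup>r\<^sup>(\<^sup>i\<^sup>-\<^sup>1\<^sup>)\<close>. Because \<open>\<mm>\<^sup>n = 0\<close>, the previous matrix, with entries in \<open>\<mm>\<close>,
  kills \<open>\<mm>\<^sup>n\<^sup>-\<^sup>1 R\<^sup>r\<^sup>(\<^sup>i\<^sup>-\<^sup>1\<^sup>)\<close>, which by exactness lies in the image of \<open>A\<close>. Lift \<open>A\<close> to polynomials and let
  \<open>K\<close> be the module of polynomial vectors \<open>v\<close> such that \<open>A v\<close> has entries in \<open>\<nn>\<^sup>n\<close>. The kernel of \<open>A\<close> needs
  \<open>dim K / \<nn> K\<close> generators, and two families of elements of \<open>K\<close> are independent modulo \<open>\<nn> K\<close>: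

  \<^item> Restricting polynomials to the line where all variables except \<open>x\<^sub>0\<close> vanish, and truncating at
    \<open>x\<^sub>0\<^sup>n\<close>, maps \<open>K\<close> onto a module \<open>L\<close> over \<open>k[x\<^sub>0]\<close> and \<open>\<nn> K\<close> onto \<open>x\<^sub>0 L\<close>. As \<open>L\<close> contains
    \<open>x\<^sub>0\<^sup>n\<^sup>-\<^sup>1 e\<^sub>t\<close> for every \<open>t < r(i)\<close>, rank and nullity give \<open>dim L / x\<^sub>0 L \<ge> r(i)\<close>
    (\<open>line_independent\<close>).

  \<^item> For each monomial \<open>\<mu> \<noteq> x\<^sub>0\<^sup>n\<close> of degree \<open>n\<close> and each row \<open>s\<close> there is an element of \<open>K\<close> that vanishes
    on the line and is mapped by \<open>A\<close> to \<open>\<mu> e\<^sub>s\<close> up to higher degree (\<open>monomial_lift\<close>), whereas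
    \<open>A(\<nn> K)\<close> has entries in \<open>\<nn>\<^sup>n\<^sup>+\<^sup>1\<close> (\<open>act_nK\<close>). This gives another \<open>r(i-1) (E - 1)\<close>.

  Hence \<open>r(i+1) \<ge> r(i) + r(i-1) (E - 1)\<close>. Finally \<open>r(i-1) \<ge> 1\<close>, as a minimal resolution that stops
  in positive degree would have an injective matrix with entries in \<open>\<mm>\<close>, although such a matrix
  kills \<open>\<mm>\<^sup>n\<^sup>-\<^sup>1\<close>, and one that stops at \<open>R\<^sup>r\<^sup>(\<^sup>0\<^sup>)\<close> makes \<open>M\<close> free.
\<close>

section \<open>Linear maps on free modules\<close>

lemma hom_into: "f \<in> module_hom R M N \<Longrightarrow> x \<in> carrier M \<Longrightarrow> f x \<in> carrier N"
  by (auto simp: module_hom_def)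

lemma module_homI:
  assumes "\<And>x. x \<in> carrier M \<Longrightarrow> f x \<in> carrier N"
    and "\<And>x y. x \<in> carrier M \<Longrightarrow> y \<in> carrier M \<Longrightarrow> f (x \<oplus>\<^bsub>M\<^esub> y) = f x \<oplus>\<^bsub>N\<^esub> f y"
    and "\<And>r x. r \<in> carrier R \<Longrightarrow> x \<in> carrier M \<Longrightarrow> f (r \<odot>\<^bsub>M\<^esub> x) = r \<odot>\<^bsub>N\<^esub> f x"
  shows "f \<in> module_hom R M N"
  using assms by (auto simp: module_hom_def)

lemma mod_homI: "module R M \<Longrightarrow> module R N \<Longrightarrow> f \<in> module_hom R M N \<Longrightarrow> mod_hom R M N f"
  by (simp add: mod_hom_def mod_hom_axioms_def)

lemma hom_compose:
  assumes "module R M" "f \<in> module_hom R M N" "g \<in> module_hom R N P"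
  shows "(\<lambda>x. g (f x)) \<in> module_hom R M P"
  using assms by (auto simp: module_hom_def Pi_iff)

lemma hom_add:
  assumes "module R M" "module R N" "f \<in> module_hom R M N" "g \<in> module_hom R M N"
  shows "(\<lambda>x. f x \<oplus>\<^bsub>N\<^esub> g x) \<in> module_hom R M N"
proof -
  interpret M: module R M by fact
  interpret N: module R N by fact
  interpret f: mod_hom R M N f by (rule mod_homI; fact)
  interpret g: mod_hom R M N g by (rule mod_homI; fact)
  show ?thesis
    by (rule module_homI) (auto simp: N.smult_r_distr N.M.add.m_ac)
qed

lemma hom_uminus:
  assumes "module R M" "module R N" "f \<in> module_hom R M N"
  shows "(\<lambda>x. \<ominus>\<^bsub>N\<^esub> f x) \<in> module_hom R M N"
proof -
  interpret M: module R M by fact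
  interpret N: module R N by fact
  interpret f: mod_hom R M N f by (rule mod_homI; fact)
  show ?thesis
    by (rule module_homI) (auto simp: N.smult_r_minus N.M.minus_add)
qed

lemma hom_minus:
  assumes "module R M" "module R N" "f \<in> module_hom R M N" "g \<in> module_hom R M N"
  shows "(\<lambda>x. f x \<ominus>\<^bsub>N\<^esub> g x) \<in> module_hom R M N"
  using hom_add[OF assms(1-3) hom_uminus[OF assms(1,2,4)]] by (simp add: a_minus_def)

lemma hom_finsum:
  assumes "module R M" "module R N" "f \<in> module_hom R M N" "finite A" "g \<in> A \<rightarrow> carrier M"
  shows "f (\<Oplus>\<^bsub>M\<^esub>a\<in>A. g a) = (\<Oplus>\<^bsub>N\<^esub>a\<in>A. f (g a))"
proof -
  interpret f: mod_hom R M N f by (rule mod_homI; fact)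
  show ?thesis using assms(4,5)
  proof (induct A rule: finite_induct)
    case (insert a A)
    then have "(\<Oplus>\<^bsub>N\<^esub>a\<in>insert a A. f (g a)) = f (g a) \<oplus>\<^bsub>N\<^esub> (\<Oplus>\<^bsub>N\<^esub>a\<in>A. f (g a))"
      by (intro f.N.M.finsum_insert) auto
    with insert show ?case by simp
  qed auto
qed

lemma submodule_preimage:
  assumes "module R M" "module R N" "f \<in> module_hom R M N" "submodule R P N"
  shows "submodule R {x \<in> carrier M. f x \<in> P} M"
proof -
  interpret f: mod_hom R M N f by (rule mod_homI; fact)
  interpret P: submodule R P N by fact
  show ?thesis by (rule submodule.intro) (auto intro: assms)
qed

lemma submodule_image:
  assumes "module R M" "module R N" "f \<in> module_hom R M N" "submodule R P M"
  shows "submodule R (f ` P) N"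
proof -
  interpret f: mod_hom R M N f by (rule mod_homI; fact)
  interpret P: submodule R P M by fact
  show ?thesis
  proof (rule submodule.intro)
    show "module R N" by fact
    show "f ` P \<subseteq> carrier N" using P.subset by auto
    show "\<zero>\<^bsub>N\<^esub> \<in> f ` P" by (rule image_eqI[where x = "\<zero>\<^bsub>M\<^esub>"]) simp_all
  next
    fix v w assume "v \<in> f ` P" "w \<in> f ` P"
    then obtain x y where "x \<in> P" "y \<in> P" "v = f x" "w = f y" by auto
    moreover from this have "x \<in> carrier M" "y \<in> carrier M" using P.subset by auto
    ultimately have "v \<oplus>\<^bsub>N\<^esub> w = f (x \<oplus>\<^bsub>M\<^esub> y)" "x \<oplus>\<^bsub>M\<^esub> y \<in> P" by simp_all
    then show "v \<oplus>\<^bsub>N\<^esub> w \<in> f ` P" by (rule image_eqI)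
  next
    fix c v assume c: "c \<in> carrier R" "v \<in> f ` P"
    then obtain x where x: "x \<in> P" "v = f x" by auto
    moreover from this have "x \<in> carrier M" using P.subset by auto
    ultimately have "c \<odot>\<^bsub>N\<^esub> v = f (c \<odot>\<^bsub>M\<^esub> x)" "c \<odot>\<^bsub>M\<^esub> x \<in> P" using c by simp_all
    then show "c \<odot>\<^bsub>N\<^esub> v \<in> f ` P" by (rule image_eqI)
  qed
qed

lemma submodule_carrier: "module R M \<Longrightarrow> submodule R (carrier M) M"
  unfolding submodule_def by (auto simp: module.smult_closed abelian_group_def abelian_monoid.a_closed
      abelian_monoid.zero_closed module_def)

lemma submodule_uminus:
  assumes "submodule R P M" "x \<in> P" shows "\<ominus>\<^bsub>M\<^esub> x \<in> P"
proof -
  interpret P: submodule R P M by fact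
  interpret M: module R M by (rule P.module)
  have x: "x \<in> carrier M" using assms P.subset by auto
  have "(\<ominus>\<^bsub>R\<^esub> \<one>\<^bsub>R\<^esub>) \<odot>\<^bsub>M\<^esub> x = \<ominus>\<^bsub>M\<^esub> x" using x by (simp add: M.smult_l_minus)
  then show ?thesis using P.smult_closed[of "\<ominus>\<^bsub>R\<^esub> \<one>\<^bsub>R\<^esub>" x] assms by simp
qed

lemma module_minus_eq_zeroD:
  assumes "module R M" "x \<in> carrier M" "y \<in> carrier M" "x \<ominus>\<^bsub>M\<^esub> y = \<zero>\<^bsub>M\<^esub>"
  shows "x = y"
proof -
  interpret M: module R M by fact
  have "(x \<ominus>\<^bsub>M\<^esub> y) \<oplus>\<^bsub>M\<^esub> y = x"
    using assms(2,3) by (simp add: a_minus_def M.M.add.m_assoc M.M.l_neg)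
  then show ?thesis using assms by simp
qed

lemma submodule_minus:
  assumes "submodule R P M" "x \<in> P" "y \<in> P" shows "x \<ominus>\<^bsub>M\<^esub> y \<in> P"
  unfolding a_minus_def using assms submodule_uminus submodule.m_closed by metis

lemma submodule_cancel_right:
  assumes "submodule R P M" "x \<ominus>\<^bsub>M\<^esub> y \<in> P" "y \<in> P" "x \<in> carrier M" shows "x \<in> P"
proof -
  interpret P: submodule R P M by fact
  interpret M: module R M by (rule P.module)
  have y: "y \<in> carrier M" using assms P.subset by auto
  have "(x \<ominus>\<^bsub>M\<^esub> y) \<oplus>\<^bsub>M\<^esub> y = x"
    using y assms(4) by (simp add: a_minus_def M.M.add.m_assoc M.M.l_neg)
  then show ?thesis using P.m_closed[OF assms(2,3)] by simp
qed

lemma submodule_finsum: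
  assumes "submodule R P M" "\<And>a. a \<in> A \<Longrightarrow> g a \<in> P" "finite A"
  shows "(\<Oplus>\<^bsub>M\<^esub>a\<in>A. g a) \<in> P"
proof -
  interpret P: submodule R P M by fact
  interpret M: module R M by (rule P.module)
  show ?thesis using assms(3,2)
  proof (induct A rule: finite_induct)
    case (insert a A)
    then have "(\<Oplus>\<^bsub>M\<^esub>a\<in>insert a A. g a) = g a \<oplus>\<^bsub>M\<^esub> (\<Oplus>\<^bsub>M\<^esub>a\<in>A. g a)"
      using P.subset by (intro M.M.finsum_insert) auto
    with insert show ?case by simp
  qed auto
qed

lemma span_minimal:
  assumes "submodule R P M" "S \<subseteq> P" shows "module.span R M S \<subseteq> P"
  using assms module.span_is_subset submodule.module by metis


subsection \<open>The free module of finitely supported functions\<close>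

lemma carrier_free_module_on:
  "f \<in> carrier (free_module_on R S) \<longleftrightarrow>
    (\<forall>s. f s \<in> carrier R \<or> s \<notin> S) \<and> (\<forall>s. s \<notin> S \<longrightarrow> f s = \<zero>\<^bsub>R\<^esub>) \<and> finite {s. f s \<noteq> \<zero>\<^bsub>R\<^esub>}"
  by (auto simp: free_module_on_def)

lemma free_module_on_ops [simp]:
  "\<zero>\<^bsub>free_module_on R S\<^esub> = (\<lambda>s. \<zero>\<^bsub>R\<^esub>)"
  "f \<oplus>\<^bsub>free_module_on R S\<^esub> g = (\<lambda>s. f s \<oplus>\<^bsub>R\<^esub> g s)"
  "r \<odot>\<^bsub>free_module_on R S\<^esub> f = (\<lambda>s. r \<otimes>\<^bsub>R\<^esub> f s)"
  by (auto simp: free_module_on_def)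

lemma free_module_on_coeff:
  assumes "cring R" "f \<in> carrier (free_module_on R S)" shows "f s \<in> carrier R"
proof -
  interpret cring R by fact
  show ?thesis using assms(2) by (cases "s \<in> S") (auto simp: carrier_free_module_on)
qed

lemma free_module_on_module:
  assumes "cring R" shows "module R (free_module_on R S)"
proof -
  interpret R: cring R by fact
  note cf = free_module_on_coeff[OF assms]
  show ?thesis
  proof (rule module_criteria; (intro allI impI ballI)?; (elim conjE)?)
    show "cring R" by fact
    show "\<zero>\<^bsub>free_module_on R S\<^esub> \<in> carrier (free_module_on R S)"
      by (simp add: carrier_free_module_on)
  next
    fix v w assume vw: "v \<in> carrier (free_module_on R S)" "w \<in> carrier (free_module_on R S)"
    have "{s. v s \<oplus>\<^bsub>R\<^esub> w s \<noteq> \<zero>\<^bsub>R\<^esub>} \<subseteq> {s. v s \<noteq> \<zero>\<^bsub>R\<^esub>} \<union> {s. w s \<noteq> \<zero>\<^bsub>R\<^esub>}" by auto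
    then show "v \<oplus>\<^bsub>free_module_on R S\<^esub> w \<in> carrier (free_module_on R S)"
      using vw cf[OF vw(1)] cf[OF vw(2)]
      by (auto simp: carrier_free_module_on intro: finite_subset)
    show "v \<oplus>\<^bsub>free_module_on R S\<^esub> w = w \<oplus>\<^bsub>free_module_on R S\<^esub> v"
      using cf[OF vw(1)] cf[OF vw(2)] by (auto simp: R.add.m_comm)
  next
    fix v assume v: "v \<in> carrier (free_module_on R S)"
    have "{s. \<ominus>\<^bsub>R\<^esub> v s \<noteq> \<zero>\<^bsub>R\<^esub>} \<subseteq> {s. v s \<noteq> \<zero>\<^bsub>R\<^esub>}" by auto
    then have "(\<lambda>s. \<ominus>\<^bsub>R\<^esub> v s) \<in> carrier (free_module_on R S)"
      using v cf[OF v] by (auto simp: carrier_free_module_on intro: finite_subset)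
    then show "\<exists>u\<in>carrier (free_module_on R S). v \<oplus>\<^bsub>free_module_on R S\<^esub> u = \<zero>\<^bsub>free_module_on R S\<^esub>"
      using cf[OF v] by (intro bexI) (auto simp: R.r_neg)
    show "v \<oplus>\<^bsub>free_module_on R S\<^esub> \<zero>\<^bsub>free_module_on R S\<^esub> = v" using cf[OF v] by auto
    show "\<one>\<^bsub>R\<^esub> \<odot>\<^bsub>free_module_on R S\<^esub> v = v" using cf[OF v] by auto
  next
    fix c v assume c: "c \<in> carrier R" "v \<in> carrier (free_module_on R S)"
    have "{s. c \<otimes>\<^bsub>R\<^esub> v s \<noteq> \<zero>\<^bsub>R\<^esub>} \<subseteq> {s. v s \<noteq> \<zero>\<^bsub>R\<^esub>}" using c by auto
    then show "c \<odot>\<^bsub>free_module_on R S\<^esub> v \<in> carrier (free_module_on R S)"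
      using c cf[OF c(2)] by (auto simp: carrier_free_module_on intro: finite_subset)
  qed (auto simp: cf[of _ S] R.add.m_assoc R.m_assoc R.l_distr R.r_distr)
qed

lemma free_gen_closed:
  assumes "cring R" "s \<in> S" shows "free_gen R s \<in> carrier (free_module_on R S)"
proof -
  interpret cring R by fact
  show ?thesis using assms by (auto simp: carrier_free_module_on free_gen_def)
qed

text \<open>
  The value of a function on the basis \<open>S\<close>, extended linearly to \<open>R\<^sup>(\<^sup>S\<^sup>)\<close>, at the vector \<open>f\<close>.
\<close>

definition lin_ext ::
  "('a, 'b) ring_scheme \<Rightarrow> ('a, 'm, 'c) module_scheme \<Rightarrow> ('s \<Rightarrow> 'm) \<Rightarrow> ('s \<Rightarrow> 'a) \<Rightarrow> 'm"
  where "lin_ext R P G f = (\<Oplus>\<^bsub>P\<^esub>s\<in>{s. f s \<noteq> \<zero>\<^bsub>R\<^esub>}. f s \<odot>\<^bsub>P\<^esub> G s)"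

lemma lin_ext_eq_finsum:
  assumes "module R P" "f \<in> carrier (free_module_on R S)" "G \<in> S \<rightarrow> carrier P"
    "finite T" "T \<subseteq> S" "{s. f s \<noteq> \<zero>\<^bsub>R\<^esub>} \<subseteq> T"
  shows "lin_ext R P G f = (\<Oplus>\<^bsub>P\<^esub>s\<in>T. f s \<odot>\<^bsub>P\<^esub> G s)"
proof -
  interpret P: module R P by fact
  have c: "f s \<in> carrier R" for s using free_module_on_coeff[OF P.R.is_cring assms(2)] .
  have Gc: "G s \<in> carrier P" if "s \<in> T" for s using that assms by auto
  show ?thesis unfolding lin_ext_def
    by (rule P.M.add.finprod_mono_neutral_cong_left) (use assms(4,6) c Gc in auto)
qed

lemma free_module_on_support:
  "f \<in> carrier (free_module_on R S) \<Longrightarrow> {s. f s \<noteq> \<zero>\<^bsub>R\<^esub>} \<subseteq> S"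
  "f \<in> carrier (free_module_on R S) \<Longrightarrow> finite {s. f s \<noteq> \<zero>\<^bsub>R\<^esub>}"
  by (auto simp: carrier_free_module_on)

lemma lin_ext_hom:
  assumes "module R P" "G \<in> S \<rightarrow> carrier P"
  shows "lin_ext R P G \<in> module_hom R (free_module_on R S) P"
proof -
  interpret P: module R P by fact
  note cf = free_module_on_coeff[OF P.R.is_cring]
  interpret L: module R "free_module_on R S" by (rule free_module_on_module) (rule P.R.is_cring)
  note eq = lin_ext_eq_finsum[OF assms(1) _ assms(2)]
  have Gc: "s \<in> S \<Longrightarrow> G s \<in> carrier P" for s using assms by auto
  show ?thesis
  proof (rule module_homI)
    fix f assume f: "f \<in> carrier (free_module_on R S)"
    note sf = free_module_on_support[OF f]
    show "lin_ext R P G f \<in> carrier P"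
      unfolding lin_ext_def using sf cf[OF f] assms(2) by (intro P.M.finsum_closed) auto
    fix r assume r: "r \<in> carrier R"
    have rf: "{s. (r \<odot>\<^bsub>free_module_on R S\<^esub> f) s \<noteq> \<zero>\<^bsub>R\<^esub>} \<subseteq> {s. f s \<noteq> \<zero>\<^bsub>R\<^esub>}" using r by auto
    have Gf: "f s \<noteq> \<zero>\<^bsub>R\<^esub> \<Longrightarrow> G s \<in> carrier P" for s using sf Gc by auto
    have "lin_ext R P G (r \<odot>\<^bsub>free_module_on R S\<^esub> f) = (\<Oplus>\<^bsub>P\<^esub>s\<in>{s. f s \<noteq> \<zero>\<^bsub>R\<^esub>}. (r \<otimes>\<^bsub>R\<^esub> f s) \<odot>\<^bsub>P\<^esub> G s)"
      using eq[OF L.smult_closed[OF r f] sf(2,1) rf] by simp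
    also have "\<dots> = (\<Oplus>\<^bsub>P\<^esub>s\<in>{s. f s \<noteq> \<zero>\<^bsub>R\<^esub>}. r \<odot>\<^bsub>P\<^esub> (f s \<odot>\<^bsub>P\<^esub> G s))"
      using cf[OF f] r Gf by (intro P.M.finsum_cong') (auto intro!: P.smult_assoc1)
    also have "\<dots> = r \<odot>\<^bsub>P\<^esub> lin_ext R P G f" unfolding lin_ext_def
      using sf cf[OF f] r assms(2) by (intro P.finsum_smult_ldistr[symmetric]) auto
    finally show "lin_ext R P G (r \<odot>\<^bsub>free_module_on R S\<^esub> f) = r \<odot>\<^bsub>P\<^esub> lin_ext R P G f" .
  next
    fix f g assume f: "f \<in> carrier (free_module_on R S)" and g: "g \<in> carrier (free_module_on R S)"
    note sf = free_module_on_support[OF f]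
    note sg = free_module_on_support[OF g]
    let ?T = "{s. f s \<noteq> \<zero>\<^bsub>R\<^esub>} \<union> {s. g s \<noteq> \<zero>\<^bsub>R\<^esub>}"
    have T: "finite ?T" "?T \<subseteq> S" using sf sg by auto
    have Gf: "s \<in> ?T \<Longrightarrow> G s \<in> carrier P" for s using T Gc by auto
    have sT: "{s. (f \<oplus>\<^bsub>free_module_on R S\<^esub> g) s \<noteq> \<zero>\<^bsub>R\<^esub>} \<subseteq> ?T" by auto
    have "lin_ext R P G (f \<oplus>\<^bsub>free_module_on R S\<^esub> g) = (\<Oplus>\<^bsub>P\<^esub>s\<in>?T. (f s \<oplus>\<^bsub>R\<^esub> g s) \<odot>\<^bsub>P\<^esub> G s)"
      using eq[OF L.M.a_closed[OF f g] T sT] by simp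
    also have "\<dots> = (\<Oplus>\<^bsub>P\<^esub>s\<in>?T. f s \<odot>\<^bsub>P\<^esub> G s \<oplus>\<^bsub>P\<^esub> g s \<odot>\<^bsub>P\<^esub> G s)"
      using cf[OF f] cf[OF g] Gf
      by (intro P.M.finsum_cong' refl Pi_I P.smult_l_distr P.M.a_closed P.smult_closed)
    also have "\<dots> = (\<Oplus>\<^bsub>P\<^esub>s\<in>?T. f s \<odot>\<^bsub>P\<^esub> G s) \<oplus>\<^bsub>P\<^esub> (\<Oplus>\<^bsub>P\<^esub>s\<in>?T. g s \<odot>\<^bsub>P\<^esub> G s)"
      using cf[OF f] cf[OF g] Gf
      by (intro P.M.finsum_addf Pi_I P.M.a_closed P.smult_closed)
    also have "\<dots> = lin_ext R P G f \<oplus>\<^bsub>P\<^esub> lin_ext R P G g"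
      using eq[OF f T] eq[OF g T] by auto
    finally show "lin_ext R P G (f \<oplus>\<^bsub>free_module_on R S\<^esub> g) = lin_ext R P G f \<oplus>\<^bsub>P\<^esub> lin_ext R P G g" .
  qed
qed

lemma lin_ext_gen:
  assumes "module R P" "G \<in> S \<rightarrow> carrier P" "s \<in> S"
  shows "lin_ext R P G (free_gen R s) = G s"
proof -
  interpret P: module R P by fact
  have G: "G s \<in> carrier P" using assms by auto
  have "lin_ext R P G (free_gen R s) = (\<Oplus>\<^bsub>P\<^esub>t\<in>{s}. free_gen R s t \<odot>\<^bsub>P\<^esub> G t)"
    by (rule lin_ext_eq_finsum[OF assms(1) free_gen_closed[OF P.R.is_cring assms(3)] assms(2)])
      (use assms in \<open>auto simp: free_gen_def\<close>)
  also have "\<dots> = G s" using G by (simp add: free_gen_def)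
  finally show ?thesis .
qed

lemma finsum_free_module_on:
  assumes "cring R" "finite A" "g \<in> A \<rightarrow> carrier (free_module_on R S)"
  shows "(\<Oplus>\<^bsub>free_module_on R S\<^esub>a\<in>A. g a) t = (\<Oplus>\<^bsub>R\<^esub>a\<in>A. g a t)"
proof -
  interpret R: cring R by fact
  interpret L: module R "free_module_on R S" by (rule free_module_on_module) fact
  note cf = free_module_on_coeff[OF assms(1)]
  show ?thesis using assms(2,3)
  proof (induct A rule: finite_induct)
    case (insert a A)
    have "(\<Oplus>\<^bsub>free_module_on R S\<^esub>a\<in>insert a A. g a)
        = g a \<oplus>\<^bsub>free_module_on R S\<^esub> (\<Oplus>\<^bsub>free_module_on R S\<^esub>a\<in>A. g a)"
      using insert by (intro L.M.finsum_insert) auto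
    moreover have "(\<Oplus>\<^bsub>R\<^esub>a\<in>insert a A. g a t) = g a t \<oplus>\<^bsub>R\<^esub> (\<Oplus>\<^bsub>R\<^esub>a\<in>A. g a t)"
      using insert by (intro R.finsum_insert Pi_I cf[of _ S]) auto
    ultimately show ?case using insert by simp
  qed auto
qed

lemma free_module_on_expand:
  assumes "cring R" "f \<in> carrier (free_module_on R S)"
  shows "lin_ext R (free_module_on R S) (free_gen R) f = f"
proof
  fix t
  interpret R: cring R by fact
  interpret L: module R "free_module_on R S" by (rule free_module_on_module) fact
  note sf = free_module_on_support[OF assms(2)]
  have c: "f s \<in> carrier R" for s using free_module_on_coeff[OF assms] .
  have "lin_ext R (free_module_on R S) (free_gen R) f t
      = (\<Oplus>\<^bsub>R\<^esub>s\<in>{s. f s \<noteq> \<zero>\<^bsub>R\<^esub>}. (f s \<odot>\<^bsub>free_module_on R S\<^esub> free_gen R s) t)"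
    unfolding lin_ext_def
    by (rule finsum_free_module_on[OF assms(1) sf(2)])
      (intro Pi_I L.smult_closed c free_gen_closed[OF assms(1)] subsetD[OF sf(1)])
  also have "\<dots> = (\<Oplus>\<^bsub>R\<^esub>s\<in>{s. f s \<noteq> \<zero>\<^bsub>R\<^esub>}. if t = s then f s else \<zero>\<^bsub>R\<^esub>)"
    using c by (intro R.finsum_cong') (auto simp: free_gen_def)
  also have "\<dots> = f t"
  proof (cases "f t = \<zero>\<^bsub>R\<^esub>")
    case True
    then have "(\<Oplus>\<^bsub>R\<^esub>s\<in>{s. f s \<noteq> \<zero>\<^bsub>R\<^esub>}. if t = s then f s else \<zero>\<^bsub>R\<^esub>) = (\<Oplus>\<^bsub>R\<^esub>s\<in>{s. f s \<noteq> \<zero>\<^bsub>R\<^esub>}. \<zero>\<^bsub>R\<^esub>)"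
      by (intro R.finsum_cong') auto
    then show ?thesis using True by simp
  next
    case False
    then show ?thesis using R.finsum_singleton[of t "{s. f s \<noteq> \<zero>\<^bsub>R\<^esub>}" f] sf c by auto
  qed
  finally show "lin_ext R (free_module_on R S) (free_gen R) f t = f t" .
qed

lemma free_module_on_hom_eq:
  assumes "module R P" "h \<in> module_hom R (free_module_on R S) P" "f \<in> carrier (free_module_on R S)"
  shows "h f = lin_ext R P (\<lambda>s. h (free_gen R s)) f"
proof -
  interpret P: module R P by fact
  have L: "module R (free_module_on R S)" by (rule free_module_on_module) (rule P.R.is_cring)
  interpret L: module R "free_module_on R S" by fact
  interpret h: mod_hom R "free_module_on R S" P h by (rule mod_homI; fact)
  note sf = free_module_on_support[OF assms(3)]
  note g = free_gen_closed[OF P.R.is_cring, of _ S]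
  have c: "f s \<in> carrier R" for s using free_module_on_coeff[OF P.R.is_cring assms(3)] .
  have "h f = h (lin_ext R (free_module_on R S) (free_gen R) f)"
    using free_module_on_expand[OF P.R.is_cring assms(3)] by simp
  also have "\<dots> = (\<Oplus>\<^bsub>P\<^esub>s\<in>{s. f s \<noteq> \<zero>\<^bsub>R\<^esub>}. h (f s \<odot>\<^bsub>free_module_on R S\<^esub> free_gen R s))"
    unfolding lin_ext_def
    by (rule hom_finsum[OF L assms(1,2) sf(2)])
      (intro Pi_I L.smult_closed c g subsetD[OF sf(1)])
  also have "\<dots> = lin_ext R P (\<lambda>s. h (free_gen R s)) f"
    unfolding lin_ext_def
    by (intro P.M.finsum_cong' refl Pi_I P.smult_closed h.f_smult h.f_im c g subsetD[OF sf(1)])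
  finally show ?thesis .
qed

lemma free_module_on_generated:
  assumes "cring R" "submodule R P (free_module_on R S)" "\<And>s. s \<in> S \<Longrightarrow> free_gen R s \<in> P"
  shows "carrier (free_module_on R S) \<subseteq> P"
proof
  fix f assume f: "f \<in> carrier (free_module_on R S)"
  note sf = free_module_on_support[OF f]
  have c: "f s \<in> carrier R" for s using free_module_on_coeff[OF assms(1) f] .
  have "lin_ext R (free_module_on R S) (free_gen R) f \<in> P"
    unfolding lin_ext_def
    by (rule submodule_finsum[OF assms(2) _ sf(2)])
      (use c sf(1) assms(3) submodule.smult_closed[OF assms(2)] in auto)
  then show "f \<in> P" using free_module_on_expand[OF assms(1) f] by simp
qed

lemma free_module_free_module_on:
  assumes "cring R" "\<one>\<^bsub>R\<^esub> \<noteq> \<zero>\<^bsub>R\<^esub>"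
  shows "free_module R (free_module_on R S)"
proof -
  interpret R: cring R by fact
  have L: "module R (free_module_on R S)" by (rule free_module_on_module) fact
  interpret L: module R "free_module_on R S" by fact
  let ?B = "free_gen R ` S"
  have B: "?B \<subseteq> carrier (free_module_on R S)" using free_gen_closed[OF assms(1)] by auto
  have "\<not> L.lin_dep ?B"
  proof
    assume "L.lin_dep ?B"
    then obtain A a v where A: "finite A" "A \<subseteq> ?B" "a \<in> A \<rightarrow> carrier R"
      "L.lincomb a A = \<zero>\<^bsub>free_module_on R S\<^esub>" "v \<in> A" "a v \<noteq> \<zero>\<^bsub>R\<^esub>"
      unfolding L.lin_dep_def by auto
    then obtain s where s: "s \<in> S" "v = free_gen R s" by auto
    have ac: "w \<in> A \<Longrightarrow> a w \<in> carrier R" for w using A(3) by auto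
    have "\<zero>\<^bsub>R\<^esub> = L.lincomb a A s" by (simp add: A(4))
    also have "\<dots> = (\<Oplus>\<^bsub>R\<^esub>w\<in>A. (a w \<odot>\<^bsub>free_module_on R S\<^esub> w) s)"
      unfolding L.lincomb_def
      by (rule finsum_free_module_on[OF assms(1) A(1)])
        (intro Pi_I L.smult_closed ac subsetD[OF B] subsetD[OF A(2)])
    also have "\<dots> = (\<Oplus>\<^bsub>R\<^esub>w\<in>A. if v = w then a w else \<zero>\<^bsub>R\<^esub>)"
    proof (rule R.finsum_cong')
      fix w assume w: "w \<in> A"
      then obtain t where t: "w = free_gen R t" using A(2) by auto
      show "(a w \<odot>\<^bsub>free_module_on R S\<^esub> w) s = (if v = w then a w else \<zero>\<^bsub>R\<^esub>)"
      proof (cases "v = w")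
        case True
        moreover have "v s = \<one>\<^bsub>R\<^esub>" using s by (simp add: free_gen_def)
        ultimately show ?thesis using ac[OF w] by simp
      next
        case False
        then have "w s = \<zero>\<^bsub>R\<^esub>" using s t by (auto simp: free_gen_def)
        then show ?thesis using ac[OF w] False by simp
      qed
    qed (use ac in auto)
    also have "\<dots> = a v"
      by (rule R.finsum_singleton) (use A ac in auto)
    finally show False using A(6) by simp
  qed
  moreover have "L.span ?B = carrier (free_module_on R S)"
    using free_module_on_generated[OF assms(1) L.span_is_submodule[OF B]] L.in_own_span[OF B]
      L.span_is_subset2[OF B] by blast
  ultimately show ?thesis using L B unfolding free_module_def by blast
qed

lemma hom_inverse:
  assumes "module R M" "module R N" "f \<in> module_hom R M N" "bij_betw f (carrier M) (carrier N)"
  shows "inv_into (carrier M) f \<in> module_hom R N M"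
proof -
  interpret f: mod_hom R M N f by (rule mod_homI; fact)
  let ?g = "inv_into (carrier M) f"
  have g: "?g y \<in> carrier M" "f (?g y) = y" if "y \<in> carrier N" for y
    using that assms(4) by (auto simp: bij_betw_def f_inv_into_f inv_into_into)
  have gf: "?g (f x) = x" if "x \<in> carrier M" for x
    using that assms(4) by (auto simp: bij_betw_def)
  show ?thesis
  proof (rule module_homI)
    fix x y assume "x \<in> carrier N" "y \<in> carrier N"
    then show "?g (x \<oplus>\<^bsub>N\<^esub> y) = ?g x \<oplus>\<^bsub>M\<^esub> ?g y" using gf[of "?g x \<oplus>\<^bsub>M\<^esub> ?g y"] g by simp
  next
    fix r x assume "r \<in> carrier R" "x \<in> carrier N"
    then show "?g (r \<odot>\<^bsub>N\<^esub> x) = r \<odot>\<^bsub>M\<^esub> ?g x" using gf[of "r \<odot>\<^bsub>M\<^esub> ?g x"] g by simp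
  qed (use g in auto)
qed

text \<open>
  The universal property of free modules in the form used throughout: a map out of a free module
  can be lifted along a map whose image contains its own. A basis \<open>B\<close> of \<open>F\<close> identifies \<open>F\<close> with
  \<open>R\<^sup>(\<^sup>B\<^sup>)\<close>, and there the lift is prescribed on the basis vectors.
\<close>

lemma free_module_lift:
  assumes F: "free_module R F" and G: "module R G" and H: "module R H"
    and p: "p \<in> module_hom R G H" and f: "f \<in> module_hom R F H"
    and im: "f ` carrier F \<subseteq> p ` carrier G"
  shows "\<exists>g \<in> module_hom R F G. \<forall>x\<in>carrier F. p (g x) = f x"
proof -
  have modF: "module R F" using F by (simp add: free_module_def)
  interpret F: module R F by fact
  obtain B where B: "B \<subseteq> carrier F" "\<not> F.lin_dep B" "F.span B = carrier F"
    using F unfolding free_module_def by auto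
  let ?L = "free_module_on R B"
  have L: "module R ?L" by (rule free_module_on_module) (rule F.R.is_cring)
  interpret L: module R ?L by fact
  define \<theta> where "\<theta> = lin_ext R F (\<lambda>b. b)"
  have \<theta>: "\<theta> \<in> module_hom R ?L F"
    unfolding \<theta>_def using B(1) by (intro lin_ext_hom modF) auto
  interpret \<theta>: mod_hom R ?L F \<theta> by (rule mod_homI; fact)
  have inj: "inj_on \<theta> (carrier ?L)"
  proof (rule inj_onI)
    fix c c' assume c: "c \<in> carrier ?L" "c' \<in> carrier ?L" "\<theta> c = \<theta> c'"
    define e where "e = c \<ominus>\<^bsub>?L\<^esub> c'"
    have e: "e \<in> carrier ?L" "\<theta> e = \<zero>\<^bsub>F\<^esub>"
      using c unfolding e_def a_minus_def
      by (simp_all add: F.M.r_neg del: free_module_on_ops)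
    note se = free_module_on_support[OF e(1)]
    have "F.lincomb e {s. e s \<noteq> \<zero>\<^bsub>R\<^esub>} = \<zero>\<^bsub>F\<^esub>"
      using e(2) by (simp add: F.lincomb_def \<theta>_def lin_ext_def)
    then have dep: "F.lin_dep B" if "e s \<noteq> \<zero>\<^bsub>R\<^esub>" for s
      unfolding F.lin_dep_def
      using se free_module_on_coeff[OF F.R.is_cring e(1)] that
      by (intro exI[of _ "{s. e s \<noteq> \<zero>\<^bsub>R\<^esub>}"] exI[of _ e] exI[of _ s]) simp
    have e0: "e = \<zero>\<^bsub>?L\<^esub>" using dep B(2) by auto
    show "c = c'"
      using module_minus_eq_zeroD[OF L c(1,2)] e0 unfolding e_def by simp
  qed
  have "F.span B \<subseteq> \<theta> ` carrier ?L"
  proof (rule span_minimal)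
    show "submodule R (\<theta> ` carrier ?L) F"
      by (rule submodule_image[OF L modF \<theta> submodule_carrier[OF L]])
    show "B \<subseteq> \<theta> ` carrier ?L"
    proof
      fix b assume b: "b \<in> B"
      have "\<theta> (free_gen R b) = b"
        unfolding \<theta>_def using B(1) b by (intro lin_ext_gen modF) auto
      then show "b \<in> \<theta> ` carrier ?L"
        using free_gen_closed[OF F.R.is_cring b] by (intro image_eqI[of b \<theta> "free_gen R b"]) simp_all
    qed
  qed
  then have bij: "bij_betw \<theta> (carrier ?L) (carrier F)"
    using inj B(3) by (auto simp: bij_betw_def)
  define G0 where "G0 b = (SOME y. y \<in> carrier G \<and> p y = f b)" for b
  have G0: "G0 b \<in> carrier G" "p (G0 b) = f b" if "b \<in> B" for b
  proof -
    have "f b \<in> p ` carrier G" using im B(1) that by blast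
    then have "\<exists>y. y \<in> carrier G \<and> p y = f b" by auto
    from someI_ex[OF this] show "G0 b \<in> carrier G" "p (G0 b) = f b" unfolding G0_def by auto
  qed
  define l where "l = lin_ext R G G0"
  have l: "l \<in> module_hom R ?L G"
    unfolding l_def using G0 by (intro lin_ext_hom G) auto
  have eq: "p (l c) = f (\<theta> c)" if c: "c \<in> carrier ?L" for c
  proof -
    have gens: "p (l (free_gen R b)) = f (\<theta> (free_gen R b))" if "b \<in> B" for b
    proof -
      have "l (free_gen R b) = G0 b" unfolding l_def by (rule lin_ext_gen[OF G _ that]) (use G0 in auto)
      moreover have "\<theta> (free_gen R b) = b"
        unfolding \<theta>_def using B(1) that by (intro lin_ext_gen modF) auto
      ultimately show ?thesis using G0[OF that] by simp
    qed
    have "p (l c) = lin_ext R H (\<lambda>b. p (l (free_gen R b))) c"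
      by (rule free_module_on_hom_eq[OF H hom_compose[OF L l p] c])
    also have "\<dots> = lin_ext R H (\<lambda>b. f (\<theta> (free_gen R b))) c"
      unfolding lin_ext_def
    proof (rule abelian_monoid.finsum_cong')
      show "abelian_monoid H" using H by (simp add: module_def abelian_group_def)
      show "(\<lambda>b. c b \<odot>\<^bsub>H\<^esub> f (\<theta> (free_gen R b))) \<in> {s. c s \<noteq> \<zero>\<^bsub>R\<^esub>} \<rightarrow> carrier H"
      proof (intro Pi_I module.smult_closed[OF H])
        fix b assume "b \<in> {s. c s \<noteq> \<zero>\<^bsub>R\<^esub>}"
        then have b: "b \<in> B" using free_module_on_support(1)[OF c] by auto
        show "c b \<in> carrier R" by (rule free_module_on_coeff[OF F.R.is_cring c])
        show "f (\<theta> (free_gen R b)) \<in> carrier H"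
          using hom_into[OF f hom_into[OF \<theta> free_gen_closed[OF F.R.is_cring b]]] .
      qed
      fix b assume "b \<in> {s. c s \<noteq> \<zero>\<^bsub>R\<^esub>}"
      then have b: "b \<in> B" using free_module_on_support(1)[OF c] by auto
      show "c b \<odot>\<^bsub>H\<^esub> p (l (free_gen R b)) = c b \<odot>\<^bsub>H\<^esub> f (\<theta> (free_gen R b))" using gens[OF b] by simp
    qed simp
    also have "\<dots> = f (\<theta> c)"
      by (rule free_module_on_hom_eq[OF H hom_compose[OF L \<theta> f] c, symmetric])
    finally show ?thesis .
  qed
  let ?i = "inv_into (carrier ?L) \<theta>"
  have i: "?i \<in> module_hom R F ?L" by (rule hom_inverse[OF L modF \<theta> bij])
  show ?thesis
  proof (rule bexI[of _ "\<lambda>x. l (?i x)"])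
    show "(\<lambda>x. l (?i x)) \<in> module_hom R F G" by (rule hom_compose[OF modF i l])
    show "\<forall>x\<in>carrier F. p (l (?i x)) = f x"
    proof
      fix x assume x: "x \<in> carrier F"
      have "\<theta> (?i x) = x" using bij x by (auto simp: bij_betw_def f_inv_into_f)
      then show "p (l (?i x)) = f x" using eq[OF hom_into[OF i x]] by simp
    qed
  qed
qed

lemma module_minus_closed:
  assumes "module R M" "x \<in> carrier M" "y \<in> carrier M" shows "x \<ominus>\<^bsub>M\<^esub> y \<in> carrier M"
proof -
  interpret M: module R M by fact
  show ?thesis using assms(2,3) by (rule M.M.minus_closed)
qed

lemma module_minus_self:
  assumes "module R M" "x \<in> carrier M" shows "x \<ominus>\<^bsub>M\<^esub> x = \<zero>\<^bsub>M\<^esub>"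
proof -
  interpret M: module R M by fact
  show ?thesis using assms(2) unfolding a_minus_def by (rule M.M.r_neg)
qed

lemma module_minus_minus:
  assumes "module R M" "x \<in> carrier M" "y \<in> carrier M"
  shows "x \<ominus>\<^bsub>M\<^esub> (x \<ominus>\<^bsub>M\<^esub> y) = y"
proof -
  interpret M: module R M by fact
  show ?thesis using assms(2,3) by (simp add: a_minus_def M.M.minus_add M.M.r_neg2)
qed

lemma module_minus_zero:
  assumes "module R M" "x \<in> carrier M" shows "x \<ominus>\<^bsub>M\<^esub> \<zero>\<^bsub>M\<^esub> = x"
proof -
  interpret M: module R M by fact
  show ?thesis using assms(2) by (simp add: a_minus_def)
qed

lemma hom_minus_eq:
  assumes "module R M" "module R N" "f \<in> module_hom R M N" "x \<in> carrier M" "y \<in> carrier M"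
  shows "f (x \<ominus>\<^bsub>M\<^esub> y) = f x \<ominus>\<^bsub>N\<^esub> f y"
proof -
  interpret f: mod_hom R M N f by (rule mod_homI; fact)
  show ?thesis using assms(4,5) by (rule f.f_minus)
qed

lemma hom_zero:
  assumes "module R M" "module R N" "f \<in> module_hom R M N" shows "f \<zero>\<^bsub>M\<^esub> = \<zero>\<^bsub>N\<^esub>"
  by (rule mod_hom.f0_is_0[OF mod_homI[OF assms]])


section \<open>Comparison of free resolutions\<close>

definition ideal_smult :: "('a, 'b) ring_scheme \<Rightarrow> 'a set \<Rightarrow> ('a, 'm, 'c) module_scheme \<Rightarrow> 'm set"
  where "ideal_smult R I M = module.span R M {r \<odot>\<^bsub>M\<^esub> x | r x. r \<in> I \<and> x \<in> carrier M}"

lemma ideal_smult_submodule: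
  assumes "module R M" "I \<subseteq> carrier R" shows "submodule R (ideal_smult R I M) M"
proof -
  interpret M: module R M by fact
  show ?thesis unfolding ideal_smult_def by (rule M.span_is_submodule) (use assms(2) in auto)
qed

lemma ideal_smult_mem:
  assumes "module R M" "I \<subseteq> carrier R" "r \<in> I" "x \<in> carrier M"
  shows "r \<odot>\<^bsub>M\<^esub> x \<in> ideal_smult R I M"
proof -
  interpret M: module R M by fact
  have "{r \<odot>\<^bsub>M\<^esub> x | r x. r \<in> I \<and> x \<in> carrier M} \<subseteq> carrier M" using assms(2) by auto
  from M.in_own_span[OF this] show ?thesis unfolding ideal_smult_def
    by (rule subsetD) (use assms(3,4) in blast)
qed

lemma ideal_smult_least:
  assumes "submodule R P M" "\<And>r x. r \<in> I \<Longrightarrow> x \<in> carrier M \<Longrightarrow> r \<odot>\<^bsub>M\<^esub> x \<in> P"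
  shows "ideal_smult R I M \<subseteq> P"
  unfolding ideal_smult_def by (rule span_minimal[OF assms(1)]) (use assms(2) in auto)

lemma ideal_smult_hom:
  assumes "module R M" "module R N" "f \<in> module_hom R M N" "I \<subseteq> carrier R" "x \<in> ideal_smult R I M"
  shows "f x \<in> ideal_smult R I N"
proof -
  interpret f: mod_hom R M N f by (rule mod_homI; fact)
  have "ideal_smult R I M \<subseteq> {x \<in> carrier M. f x \<in> ideal_smult R I N}"
  proof (rule ideal_smult_least)
    show "submodule R {x \<in> carrier M. f x \<in> ideal_smult R I N} M"
      by (rule submodule_preimage[OF assms(1-3) ideal_smult_submodule[OF assms(2,4)]])
    fix r x assume "r \<in> I" "x \<in> carrier M"
    moreover from this have "r \<in> carrier R" using assms(4) by auto
    ultimately show "r \<odot>\<^bsub>M\<^esub> x \<in> {x \<in> carrier M. f x \<in> ideal_smult R I N}"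
      using ideal_smult_mem[OF assms(2,4), of r "f x"] by simp
  qed
  from subsetD[OF this assms(5)] show ?thesis by simp
qed

text \<open>
  The augmentation \<open>e\<close> plays the part of the differential in degree \<open>0\<close>, so that exactness has one
  form in all degrees.
\<close>

definition resolution_kernel ::
  "('a, 'm, 'c) module_scheme \<Rightarrow> (nat \<Rightarrow> ('a, 'f) module) \<Rightarrow> (nat \<Rightarrow> 'f \<Rightarrow> 'f) \<Rightarrow> ('f \<Rightarrow> 'm)
    \<Rightarrow> nat \<Rightarrow> 'f set"
  where "resolution_kernel M F d e i =
    (case i of 0 \<Rightarrow> a_kernel (F 0) M e | Suc j \<Rightarrow> a_kernel (F (Suc j)) (F j) (d j))"

lemma free_resolutionD:
  assumes "free_resolution R M F d e"
  shows "free_module R (F i)" "module R (F i)" "d i \<in> module_hom R (F (Suc i)) (F i)"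
    "e \<in> module_hom R (F 0) M" "e ` carrier (F 0) = carrier M"
    "resolution_kernel M F d e i = d i ` carrier (F (Suc i))"
    "x \<in> carrier (F (Suc i)) \<Longrightarrow> d i x \<in> resolution_kernel M F d e i"
    "x \<in> resolution_kernel M F d e i \<Longrightarrow> x \<in> carrier (F i)"
    "x \<in> resolution_kernel M F d e 0 \<longleftrightarrow> x \<in> carrier (F 0) \<and> e x = \<zero>\<^bsub>M\<^esub>"
    "x \<in> resolution_kernel M F d e (Suc i) \<longleftrightarrow> x \<in> carrier (F (Suc i)) \<and> d i x = \<zero>\<^bsub>F i\<^esub>"
proof -
  show a: "free_module R (F i)" for i using assms by (simp add: free_resolution_def)
  show "module R (F i)" using a by (simp add: free_module_def)
  show d: "d i \<in> module_hom R (F (Suc i)) (F i)" for i using assms by (simp add: free_resolution_def)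
  show "e \<in> module_hom R (F 0) M" "e ` carrier (F 0) = carrier M"
    using assms by (simp_all add: free_resolution_def)
  show k: "resolution_kernel M F d e i = d i ` carrier (F (Suc i))" for i
    using assms by (cases i) (simp_all add: free_resolution_def resolution_kernel_def)
  show "x \<in> carrier (F (Suc i)) \<Longrightarrow> d i x \<in> resolution_kernel M F d e i" using k by auto
  show "x \<in> resolution_kernel M F d e i \<Longrightarrow> x \<in> carrier (F i)"
    using k hom_into[OF d] by auto
  show "x \<in> resolution_kernel M F d e 0 \<longleftrightarrow> x \<in> carrier (F 0) \<and> e x = \<zero>\<^bsub>M\<^esub>"
    by (simp add: resolution_kernel_def a_kernel_def')
  show "x \<in> resolution_kernel M F d e (Suc i) \<longleftrightarrow> x \<in> carrier (F (Suc i)) \<and> d i x = \<zero>\<^bsub>F i\<^esub>"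
    by (simp add: resolution_kernel_def a_kernel_def')
qed

text \<open>
  The comparison theorem: each component is lifted through the next differential, which is possible
  because the image of a differential is the kernel of the preceding one.
\<close>

lemma chain_map_exists:
  assumes M: "module R M" and F: "free_resolution R M F d e" and G: "free_resolution R M G d' e'"
  shows "\<exists>\<alpha>. (\<forall>i. \<alpha> i \<in> module_hom R (F i) (G i)) \<and> (\<forall>x\<in>carrier (F 0). e' (\<alpha> 0 x) = e x) \<and>
    (\<forall>i. \<forall>x\<in>carrier (F (Suc i)). d' i (\<alpha> (Suc i) x) = \<alpha> i (d i x))"
proof -
  note F' = free_resolutionD[OF F] and G' = free_resolutionD[OF G]
  let ?Z = "resolution_kernel M F d e" and ?Z' = "resolution_kernel M G d' e'"
  define P where "P n a \<longleftrightarrow> a \<in> module_hom R (F n) (G n) \<and> (\<forall>x\<in>?Z n. a x \<in> ?Z' n) \<and>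
    (n = 0 \<longrightarrow> (\<forall>x\<in>carrier (F 0). e' (a x) = e x))" for n a
  define Q where "Q n a b \<longleftrightarrow> (\<forall>x\<in>carrier (F (Suc n)). d' n (b x) = a (d n x))" for n a b
  have "\<exists>a. P 0 a"
  proof -
    obtain a where a: "a \<in> module_hom R (F 0) (G 0)" "\<forall>x\<in>carrier (F 0). e' (a x) = e x"
      using free_module_lift[OF F'(1) G'(2) M G'(4) F'(4)] F'(5) G'(5) by auto
    have "a x \<in> ?Z' 0" if "x \<in> ?Z 0" for x
      using that a(2) hom_into[OF a(1)] unfolding F'(9) G'(9) by simp
    then show ?thesis using a unfolding P_def by (intro exI[of _ a]) simp
  qed
  moreover have "\<exists>b. P (Suc n) b \<and> Q n a b" if "P n a" for n a
  proof -
    from that have a: "a \<in> module_hom R (F n) (G n)" and aZ: "\<forall>x\<in>?Z n. a x \<in> ?Z' n"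
      unfolding P_def by simp_all
    have "(\<lambda>x. a (d n x)) ` carrier (F (Suc n)) \<subseteq> d' n ` carrier (G (Suc n))"
    proof (rule image_subsetI)
      fix x assume "x \<in> carrier (F (Suc n))"
      from bspec[OF aZ F'(7)[OF this]] show "a (d n x) \<in> d' n ` carrier (G (Suc n))"
        by (simp only: G'(6))
    qed
    from free_module_lift[OF F'(1) G'(2) G'(2) G'(3) hom_compose[OF F'(2) F'(3) a] this]
    obtain b where b: "b \<in> module_hom R (F (Suc n)) (G (Suc n))"
      "\<forall>x\<in>carrier (F (Suc n)). d' n (b x) = a (d n x)"
      by (elim bexE) (rule that)
    have "b x \<in> ?Z' (Suc n)" if "x \<in> ?Z (Suc n)" for x
      using that b(2) hom_into[OF b(1)] hom_zero[OF F'(2) G'(2) a] unfolding F'(10) G'(10) by simp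
    with b show ?thesis unfolding P_def Q_def by (intro exI[of _ b]) simp
  qed
  ultimately have "\<exists>\<alpha>. \<forall>n. P n (\<alpha> n) \<and> Q n (\<alpha> n) (\<alpha> (Suc n))"
    by (rule dependent_nat_choice[where P = P and Q = Q])
  then obtain \<alpha> where \<alpha>': "\<forall>n. P n (\<alpha> n) \<and> Q n (\<alpha> n) (\<alpha> (Suc n))" by (rule exE)
  then have \<alpha>: "P n (\<alpha> n)" "Q n (\<alpha> n) (\<alpha> (Suc n))" for n by simp_all
  show ?thesis
  proof (intro exI[of _ \<alpha>] conjI allI)
    show "\<alpha> i \<in> module_hom R (F i) (G i)" for i using \<alpha>(1)[of i] unfolding P_def by (rule conjunct1)
    show "\<forall>x\<in>carrier (F 0). e' (\<alpha> 0 x) = e x" using \<alpha>(1)[of 0] unfolding P_def by simp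
    show "\<forall>x\<in>carrier (F (Suc i)). d' i (\<alpha> (Suc i) x) = \<alpha> i (d i x)" for i
      using \<alpha>(2)[of i] unfolding Q_def .
  qed
qed

text \<open>
  A chain endomorphism that lifts the identity of \<open>M\<close> is homotopic to the identity: once the
  homotopy is known in degree \<open>i\<close>, the remaining difference consists of cycles, hence of boundaries, and
  can be lifted. Modulo boundaries only the component of the homotopy in degree \<open>j\<close> is visible.
\<close>

lemma chain_homotopy_exists:
  assumes M: "module R M" and F: "free_resolution R M F d e"
    and \<phi>: "\<And>i. \<phi> i \<in> module_hom R (F i) (F i)" "\<And>x. x \<in> carrier (F 0) \<Longrightarrow> e (\<phi> 0 x) = e x"
      "\<And>i x. x \<in> carrier (F (Suc i)) \<Longrightarrow> d i (\<phi> (Suc i) x) = \<phi> i (d i x)"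
  shows "\<exists>h \<in> module_hom R (F j) (F (Suc j)). \<forall>x\<in>carrier (F (Suc j)).
    \<phi> (Suc j) x \<ominus>\<^bsub>F (Suc j)\<^esub> x \<ominus>\<^bsub>F (Suc j)\<^esub> h (d j x) \<in> resolution_kernel M F d e (Suc j)"
proof -
  note F' = free_resolutionD[OF F]
  let ?Z = "resolution_kernel M F d e"
  have id: "(\<lambda>x. x) \<in> module_hom R (F i) (F i)" for i by (auto simp: module_hom_def)
  have step: "\<exists>h \<in> module_hom R (F n) (F (Suc n)). \<forall>x\<in>carrier (F (Suc n)).
      \<phi> (Suc n) x \<ominus>\<^bsub>F (Suc n)\<^esub> x \<ominus>\<^bsub>F (Suc n)\<^esub> h (d n x) \<in> ?Z (Suc n)"
    if \<psi>: "\<psi> \<in> module_hom R (F n) (F n)" "\<forall>x\<in>carrier (F n). \<psi> x \<in> ?Z n"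
      "\<forall>x\<in>?Z n. \<psi> x = \<phi> n x \<ominus>\<^bsub>F n\<^esub> x" for n \<psi>
  proof -
    obtain h where h: "h \<in> module_hom R (F n) (F (Suc n))" "\<forall>x\<in>carrier (F n). d n (h x) = \<psi> x"
    proof -
      have "\<psi> ` carrier (F n) \<subseteq> d n ` carrier (F (Suc n))"
        using \<psi>(2) unfolding F'(6) by (intro image_subsetI) (rule bspec)
      from free_module_lift[OF F'(1) F'(2) F'(2) F'(3) \<psi>(1) this] that show thesis
        by (elim bexE)
    qed
    show ?thesis
    proof (intro bexI[of _ h] ballI)
      fix x assume x: "x \<in> carrier (F (Suc n))"
      have dx: "d n x \<in> ?Z n" using F'(7)[OF x] .
      have c: "\<phi> (Suc n) x \<in> carrier (F (Suc n))" "h (d n x) \<in> carrier (F (Suc n))"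
        using hom_into[OF \<phi>(1) x] hom_into[OF h(1) F'(8)[OF dx]] by auto
      note mc = module_minus_closed[OF F'(2)]
      have "d n (\<phi> (Suc n) x \<ominus>\<^bsub>F (Suc n)\<^esub> x \<ominus>\<^bsub>F (Suc n)\<^esub> h (d n x))
          = (d n (\<phi> (Suc n) x) \<ominus>\<^bsub>F n\<^esub> d n x) \<ominus>\<^bsub>F n\<^esub> d n (h (d n x))"
        by (simp only: hom_minus_eq[OF F'(2) F'(2) F'(3)] mc x c)
      also have "\<dots> = (\<phi> n (d n x) \<ominus>\<^bsub>F n\<^esub> d n x) \<ominus>\<^bsub>F n\<^esub> (\<phi> n (d n x) \<ominus>\<^bsub>F n\<^esub> d n x)"
        by (simp only: bspec[OF h(2) F'(8)[OF dx]] \<phi>(3)[OF x] bspec[OF \<psi>(3) dx])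
      also have "\<dots> = \<zero>\<^bsub>F n\<^esub>"
        by (intro module_minus_self[OF F'(2)] mc hom_into[OF \<phi>(1)] F'(8)[OF dx])
      finally show "\<phi> (Suc n) x \<ominus>\<^bsub>F (Suc n)\<^esub> x \<ominus>\<^bsub>F (Suc n)\<^esub> h (d n x) \<in> ?Z (Suc n)"
        unfolding F'(10) by (intro conjI mc x c)
    qed (rule h(1))
  qed
  have "\<exists>\<psi> \<in> module_hom R (F n) (F n). (\<forall>x\<in>carrier (F n). \<psi> x \<in> ?Z n) \<and>
      (\<forall>x\<in>?Z n. \<psi> x = \<phi> n x \<ominus>\<^bsub>F n\<^esub> x)" for n
  proof (induction n)
    case 0
    have "\<phi> 0 x \<ominus>\<^bsub>F 0\<^esub> x \<in> ?Z 0" if "x \<in> carrier (F 0)" for x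
      unfolding F'(9)
      by (simp only: hom_minus_eq[OF F'(2) M F'(4)] module_minus_closed[OF F'(2)] that
          hom_into[OF \<phi>(1) that] \<phi>(2)[OF that] module_minus_self[OF M] hom_into[OF F'(4) that])
    then show ?case
      by (intro bexI[of _ "\<lambda>x. \<phi> 0 x \<ominus>\<^bsub>F 0\<^esub> x"] hom_minus[OF F'(2) F'(2) \<phi>(1) id]) simp
  next
    case (Suc n)
    then obtain \<psi> where "\<psi> \<in> module_hom R (F n) (F n)" "\<forall>x\<in>carrier (F n). \<psi> x \<in> ?Z n"
      "\<forall>x\<in>?Z n. \<psi> x = \<phi> n x \<ominus>\<^bsub>F n\<^esub> x"
      by (elim bexE conjE) (rule that)
    from step[OF this] obtain h where h: "h \<in> module_hom R (F n) (F (Suc n))" "\<forall>x\<in>carrier (F (Suc n)).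
      \<phi> (Suc n) x \<ominus>\<^bsub>F (Suc n)\<^esub> x \<ominus>\<^bsub>F (Suc n)\<^esub> h (d n x) \<in> ?Z (Suc n)"
      by (elim bexE) (rule that)

    have "\<phi> (Suc n) x \<ominus>\<^bsub>F (Suc n)\<^esub> x \<ominus>\<^bsub>F (Suc n)\<^esub> h (d n x) = \<phi> (Suc n) x \<ominus>\<^bsub>F (Suc n)\<^esub> x"
      if "x \<in> ?Z (Suc n)" for x
      using that unfolding F'(10)
      by (elim conjE) (simp only: hom_zero[OF F'(2) F'(2) h(1)] module_minus_zero[OF F'(2)]
          module_minus_closed[OF F'(2)] hom_into[OF \<phi>(1)])
    then show ?case
      by (intro bexI[of _ "\<lambda>x. \<phi> (Suc n) x \<ominus>\<^bsub>F (Suc n)\<^esub> x \<ominus>\<^bsub>F (Suc n)\<^esub> h (d n x)"]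
          hom_minus[OF F'(2) F'(2) hom_minus[OF F'(2) F'(2) \<phi>(1) id] hom_compose[OF F'(2) F'(3) h(1)]]
          conjI h(2) ballI)
  qed
  from this[of j] show ?thesis
    by (elim bexE conjE) (rule step)
qed

definition tor_cycles ::
  "('a, 'b) ring_scheme \<Rightarrow> 'a set \<Rightarrow> (nat \<Rightarrow> ('a, 'f) module) \<Rightarrow> (nat \<Rightarrow> 'f \<Rightarrow> 'f) \<Rightarrow> nat \<Rightarrow> 'f set"
  where "tor_cycles R I F d j = {y \<in> carrier (F (Suc j)). d j y \<in> ideal_smult R I (F j)}"

text \<open>
  Homology in degree \<open>j + 1\<close> of \<open>(R/I) \<otimes> F\<close> is the module of \<open>y \<in> F\<^sub>j\<^sub>+\<^sub>1\<close> with \<open>d y \<in> I F\<^sub>j\<close>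
  modulo \<open>I F\<^sub>j\<^sub>+\<^sub>1 + d F\<^sub>j\<^sub>+\<^sub>2\<close>. That \<open>Y\<close> generates it is expressed by quantifying over submodules.
\<close>

definition tor_generated_by ::
  "('a, 'b) ring_scheme \<Rightarrow> 'a set \<Rightarrow> (nat \<Rightarrow> ('a, 'f) module) \<Rightarrow> (nat \<Rightarrow> 'f \<Rightarrow> 'f) \<Rightarrow> nat \<Rightarrow> 'f set \<Rightarrow> bool"
  where "tor_generated_by R I F d j Y \<longleftrightarrow> Y \<subseteq> tor_cycles R I F d j \<and>
    (\<forall>P. submodule R P (F (Suc j)) \<longrightarrow> Y \<subseteq> P \<longrightarrow> ideal_smult R I (F (Suc j)) \<subseteq> P \<longrightarrow>
       d (Suc j) ` carrier (F (Suc (Suc j))) \<subseteq> P \<longrightarrow> tor_cycles R I F d j \<subseteq> P)"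

text \<open>
  Tor is independent of the resolution. With chain maps \<open>\<alpha> : G \<rightarrow> F\<close> and \<open>\<beta> : F \<rightarrow> G\<close>, the images
  \<open>\<beta> Y\<close> generate: for a cycle \<open>w\<close> of \<open>G\<close> the element \<open>\<beta> (\<alpha> w)\<close> differs from \<open>w\<close> by \<open>h (d' w)\<close>, which is
  in \<open>I G\<close> because \<open>d' w\<close> is, and by a boundary.
\<close>

lemma tor_generated_transfer:
  assumes M: "module R M" and F: "free_resolution R M F d e" and G: "free_resolution R M G d' e'"
    and I: "I \<subseteq> carrier R" and Y: "tor_generated_by R I F d j Y" "finite Y"
  shows "\<exists>Y'. tor_generated_by R I G d' j Y' \<and> finite Y' \<and> card Y' \<le> card Y"
proof -
  note F' = free_resolutionD[OF F] and G' = free_resolutionD[OF G]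
  obtain \<alpha> where \<alpha>': "\<forall>i. \<alpha> i \<in> module_hom R (G i) (F i)" "\<forall>x\<in>carrier (G 0). e (\<alpha> 0 x) = e' x"
    "\<forall>i. \<forall>x\<in>carrier (G (Suc i)). d i (\<alpha> (Suc i) x) = \<alpha> i (d' i x)"
    using chain_map_exists[OF M G F] by (elim exE conjE) (rule that)
  note \<alpha> = \<alpha>'(1)[rule_format] \<alpha>'(2)[rule_format] \<alpha>'(3)[rule_format]
  obtain \<beta> where \<beta>': "\<forall>i. \<beta> i \<in> module_hom R (F i) (G i)" "\<forall>x\<in>carrier (F 0). e' (\<beta> 0 x) = e x"
    "\<forall>i. \<forall>x\<in>carrier (F (Suc i)). d' i (\<beta> (Suc i) x) = \<beta> i (d i x)"
    using chain_map_exists[OF M F G] by (elim exE conjE) (rule that)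
  note \<beta> = \<beta>'(1)[rule_format] \<beta>'(2)[rule_format] \<beta>'(3)[rule_format]
  have ba: "\<beta> i (\<alpha> i x) \<in> carrier (G i)" if "x \<in> carrier (G i)" for i x
    by (rule hom_into[OF \<beta>(1) hom_into[OF \<alpha>(1) that]])
  have "\<exists>h \<in> module_hom R (G j) (G (Suc j)). \<forall>x\<in>carrier (G (Suc j)).
      \<beta> (Suc j) (\<alpha> (Suc j) x) \<ominus>\<^bsub>G (Suc j)\<^esub> x \<ominus>\<^bsub>G (Suc j)\<^esub> h (d' j x)
        \<in> resolution_kernel M G d' e' (Suc j)"
  proof (rule chain_homotopy_exists[OF M G, where \<phi> = "\<lambda>i x. \<beta> i (\<alpha> i x)"])
    show "(\<lambda>x. \<beta> i (\<alpha> i x)) \<in> module_hom R (G i) (G i)" for i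
      by (rule hom_compose[OF G'(2) \<alpha>(1) \<beta>(1)])
    show "e' (\<beta> 0 (\<alpha> 0 x)) = e' x" if "x \<in> carrier (G 0)" for x
      using \<beta>(2)[OF hom_into[OF \<alpha>(1) that]] \<alpha>(2)[OF that] by simp
    show "d' i (\<beta> (Suc i) (\<alpha> (Suc i) x)) = \<beta> i (\<alpha> i (d' i x))" if "x \<in> carrier (G (Suc i))" for i x
      using \<beta>(3)[OF hom_into[OF \<alpha>(1) that]] \<alpha>(3)[OF that] by simp
  qed
  then obtain h where h: "h \<in> module_hom R (G j) (G (Suc j))"
    and h': "\<forall>x\<in>carrier (G (Suc j)).
      \<beta> (Suc j) (\<alpha> (Suc j) x) \<ominus>\<^bsub>G (Suc j)\<^esub> x \<ominus>\<^bsub>G (Suc j)\<^esub> h (d' j x)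
        \<in> resolution_kernel M G d' e' (Suc j)"
    by (elim bexE) (rule that)
  have cyc_\<alpha>: "\<alpha> (Suc j) w \<in> tor_cycles R I F d j" if "w \<in> tor_cycles R I G d' j" for w
  proof -
    have w: "w \<in> carrier (G (Suc j))" "d' j w \<in> ideal_smult R I (G j)"
      using that by (simp_all add: tor_cycles_def)
    show ?thesis
      using hom_into[OF \<alpha>(1) w(1)] ideal_smult_hom[OF G'(2) F'(2) \<alpha>(1) I w(2)]
      by (simp add: tor_cycles_def \<alpha>(3)[OF w(1)])
  qed
  have cyc_\<beta>: "\<beta> (Suc j) w \<in> tor_cycles R I G d' j" if "w \<in> tor_cycles R I F d j" for w
  proof -
    have w: "w \<in> carrier (F (Suc j))" "d j w \<in> ideal_smult R I (F j)"
      using that by (simp_all add: tor_cycles_def)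
    show ?thesis
      using hom_into[OF \<beta>(1) w(1)] ideal_smult_hom[OF F'(2) G'(2) \<beta>(1) I w(2)]
      by (simp add: tor_cycles_def \<beta>(3)[OF w(1)])
  qed
  have "tor_generated_by R I G d' j (\<beta> (Suc j) ` Y)"
    unfolding tor_generated_by_def
  proof (intro conjI allI impI)
    show "\<beta> (Suc j) ` Y \<subseteq> tor_cycles R I G d' j"
      using Y(1) cyc_\<beta> unfolding tor_generated_by_def by (intro image_subsetI) (elim conjE, drule (1) subsetD)
    fix P assume P: "submodule R P (G (Suc j))" "\<beta> (Suc j) ` Y \<subseteq> P"
      "ideal_smult R I (G (Suc j)) \<subseteq> P" "d' (Suc j) ` carrier (G (Suc (Suc j))) \<subseteq> P"
    let ?P = "{x \<in> carrier (F (Suc j)). \<beta> (Suc j) x \<in> P}"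
    have sub: "submodule R ?P (F (Suc j))"
      by (rule submodule_preimage[OF F'(2) G'(2) \<beta>(1) P(1)])
    have 1: "Y \<subseteq> ?P"
    proof
      fix y assume y: "y \<in> Y"
      then have "y \<in> carrier (F (Suc j))"
        using Y(1) by (auto simp only: tor_generated_by_def tor_cycles_def)
      then show "y \<in> ?P" using subsetD[OF P(2) imageI[OF y]] by simp
    qed
    have 2: "ideal_smult R I (F (Suc j)) \<subseteq> ?P"
    proof
      fix x assume x: "x \<in> ideal_smult R I (F (Suc j))"
      then have "x \<in> carrier (F (Suc j))"
        by (rule subsetD[OF submodule.subset[OF ideal_smult_submodule[OF F'(2) I]]])
      then show "x \<in> ?P" using subsetD[OF P(3) ideal_smult_hom[OF F'(2) G'(2) \<beta>(1) I x]] by simp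
    qed
    have 3: "d (Suc j) ` carrier (F (Suc (Suc j))) \<subseteq> ?P"
    proof clarify
      fix x assume x: "x \<in> carrier (F (Suc (Suc j)))"
      have "\<beta> (Suc j) (d (Suc j) x) \<in> P"
        unfolding \<beta>(3)[OF x, symmetric] by (rule subsetD[OF P(4) imageI[OF hom_into[OF \<beta>(1) x]]])
      then show "d (Suc j) x \<in> carrier (F (Suc j)) \<and> \<beta> (Suc j) (d (Suc j) x) \<in> P"
        using hom_into[OF F'(3) x] by simp
    qed
    have cyc: "tor_cycles R I F d j \<subseteq> ?P"
      using Y(1) sub 1 2 3 unfolding tor_generated_by_def by (elim conjE allE[of _ ?P]) simp
    show "tor_cycles R I G d' j \<subseteq> P"
    proof
      fix w assume w: "w \<in> tor_cycles R I G d' j"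
      then have wc: "w \<in> carrier (G (Suc j))" "d' j w \<in> ideal_smult R I (G j)"
        by (simp_all add: tor_cycles_def)
      let ?b = "\<beta> (Suc j) (\<alpha> (Suc j) w)"
      have b: "?b \<in> P" using subsetD[OF cyc cyc_\<alpha>[OF w]] by simp
      have bc: "?b \<in> carrier (G (Suc j))" by (rule hom_into[OF \<beta>(1) hom_into[OF \<alpha>(1) wc(1)]])
      have "?b \<ominus>\<^bsub>G (Suc j)\<^esub> w \<ominus>\<^bsub>G (Suc j)\<^esub> h (d' j w) \<in> P"
        by (rule subsetD[OF _ bspec[OF h' wc(1)]]) (simp only: G'(6) P(4))
      moreover have "h (d' j w) \<in> P"
        by (rule subsetD[OF P(3) ideal_smult_hom[OF G'(2) G'(2) h I wc(2)]])
      ultimately have "?b \<ominus>\<^bsub>G (Suc j)\<^esub> w \<in> P"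
        by (rule submodule_cancel_right[OF P(1)]) (rule module_minus_closed[OF G'(2) bc wc(1)])
      from submodule_minus[OF P(1) b this]
      have "?b \<ominus>\<^bsub>G (Suc j)\<^esub> (?b \<ominus>\<^bsub>G (Suc j)\<^esub> w) \<in> P" .
      moreover have "?b \<ominus>\<^bsub>G (Suc j)\<^esub> (?b \<ominus>\<^bsub>G (Suc j)\<^esub> w) = w"
        by (rule module_minus_minus[OF G'(2) bc wc(1)])
      ultimately show "w \<in> P" by simp
    qed
  qed
  then show ?thesis using Y(2) card_image_le[OF Y(2)]
    by (intro exI[of _ "\<beta> (Suc j) ` Y"]) simp
qed

section \<open>Quotient modules\<close>

text \<open>
  The module laws for \<open>H\<close> are inherited along \<open>q\<close>. This makes quotient modules and, below, spaces of
  residue classes into modules without treating cosets elementwise.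
\<close>

lemma module_of_surjection:
  assumes M: "module R M" and surj: "q ` carrier M = carrier H"
    and add: "\<And>x y. x \<in> carrier M \<Longrightarrow> y \<in> carrier M \<Longrightarrow> q (x \<oplus>\<^bsub>M\<^esub> y) = q x \<oplus>\<^bsub>H\<^esub> q y"
    and smult: "\<And>r x. r \<in> carrier R \<Longrightarrow> x \<in> carrier M \<Longrightarrow> q (r \<odot>\<^bsub>M\<^esub> x) = r \<odot>\<^bsub>H\<^esub> q x"
    and zero: "q \<zero>\<^bsub>M\<^esub> = \<zero>\<^bsub>H\<^esub>"
  shows "module R H" and "q \<in> module_hom R M H"
proof -
  interpret M: module R M by fact
  have qc: "q x \<in> carrier H" if "x \<in> carrier M" for x using surj that by blast
  have rep: "\<exists>x\<in>carrier M. h = q x" if "h \<in> carrier H" for h using surj that by blast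
  show "q \<in> module_hom R M H" by (rule module_homI) (simp_all add: qc add smult)
  note qs = add[symmetric] smult[symmetric] zero[symmetric]
  show "module R H"
  proof (rule module_criteria; (intro allI impI ballI)?; (elim conjE)?)
    show "cring R" by (rule M.R.is_cring)
    show "\<zero>\<^bsub>H\<^esub> \<in> carrier H" unfolding zero[symmetric] by (rule qc) simp
  next
    fix v w assume "v \<in> carrier H" "w \<in> carrier H"
    then obtain x y where x: "x \<in> carrier M" "v = q x" and y: "y \<in> carrier M" "w = q y"
      using rep by metis
    show "v \<oplus>\<^bsub>H\<^esub> w \<in> carrier H" using x y by (simp add: qs qc)
    show "v \<oplus>\<^bsub>H\<^esub> w = w \<oplus>\<^bsub>H\<^esub> v" using x y by (simp add: qs M.M.a_comm)
  next
    fix v assume "v \<in> carrier H"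
    then obtain x where x: "x \<in> carrier M" "v = q x" using rep by metis
    show "\<exists>u\<in>carrier H. v \<oplus>\<^bsub>H\<^esub> u = \<zero>\<^bsub>H\<^esub>"
      using x by (intro bexI[of _ "q (\<ominus>\<^bsub>M\<^esub> x)"]) (simp_all add: qs qc M.M.r_neg)
    show "v \<oplus>\<^bsub>H\<^esub> \<zero>\<^bsub>H\<^esub> = v" using x by (simp add: qs)
    show "\<one>\<^bsub>R\<^esub> \<odot>\<^bsub>H\<^esub> v = v" using x by (simp add: qs)
  next
    fix c v assume c: "c \<in> carrier R" "v \<in> carrier H"
    then obtain x where x: "x \<in> carrier M" "v = q x" using rep by metis
    show "c \<odot>\<^bsub>H\<^esub> v \<in> carrier H" using x c by (simp add: qs qc)
  next
    fix u v w assume "u \<in> carrier H" "v \<in> carrier H" "w \<in> carrier H"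
    then obtain x y z where "x \<in> carrier M" "u = q x" "y \<in> carrier M" "v = q y"
      "z \<in> carrier M" "w = q z" using rep by metis
    then show "u \<oplus>\<^bsub>H\<^esub> v \<oplus>\<^bsub>H\<^esub> w = u \<oplus>\<^bsub>H\<^esub> (v \<oplus>\<^bsub>H\<^esub> w)" by (simp add: qs M.M.a_assoc)
  next
    fix a b v assume ab: "a \<in> carrier R" "b \<in> carrier R" "v \<in> carrier H"
    then obtain x where x: "x \<in> carrier M" "v = q x" using rep by metis
    show "(a \<otimes>\<^bsub>R\<^esub> b) \<odot>\<^bsub>H\<^esub> v = a \<odot>\<^bsub>H\<^esub> (b \<odot>\<^bsub>H\<^esub> v)" using x ab by (simp add: qs M.smult_assoc1)
    show "(a \<oplus>\<^bsub>R\<^esub> b) \<odot>\<^bsub>H\<^esub> v = a \<odot>\<^bsub>H\<^esub> v \<oplus>\<^bsub>H\<^esub> b \<odot>\<^bsub>H\<^esub> v" using x ab by (simp add: qs M.smult_l_distr)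
  next
    fix a v w assume a: "a \<in> carrier R" "v \<in> carrier H" "w \<in> carrier H"
    then obtain x y where x: "x \<in> carrier M" "v = q x" and y: "y \<in> carrier M" "w = q y"
      using rep by metis
    show "a \<odot>\<^bsub>H\<^esub> (v \<oplus>\<^bsub>H\<^esub> w) = a \<odot>\<^bsub>H\<^esub> v \<oplus>\<^bsub>H\<^esub> a \<odot>\<^bsub>H\<^esub> w"
      using x y a by (simp add: qs M.smult_r_distr)
  qed
qed

lemma submodule_abelian_subgroup:
  assumes "submodule R N M" shows "abelian_subgroup N M"
proof (rule abelian_subgroupI3[OF additive_subgroupI])
  interpret N: submodule R N M by fact
  interpret M: module R M by (rule N.module)
  show "abelian_group M" by (rule M.M.abelian_group_axioms)
  show "subgroup N (add_monoid M)"
  proof (rule subgroup.intro)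
    show "inv\<^bsub>add_monoid M\<^esub> x \<in> N" if "x \<in> N" for x
      using submodule_uminus[OF assms that] by (simp add: a_inv_def)
  qed (simp_all add: N.subset)
qed

lemma coset_eq_iff:
  assumes "submodule R N M" "x \<in> carrier M" "y \<in> carrier M"
  shows "N +>\<^bsub>M\<^esub> x = N +>\<^bsub>M\<^esub> y \<longleftrightarrow> x \<ominus>\<^bsub>M\<^esub> y \<in> N"
proof -
  interpret N: submodule R N M by fact
  interpret M: module R M by (rule N.module)
  interpret A: abelian_subgroup N M by (rule submodule_abelian_subgroup) fact
  show ?thesis
  proof
    assume "N +>\<^bsub>M\<^esub> x = N +>\<^bsub>M\<^esub> y"
    then have "x \<in> N +>\<^bsub>M\<^esub> y" using A.a_rcos_self[OF assms(2)] by simp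
    then obtain h where h: "h \<in> N" "x = h \<oplus>\<^bsub>M\<^esub> y" by (auto simp: a_r_coset_def')
    then have "x \<ominus>\<^bsub>M\<^esub> y = h"
      using subsetD[OF N.subset h(1)] assms(3) by (simp add: a_minus_def M.M.a_assoc M.M.r_neg)
    with h show "x \<ominus>\<^bsub>M\<^esub> y \<in> N" by simp
  next
    assume a: "x \<ominus>\<^bsub>M\<^esub> y \<in> N"
    have "x = (x \<ominus>\<^bsub>M\<^esub> y) \<oplus>\<^bsub>M\<^esub> y"
      using assms(2,3) by (simp add: a_minus_def M.M.a_assoc M.M.l_neg)
    with a have "x \<in> N +>\<^bsub>M\<^esub> y" unfolding a_r_coset_def' by blast
    from A.a_repr_independence'[OF this assms(3)] show "N +>\<^bsub>M\<^esub> x = N +>\<^bsub>M\<^esub> y" by simp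
  qed
qed

lemma coset_eq_submodule_iff:
  assumes "submodule R N M" "x \<in> carrier M"
  shows "N +>\<^bsub>M\<^esub> x = N \<longleftrightarrow> x \<in> N"
proof -
  interpret N: submodule R N M by fact
  interpret M: module R M by (rule N.module)
  interpret A: abelian_subgroup N M by (rule submodule_abelian_subgroup) fact
  have "N +>\<^bsub>M\<^esub> \<zero>\<^bsub>M\<^esub> = N"
    by (rule M.M.a_coset_join2[OF M.M.zero_closed A.a_subgroup N.zero_closed])
  then show ?thesis
    using coset_eq_iff[OF assms M.M.zero_closed] module_minus_zero[OF N.module assms(2)] by simp
qed

lemma quot_module_projection:
  assumes "submodule R N M"
  shows "module R (quot_module M N)"
    and "(\<lambda>x. N +>\<^bsub>M\<^esub> x) \<in> module_hom R M (quot_module M N)"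
    and "(\<lambda>x. N +>\<^bsub>M\<^esub> x) ` carrier M = carrier (quot_module M N)"
proof -
  interpret N: submodule R N M by fact
  interpret M: module R M by (rule N.module)
  interpret A: abelian_subgroup N M by (rule submodule_abelian_subgroup) fact
  let ?H = "quot_module M N"
  have surj: "(\<lambda>x. N +>\<^bsub>M\<^esub> x) ` carrier M = carrier ?H"
    by (auto simp: quot_module_def A_RCOSETS_def')
  have add: "N +>\<^bsub>M\<^esub> (x \<oplus>\<^bsub>M\<^esub> y) = (N +>\<^bsub>M\<^esub> x) \<oplus>\<^bsub>?H\<^esub> (N +>\<^bsub>M\<^esub> y)"
    if "x \<in> carrier M" "y \<in> carrier M" for x y
    using A.a_rcos_sum[OF that] by (simp add: quot_module_def)
  have smult: "N +>\<^bsub>M\<^esub> (r \<odot>\<^bsub>M\<^esub> x) = r \<odot>\<^bsub>?H\<^esub> (N +>\<^bsub>M\<^esub> x)" if r: "r \<in> carrier R" and x: "x \<in> carrier M" for r x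
  proof -
    have "N +>\<^bsub>M\<^esub> (r \<odot>\<^bsub>M\<^esub> y) = N +>\<^bsub>M\<^esub> (r \<odot>\<^bsub>M\<^esub> x)" if y: "y \<in> N +>\<^bsub>M\<^esub> x" for y
    proof -
      from y obtain h where h: "h \<in> N" "y = h \<oplus>\<^bsub>M\<^esub> x" by (auto simp: a_r_coset_def')
      have hc: "h \<in> carrier M" using h(1) N.subset by auto
      have "r \<odot>\<^bsub>M\<^esub> y \<ominus>\<^bsub>M\<^esub> r \<odot>\<^bsub>M\<^esub> x = r \<odot>\<^bsub>M\<^esub> h"
        using h(2) hc r x by (simp add: M.smult_r_distr a_minus_def M.M.a_assoc M.M.r_neg)
      then have "r \<odot>\<^bsub>M\<^esub> y \<ominus>\<^bsub>M\<^esub> r \<odot>\<^bsub>M\<^esub> x \<in> N" using N.smult_closed[OF r h(1)] by simp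
      then show ?thesis using coset_eq_iff[OF assms, of "r \<odot>\<^bsub>M\<^esub> y" "r \<odot>\<^bsub>M\<^esub> x"] h(2) hc r x by simp
    qed
    moreover have "x \<in> N +>\<^bsub>M\<^esub> x" by (rule A.a_rcos_self[OF x])
    ultimately have "(\<Union>y\<in>N +>\<^bsub>M\<^esub> x. N +>\<^bsub>M\<^esub> (r \<odot>\<^bsub>M\<^esub> y)) = N +>\<^bsub>M\<^esub> (r \<odot>\<^bsub>M\<^esub> x)" by blast
    then show ?thesis by (simp add: quot_module_def)
  qed
  have zero: "N +>\<^bsub>M\<^esub> \<zero>\<^bsub>M\<^esub> = \<zero>\<^bsub>?H\<^esub>"
    using coset_eq_submodule_iff[OF assms M.M.zero_closed] by (simp add: quot_module_def)
  show "module R ?H" "(\<lambda>x. N +>\<^bsub>M\<^esub> x) \<in> module_hom R M ?H"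
    using module_of_surjection[OF N.module surj add smult zero] by auto
  show "(\<lambda>x. N +>\<^bsub>M\<^esub> x) ` carrier M = carrier ?H" by (rule surj)
qed


section \<open>Tensoring with the residue field\<close>

locale residue_ring =
  fixes R :: "('a, 'b) ring_scheme" and I :: "'a set"
  assumes cring: "cring R" and maximal: "maximalideal I R" and max_ideal_eq: "max_ideal R = I"
begin

abbreviation k where "k \<equiv> residue_field_module R"

lemma ideal_I: "ideal I R" using maximal by (simp add: maximalideal_def)

lemma I_subset: "I \<subseteq> carrier R"
  using additive_subgroup.a_subset[OF ideal.axioms(1)[OF ideal_I]] .

lemma abelian_subgroup_I: "abelian_subgroup I R"
  using abelian_subgroupI3[OF ideal.axioms(1)[OF ideal_I]] cring
  by (simp add: cring_def ring_def)

lemma carrier_k: "carrier k = (\<lambda>r. I +>\<^bsub>R\<^esub> r) ` carrier R"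
  by (auto simp: residue_field_module_def residue_field_def max_ideal_eq FactRing_def A_RCOSETS_def')

lemma class_in_k: "r \<in> carrier R \<Longrightarrow> I +>\<^bsub>R\<^esub> r \<in> carrier k"
  unfolding carrier_k by (rule imageI)

lemma k_add:
  "r \<in> carrier R \<Longrightarrow> s \<in> carrier R \<Longrightarrow> (I +>\<^bsub>R\<^esub> r) \<oplus>\<^bsub>k\<^esub> (I +>\<^bsub>R\<^esub> s) = I +>\<^bsub>R\<^esub> (r \<oplus>\<^bsub>R\<^esub> s)"
  using abelian_subgroup.a_rcos_sum[OF abelian_subgroup_I]
  by (simp add: residue_field_module_def residue_field_def max_ideal_eq FactRing_def)

lemma k_smult:
  "r \<in> carrier R \<Longrightarrow> s \<in> carrier R \<Longrightarrow> r \<odot>\<^bsub>k\<^esub> (I +>\<^bsub>R\<^esub> s) = I +>\<^bsub>R\<^esub> (r \<otimes>\<^bsub>R\<^esub> s)"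
  using ideal.rcoset_mult_add[OF ideal_I]
  by (simp add: residue_field_module_def residue_field_def max_ideal_eq FactRing_def)

lemma class_eq_iff:
  assumes "r \<in> carrier R" "s \<in> carrier R"
  shows "I +>\<^bsub>R\<^esub> r = I +>\<^bsub>R\<^esub> s \<longleftrightarrow> r \<ominus>\<^bsub>R\<^esub> s \<in> I"
proof -
  interpret cring R by (rule cring)
  interpret abelian_subgroup I R by (rule abelian_subgroup_I)
  show ?thesis
  proof
    assume "I +>\<^bsub>R\<^esub> r = I +>\<^bsub>R\<^esub> s"
    then have "r \<in> I +>\<^bsub>R\<^esub> s" using a_rcos_self[OF assms(1)] by simp
    then obtain h where h: "h \<in> I" "r = h \<oplus>\<^bsub>R\<^esub> s" by (auto simp: a_r_coset_def')
    then have "r \<ominus>\<^bsub>R\<^esub> s = h" using subsetD[OF I_subset h(1)] assms(2) by (simp add: minus_eq a_assoc r_neg)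
    with h show "r \<ominus>\<^bsub>R\<^esub> s \<in> I" by simp
  next
    assume a: "r \<ominus>\<^bsub>R\<^esub> s \<in> I"
    have "r = (r \<ominus>\<^bsub>R\<^esub> s) \<oplus>\<^bsub>R\<^esub> s" using assms by (simp add: minus_eq a_assoc l_neg)
    with a have "r \<in> I +>\<^bsub>R\<^esub> s" unfolding a_r_coset_def' by blast
    from a_repr_independence'[OF this assms(2)] show "I +>\<^bsub>R\<^esub> r = I +>\<^bsub>R\<^esub> s" by simp
  qed
qed

definition rep :: "'a set \<Rightarrow> 'a" where "rep c = (SOME r. r \<in> c)"

lemma rep:
  assumes "c \<in> carrier k" shows "rep c \<in> carrier R" and "I +>\<^bsub>R\<^esub> rep c = c"
proof -
  interpret abelian_subgroup I R by (rule abelian_subgroup_I)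
  obtain r where r: "r \<in> carrier R" "c = I +>\<^bsub>R\<^esub> r" using assms unfolding carrier_k by auto
  have "r \<in> c" using a_rcos_self[OF r(1)] r(2) by simp
  then have rc: "rep c \<in> c" unfolding rep_def by (rule someI)
  then show "rep c \<in> carrier R"
    using r a_r_coset_subset_G[OF a_subset r(1)] by blast
  show "I +>\<^bsub>R\<^esub> rep c = c" using a_repr_independence'[OF rc[unfolded r(2)] r(1)] r(2) by simp
qed

end

context residue_ring
begin

abbreviation tfree :: "('a, 'f, 'e) module_scheme \<Rightarrow> ('a, 'a set \<times> 'f \<Rightarrow> 'a) module"
  where "tfree F \<equiv> free_module_on R (carrier k \<times> carrier F)"

abbreviation trel :: "('a, 'f, 'e) module_scheme \<Rightarrow> ('a set \<times> 'f \<Rightarrow> 'a) set"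
  where "trel F \<equiv> tensor_submodule R k F"

text \<open>
  As \<open>R\<close> maps onto \<open>k\<close>, every tensor is of the form \<open>1 \<otimes> y\<close>, and \<open>1 \<otimes> y = 0\<close> exactly for
  \<open>y \<in> I F\<close>. Thus \<open>k \<otimes> F\<close> is \<open>F / I F\<close>, and all computations can be done in \<open>F\<close>.
\<close>

definition unit_tensor :: "('a, 'f, 'e) module_scheme \<Rightarrow> 'f \<Rightarrow> ('a set \<times> 'f \<Rightarrow> 'a) set"
  where "unit_tensor F y = pure_tensor R k F (I +>\<^bsub>R\<^esub> \<one>\<^bsub>R\<^esub>) y"

lemma one_closed: "\<one>\<^bsub>R\<^esub> \<in> carrier R" and zero_closed: "\<zero>\<^bsub>R\<^esub> \<in> carrier R"
proof -
  interpret cring R by (rule cring)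
  show "\<one>\<^bsub>R\<^esub> \<in> carrier R" "\<zero>\<^bsub>R\<^esub> \<in> carrier R" by simp_all
qed

lemma tfree_module: "module R (tfree F)"
  by (rule free_module_on_module[OF cring])

lemma k_closed:
  shows "c \<in> carrier k \<Longrightarrow> c' \<in> carrier k \<Longrightarrow> c \<oplus>\<^bsub>k\<^esub> c' \<in> carrier k"
    and "r \<in> carrier R \<Longrightarrow> c \<in> carrier k \<Longrightarrow> r \<odot>\<^bsub>k\<^esub> c \<in> carrier k"
proof -
  interpret cring R by (rule cring)
  show "c \<in> carrier k \<Longrightarrow> c' \<in> carrier k \<Longrightarrow> c \<oplus>\<^bsub>k\<^esub> c' \<in> carrier k"
    using k_add[OF rep(1) rep(1)] rep class_in_k[OF add.m_closed[OF rep(1) rep(1)]] by metis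
  show "r \<in> carrier R \<Longrightarrow> c \<in> carrier k \<Longrightarrow> r \<odot>\<^bsub>k\<^esub> c \<in> carrier k"
    using k_smult[OF _ rep(1)] rep class_in_k[OF m_closed[OF _ rep(1)]] by metis
qed

lemma gen_closed:
  "c \<in> carrier k \<Longrightarrow> y \<in> carrier F \<Longrightarrow> free_gen R (c, y) \<in> carrier (tfree F)"
  by (rule free_gen_closed[OF cring]) simp

lemma tensor_relations_cases:
  assumes "f \<in> tensor_relations R k F"
  obtains (add_left) x x' y where "x \<in> carrier k" "x' \<in> carrier k" "y \<in> carrier F"
      "f = free_gen R (x \<oplus>\<^bsub>k\<^esub> x', y) \<ominus>\<^bsub>tfree F\<^esub> (free_gen R (x, y) \<oplus>\<^bsub>tfree F\<^esub> free_gen R (x', y))"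
    | (add_right) x y y' where "x \<in> carrier k" "y \<in> carrier F" "y' \<in> carrier F"
      "f = free_gen R (x, y \<oplus>\<^bsub>F\<^esub> y') \<ominus>\<^bsub>tfree F\<^esub> (free_gen R (x, y) \<oplus>\<^bsub>tfree F\<^esub> free_gen R (x, y'))"
    | (smult_left) r x y where "r \<in> carrier R" "x \<in> carrier k" "y \<in> carrier F"
      "f = free_gen R (r \<odot>\<^bsub>k\<^esub> x, y) \<ominus>\<^bsub>tfree F\<^esub> r \<odot>\<^bsub>tfree F\<^esub> free_gen R (x, y)"
    | (smult_right) r x y where "r \<in> carrier R" "x \<in> carrier k" "y \<in> carrier F"
      "f = free_gen R (x, r \<odot>\<^bsub>F\<^esub> y) \<ominus>\<^bsub>tfree F\<^esub> r \<odot>\<^bsub>tfree F\<^esub> free_gen R (x, y)"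
  using assms unfolding tensor_relations_def Let_def Un_iff mem_Collect_eq
  by (elim disjE exE conjE) (erule (3) add_left add_right smult_left smult_right)+

lemma trel_submodule:
  assumes F: "module R F" shows "submodule R (trel F) (tfree F)"
proof -
  interpret F: module R F by (rule F)
  interpret L: module R "tfree F" by (rule tfree_module)
  have "tensor_relations R k F \<subseteq> carrier (tfree F)"
  proof
    fix f assume "f \<in> tensor_relations R k F"
    then show "f \<in> carrier (tfree F)"
      by (cases rule: tensor_relations_cases; hypsubst)
        (intro L.M.minus_closed L.M.add.m_closed L.smult_closed gen_closed k_closed
          F.M.add.m_closed F.smult_closed; assumption)+
  qed
  then show ?thesis unfolding tensor_submodule_def by (rule L.span_is_submodule)
qed

lemma tensor_relations_in_trel:
  assumes F: "module R F" shows "tensor_relations R k F \<subseteq> trel F"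
proof -
  interpret F: module R F by (rule F)
  interpret L: module R "tfree F" by (rule tfree_module)
  have "tensor_relations R k F \<subseteq> carrier (tfree F)"
  proof
    fix f assume "f \<in> tensor_relations R k F"
    then show "f \<in> carrier (tfree F)"
      by (cases rule: tensor_relations_cases; hypsubst)
        (intro L.M.minus_closed L.M.add.m_closed L.smult_closed gen_closed k_closed
          F.M.add.m_closed F.smult_closed; assumption)+
  qed
  then show ?thesis unfolding tensor_submodule_def by (rule L.in_own_span)
qed

lemma tensor_module: "module R F \<Longrightarrow> module R (tensor_product R k F)"
  unfolding tensor_product_def by (rule quot_module_projection(1)[OF trel_submodule])

lemma pure_tensor_closed:
  assumes "module R F" "c \<in> carrier k" "y \<in> carrier F"
  shows "pure_tensor R k F c y \<in> carrier (tensor_product R k F)"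
  unfolding pure_tensor_def tensor_product_def
    quot_module_projection(3)[OF trel_submodule[OF assms(1)], symmetric]
  by (rule imageI[OF gen_closed[OF assms(2,3)]])

lemma pure_tensor_bilinear:
  assumes F: "module R F"
  shows "c \<in> carrier k \<Longrightarrow> y \<in> carrier F \<Longrightarrow> y' \<in> carrier F \<Longrightarrow>
      pure_tensor R k F c (y \<oplus>\<^bsub>F\<^esub> y') = pure_tensor R k F c y \<oplus>\<^bsub>tensor_product R k F\<^esub> pure_tensor R k F c y'"
    and "r \<in> carrier R \<Longrightarrow> c \<in> carrier k \<Longrightarrow> y \<in> carrier F \<Longrightarrow>
      pure_tensor R k F c (r \<odot>\<^bsub>F\<^esub> y) = r \<odot>\<^bsub>tensor_product R k F\<^esub> pure_tensor R k F c y"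
    and "r \<in> carrier R \<Longrightarrow> c \<in> carrier k \<Longrightarrow> y \<in> carrier F \<Longrightarrow>
      pure_tensor R k F (r \<odot>\<^bsub>k\<^esub> c) y = r \<odot>\<^bsub>tensor_product R k F\<^esub> pure_tensor R k F c y"
proof -
  interpret F: module R F by (rule F)
  interpret L: module R "tfree F" by (rule tfree_module)
  let ?L = "tfree F" and ?N = "trel F"
  note sub = trel_submodule[OF F]
  note q = quot_module_projection[OF sub]
  have eq: "?N +>\<^bsub>?L\<^esub> f = ?N +>\<^bsub>?L\<^esub> g"
    if "f \<in> carrier ?L" "g \<in> carrier ?L" "f \<ominus>\<^bsub>?L\<^esub> g \<in> tensor_relations R k F" for f g
    using coset_eq_iff[OF sub that(1,2)] subsetD[OF tensor_relations_in_trel[OF F] that(3)] by (rule iffD2)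
  note hadd = module_hom_add[OF q(2)] and hsm = module_hom_smult[OF q(2)]
  show "pure_tensor R k F c (y \<oplus>\<^bsub>F\<^esub> y') = pure_tensor R k F c y \<oplus>\<^bsub>tensor_product R k F\<^esub> pure_tensor R k F c y'"
    if c: "c \<in> carrier k" and y: "y \<in> carrier F" "y' \<in> carrier F"
  proof -
    note g = gen_closed[OF c y(1)] gen_closed[OF c y(2)]
    show ?thesis
      unfolding pure_tensor_def tensor_product_def hadd[OF g, symmetric]
    proof (rule eq)
      show "free_gen R (c, y \<oplus>\<^bsub>F\<^esub> y') \<ominus>\<^bsub>?L\<^esub> (free_gen R (c, y) \<oplus>\<^bsub>?L\<^esub> free_gen R (c, y'))
        \<in> tensor_relations R k F"
        unfolding tensor_relations_def Let_def using c y by blast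
    qed (intro gen_closed c F.M.add.m_closed y L.M.add.m_closed)+
  qed
  show "pure_tensor R k F c (r \<odot>\<^bsub>F\<^esub> y) = r \<odot>\<^bsub>tensor_product R k F\<^esub> pure_tensor R k F c y"
    if r: "r \<in> carrier R" and c: "c \<in> carrier k" and y: "y \<in> carrier F"
    unfolding pure_tensor_def tensor_product_def hsm[OF r gen_closed[OF c y], symmetric]
  proof (rule eq)
    show "free_gen R (c, r \<odot>\<^bsub>F\<^esub> y) \<ominus>\<^bsub>?L\<^esub> r \<odot>\<^bsub>?L\<^esub> free_gen R (c, y) \<in> tensor_relations R k F"
      unfolding tensor_relations_def Let_def using r c y by blast
  qed (intro gen_closed c F.smult_closed r y L.smult_closed)+
  show "pure_tensor R k F (r \<odot>\<^bsub>k\<^esub> c) y = r \<odot>\<^bsub>tensor_product R k F\<^esub> pure_tensor R k F c y"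
    if r: "r \<in> carrier R" and c: "c \<in> carrier k" and y: "y \<in> carrier F"
    unfolding pure_tensor_def tensor_product_def hsm[OF r gen_closed[OF c y], symmetric]
  proof (rule eq)
    show "free_gen R (r \<odot>\<^bsub>k\<^esub> c, y) \<ominus>\<^bsub>?L\<^esub> r \<odot>\<^bsub>?L\<^esub> free_gen R (c, y) \<in> tensor_relations R k F"
      unfolding tensor_relations_def Let_def using r c y by blast
  qed (intro gen_closed k_closed c r y L.smult_closed)+
qed

lemma pure_tensor_eq_unit_tensor:
  assumes F: "module R F" and r: "r \<in> carrier R" and y: "y \<in> carrier F"
  shows "pure_tensor R k F (I +>\<^bsub>R\<^esub> r) y = unit_tensor F (r \<odot>\<^bsub>F\<^esub> y)"
proof -
  interpret cring R by (rule cring)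
  have "I +>\<^bsub>R\<^esub> r = r \<odot>\<^bsub>k\<^esub> (I +>\<^bsub>R\<^esub> \<one>\<^bsub>R\<^esub>)" using k_smult[OF r one_closed] r by simp
  then show ?thesis
    using pure_tensor_bilinear(2,3)[OF F r class_in_k[OF one_closed] y] by (simp add: unit_tensor_def)
qed

lemma unit_tensor_hom:
  assumes F: "module R F"
  shows "unit_tensor F \<in> module_hom R F (tensor_product R k F)"
    and "unit_tensor F ` carrier F = carrier (tensor_product R k F)"
proof -
  let ?L = "tfree F" and ?N = "trel F" and ?T = "tensor_product R k F"
  note sub = trel_submodule[OF F]
  have q: "module R ?T" "(\<lambda>x. ?N +>\<^bsub>?L\<^esub> x) \<in> module_hom R ?L ?T"
    "(\<lambda>x. ?N +>\<^bsub>?L\<^esub> x) ` carrier ?L = carrier ?T"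
    using quot_module_projection[OF sub] by (simp_all only: tensor_product_def)
  note one = class_in_k[OF one_closed]
  show hom: "unit_tensor F \<in> module_hom R F ?T"
    unfolding unit_tensor_def
    by (rule module_homI) (simp_all only: pure_tensor_closed[OF F one] pure_tensor_bilinear[OF F] one)
  let ?P = "{f \<in> carrier ?L. ?N +>\<^bsub>?L\<^esub> f \<in> unit_tensor F ` carrier F}"
  have "carrier ?L \<subseteq> ?P"
  proof (rule free_module_on_generated[OF cring])
    show "submodule R ?P ?L"
      by (rule submodule_preimage[OF tfree_module q(1,2)
            submodule_image[OF F q(1) hom submodule_carrier[OF F]]])
    fix s assume s: "s \<in> carrier k \<times> carrier F"
    then obtain c y where cy: "s = (c, y)" "c \<in> carrier k" "y \<in> carrier F" by auto
    have "?N +>\<^bsub>?L\<^esub> free_gen R s = unit_tensor F (rep c \<odot>\<^bsub>F\<^esub> y)"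
      using pure_tensor_eq_unit_tensor[OF F rep(1)[OF cy(2)] cy(3)] rep(2)[OF cy(2)] cy(1)
      by (simp add: pure_tensor_def)
    moreover have "rep c \<odot>\<^bsub>F\<^esub> y \<in> carrier F"
      by (rule module.smult_closed[OF F rep(1)[OF cy(2)] cy(3)])
    ultimately show "free_gen R s \<in> ?P" using gen_closed[OF cy(2,3)] cy(1) by simp
  qed
  then have "(\<lambda>x. ?N +>\<^bsub>?L\<^esub> x) ` carrier ?L \<subseteq> unit_tensor F ` carrier F" by blast
  then show "unit_tensor F ` carrier F = carrier ?T"
    unfolding q(3) using hom_into[OF hom] by blast
qed

lemma smult_diff_in_ideal_smult:
  assumes F: "module R F" and r: "r \<in> carrier R" "s \<in> carrier R" "I +>\<^bsub>R\<^esub> r = I +>\<^bsub>R\<^esub> s" and y: "y \<in> carrier F"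
  shows "r \<odot>\<^bsub>F\<^esub> y \<ominus>\<^bsub>F\<^esub> s \<odot>\<^bsub>F\<^esub> y \<in> ideal_smult R I F"
proof -
  interpret F: module R F by (rule F)
  have "r \<ominus>\<^bsub>R\<^esub> s \<in> I" using class_eq_iff[OF r(1,2)] r(3) by simp
  from ideal_smult_mem[OF F I_subset this y]
  show ?thesis using r(1,2) y by (simp add: a_minus_def F.smult_l_distr F.smult_l_minus)
qed

text \<open>
  If \<open>1 \<otimes> y = 0\<close>, then \<open>y \<in> I F\<close>: the map that sends the basis vector \<open>(c, x)\<close> to \<open>r x\<close>, with \<open>r\<close> a
  chosen representative of the class \<open>c\<close>, takes the relations of bilinearity into \<open>I F\<close>.
\<close>

lemma unit_tensor_kernel:
  assumes F: "module R F" and y: "y \<in> carrier F"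
  shows "unit_tensor F y = \<zero>\<^bsub>tensor_product R k F\<^esub> \<longleftrightarrow> y \<in> ideal_smult R I F"
proof
  let ?L = "tfree F" and ?N = "trel F" and ?T = "tensor_product R k F" and ?IF = "ideal_smult R I F"
  interpret F: module R F by (rule F)
  interpret L: module R ?L by (rule tfree_module)
  note T = tensor_module[OF F]
  interpret T: module R ?T by (rule T)
  note hom = unit_tensor_hom(1)[OF F]
  note IF = ideal_smult_submodule[OF F I_subset]
  interpret IF: submodule R ?IF F by (rule IF)
  {
    assume y': "y \<in> ?IF"
    have zero_sub: "submodule R {\<zero>\<^bsub>?T\<^esub>} ?T" by (rule submodule.intro) (auto intro: T)
    have "?IF \<subseteq> {x \<in> carrier F. unit_tensor F x \<in> {\<zero>\<^bsub>?T\<^esub>}}"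
    proof (rule ideal_smult_least[OF submodule_preimage[OF F T hom zero_sub]])
      fix r x assume r: "r \<in> I" and x: "x \<in> carrier F"
      have rR: "r \<in> carrier R" using r I_subset by auto
      have "r \<ominus>\<^bsub>R\<^esub> \<zero>\<^bsub>R\<^esub> \<in> I" using r rR by (simp add: a_minus_def)
      then have "I +>\<^bsub>R\<^esub> r = I +>\<^bsub>R\<^esub> \<zero>\<^bsub>R\<^esub>" using class_eq_iff[OF rR zero_closed] by simp
      then have "unit_tensor F (r \<odot>\<^bsub>F\<^esub> x) = unit_tensor F (\<zero>\<^bsub>R\<^esub> \<odot>\<^bsub>F\<^esub> x)"
        using pure_tensor_eq_unit_tensor[OF F rR x] pure_tensor_eq_unit_tensor[OF F zero_closed x] by simp
      also have "\<dots> = \<zero>\<^bsub>?T\<^esub>" using x hom_zero[OF F T hom] by simp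
      finally show "r \<odot>\<^bsub>F\<^esub> x \<in> {x \<in> carrier F. unit_tensor F x \<in> {\<zero>\<^bsub>?T\<^esub>}}" using rR x by simp
    qed
    then show "unit_tensor F y = \<zero>\<^bsub>?T\<^esub>" using y' by blast
  }
  define G where "G s = rep (fst s) \<odot>\<^bsub>F\<^esub> snd s" for s :: "'a set \<times> _"
  define \<Phi> where "\<Phi> = lin_ext R F G"
  have Gc: "G \<in> carrier k \<times> carrier F \<rightarrow> carrier F" using rep(1) by (auto simp: G_def)
  have \<Phi>: "\<Phi> \<in> module_hom R ?L F" unfolding \<Phi>_def by (rule lin_ext_hom[OF F Gc])
  have \<Phi>g: "\<Phi> (free_gen R (c, x)) = rep c \<odot>\<^bsub>F\<^esub> x" if "c \<in> carrier k" "x \<in> carrier F" for c x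
    unfolding \<Phi>_def using lin_ext_gen[OF F Gc, of "(c, x)"] that by (simp add: G_def)
  note \<Phi>minus = hom_minus_eq[OF tfree_module F \<Phi>]
  note \<Phi>add = module_hom_add[OF \<Phi>] and \<Phi>smult = module_hom_smult[OF \<Phi>]
  have rel: "\<Phi> f \<in> ?IF" if "f \<in> tensor_relations R k F" for f
    using that
  proof (cases rule: tensor_relations_cases)
    case (add_left x x' y)
    note c = k_closed(1)[OF add_left(1,2)]
    have rc: "rep x \<oplus>\<^bsub>R\<^esub> rep x' \<in> carrier R" using rep(1) add_left by simp
    have "\<Phi> f = rep (x \<oplus>\<^bsub>k\<^esub> x') \<odot>\<^bsub>F\<^esub> y \<ominus>\<^bsub>F\<^esub> (rep x \<oplus>\<^bsub>R\<^esub> rep x') \<odot>\<^bsub>F\<^esub> y"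
      unfolding add_left(4)
      by (simp only: \<Phi>minus \<Phi>add \<Phi>g gen_closed L.M.add.m_closed c add_left(1-3) F.smult_l_distr rep(1))
    also have "\<dots> \<in> ?IF"
      by (rule smult_diff_in_ideal_smult[OF F rep(1)[OF c] rc _ add_left(3)])
        (simp only: rep c k_add[symmetric] add_left(1-3))
    finally show ?thesis .
  next
    case (add_right x y y')
    have "\<Phi> f = rep x \<odot>\<^bsub>F\<^esub> (y \<oplus>\<^bsub>F\<^esub> y') \<ominus>\<^bsub>F\<^esub> (rep x \<odot>\<^bsub>F\<^esub> y \<oplus>\<^bsub>F\<^esub> rep x \<odot>\<^bsub>F\<^esub> y')"
      unfolding add_right(4)
      by (simp only: \<Phi>minus \<Phi>add \<Phi>g gen_closed L.M.add.m_closed F.M.add.m_closed add_right(1-3))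
    also have "\<dots> = \<zero>\<^bsub>F\<^esub>"
      using rep(1)[OF add_right(1)] add_right(2,3)
      by (simp only: F.smult_r_distr[symmetric]) (intro module_minus_self[OF F] F.smult_closed F.M.add.m_closed)
    finally show ?thesis by simp
  next
    case (smult_left r x y)
    note c = k_closed(2)[OF smult_left(1,2)]
    have rc: "r \<otimes>\<^bsub>R\<^esub> rep x \<in> carrier R" using rep(1) smult_left by simp
    have "\<Phi> f = rep (r \<odot>\<^bsub>k\<^esub> x) \<odot>\<^bsub>F\<^esub> y \<ominus>\<^bsub>F\<^esub> (r \<otimes>\<^bsub>R\<^esub> rep x) \<odot>\<^bsub>F\<^esub> y"
      unfolding smult_left(4)
      by (simp only: \<Phi>minus \<Phi>smult \<Phi>g gen_closed L.smult_closed c smult_left(1-3) F.smult_assoc1 rep(1))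
    also have "\<dots> \<in> ?IF"
      by (rule smult_diff_in_ideal_smult[OF F rep(1)[OF c] rc _ smult_left(3)])
        (simp only: rep c k_smult[symmetric] smult_left(1-3))
    finally show ?thesis .
  next
    case (smult_right r x y)
    have comm: "rep x \<odot>\<^bsub>F\<^esub> (r \<odot>\<^bsub>F\<^esub> y) = r \<odot>\<^bsub>F\<^esub> (rep x \<odot>\<^bsub>F\<^esub> y)"
      using rep(1)[OF smult_right(2)] smult_right(1,3)
      by (simp add: F.smult_assoc1[symmetric] F.R.m_comm)
    have "\<Phi> f = rep x \<odot>\<^bsub>F\<^esub> (r \<odot>\<^bsub>F\<^esub> y) \<ominus>\<^bsub>F\<^esub> r \<odot>\<^bsub>F\<^esub> (rep x \<odot>\<^bsub>F\<^esub> y)"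
      unfolding smult_right(4)
      by (simp only: \<Phi>minus \<Phi>smult \<Phi>g gen_closed L.smult_closed F.smult_closed smult_right(1-3))
    also have "\<dots> = \<zero>\<^bsub>F\<^esub>" unfolding comm
      by (intro module_minus_self[OF F] F.smult_closed smult_right rep(1))
    finally show ?thesis by simp
  qed
  have N: "?N \<subseteq> {f \<in> carrier ?L. \<Phi> f \<in> ?IF}"
    unfolding tensor_submodule_def
  proof (rule span_minimal[OF submodule_preimage[OF tfree_module F \<Phi> IF]], rule subsetI)
    fix f assume f: "f \<in> tensor_relations R k F"
    then have "f \<in> carrier ?L"
      using tensor_relations_in_trel[OF F] submodule.subset[OF trel_submodule[OF F]] by blast
    with rel[OF f] show "f \<in> {f \<in> carrier ?L. \<Phi> f \<in> ?IF}" by simp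
  qed
  assume "unit_tensor F y = \<zero>\<^bsub>?T\<^esub>"
  then have "?N +>\<^bsub>?L\<^esub> free_gen R (I +>\<^bsub>R\<^esub> \<one>\<^bsub>R\<^esub>, y) = ?N"
    by (simp add: unit_tensor_def pure_tensor_def tensor_product_def quot_module_def)
  note one = class_in_k[OF one_closed]
  have "free_gen R (I +>\<^bsub>R\<^esub> \<one>\<^bsub>R\<^esub>, y) \<in> ?N"
    using coset_eq_submodule_iff[OF trel_submodule[OF F] gen_closed[OF one y]]
      \<open>?N +>\<^bsub>?L\<^esub> free_gen R (I +>\<^bsub>R\<^esub> \<one>\<^bsub>R\<^esub>, y) = ?N\<close> by (rule iffD1)
  then have 1: "rep (I +>\<^bsub>R\<^esub> \<one>\<^bsub>R\<^esub>) \<odot>\<^bsub>F\<^esub> y \<in> ?IF" using N \<Phi>g[OF one y] by auto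
  have "\<one>\<^bsub>R\<^esub> \<odot>\<^bsub>F\<^esub> y \<ominus>\<^bsub>F\<^esub> rep (I +>\<^bsub>R\<^esub> \<one>\<^bsub>R\<^esub>) \<odot>\<^bsub>F\<^esub> y \<in> ?IF"
    by (rule smult_diff_in_ideal_smult[OF F one_closed rep(1)[OF one] rep(2)[OF one, symmetric] y])
  from submodule_cancel_right[OF IF this 1] show "y \<in> ?IF" using y by simp
qed

lemma tensor_map_unit_tensor:
  assumes F: "module R F" and G: "module R G" and f: "f \<in> module_hom R F G"
  shows "tensor_map R k F G f \<in> module_hom R (tensor_product R k F) (tensor_product R k G)"
    and "y \<in> carrier F \<Longrightarrow> tensor_map R k F G f (unit_tensor F y) = unit_tensor G (f y)"
proof -
  let ?TF = "tensor_product R k F" and ?TG = "tensor_product R k G"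
  note TF = tensor_module[OF F] and TG = tensor_module[OF G]
  note uF = unit_tensor_hom[OF F] and uG = unit_tensor_hom[OF G]
  interpret F: module R F by (rule F)
  interpret TF: module R ?TF by (rule TF)
  define h where "h t = unit_tensor G (f (SOME y. y \<in> carrier F \<and> unit_tensor F y = t))" for t
  have h: "h (unit_tensor F y) = unit_tensor G (f y)" if y: "y \<in> carrier F" for y
  proof -
    define z where "z = (SOME z. z \<in> carrier F \<and> unit_tensor F z = unit_tensor F y)"
    have "z \<in> carrier F \<and> unit_tensor F z = unit_tensor F y"
      unfolding z_def by (rule someI[of _ y]) (simp add: y)
    then have z: "z \<in> carrier F" "unit_tensor F z = unit_tensor F y" by simp_all
    have "unit_tensor F (z \<ominus>\<^bsub>F\<^esub> y) = \<zero>\<^bsub>?TF\<^esub>"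
      unfolding hom_minus_eq[OF F TF uF(1) z(1) y] z(2)
      by (rule module_minus_self[OF TF hom_into[OF uF(1) y]])
    then have "z \<ominus>\<^bsub>F\<^esub> y \<in> ideal_smult R I F"
      using unit_tensor_kernel[OF F module_minus_closed[OF F z(1) y]] by simp
    from ideal_smult_hom[OF F G f I_subset this]
    have "unit_tensor G (f (z \<ominus>\<^bsub>F\<^esub> y)) = \<zero>\<^bsub>?TG\<^esub>"
      using unit_tensor_kernel[OF G hom_into[OF f module_minus_closed[OF F z(1) y]]] by simp
    then have "unit_tensor G (f z) \<ominus>\<^bsub>?TG\<^esub> unit_tensor G (f y) = \<zero>\<^bsub>?TG\<^esub>"
      by (simp only: hom_minus_eq[OF F G f z(1) y] hom_minus_eq[OF G TG uG(1)] hom_into[OF f] z(1) y)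
    from module_minus_eq_zeroD[OF TG hom_into[OF uG(1) hom_into[OF f z(1)]]
        hom_into[OF uG(1) hom_into[OF f y]] this]
    show ?thesis unfolding h_def z_def[symmetric] .
  qed
  have rep_t: "\<exists>y\<in>carrier F. t = unit_tensor F y" if "t \<in> carrier ?TF" for t
    using that uF(2) by blast
  have "h \<in> module_hom R ?TF ?TG"
  proof (rule module_homI)
    fix t assume "t \<in> carrier ?TF"
    then obtain y where y: "y \<in> carrier F" "t = unit_tensor F y" using rep_t by blast
    show "h t \<in> carrier ?TG" unfolding y(2) h[OF y(1)] by (rule hom_into[OF uG(1) hom_into[OF f y(1)]])
    fix r assume r: "r \<in> carrier R"
    show "h (r \<odot>\<^bsub>?TF\<^esub> t) = r \<odot>\<^bsub>?TG\<^esub> h t"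
      unfolding y(2) module_hom_smult[OF uF(1) r y(1), symmetric]
      by (simp only: h F.smult_closed r y(1) module_hom_smult[OF f] module_hom_smult[OF uG(1)] hom_into[OF f])
  next
    fix t t' assume "t \<in> carrier ?TF" "t' \<in> carrier ?TF"
    then obtain y y' where y: "y \<in> carrier F" "t = unit_tensor F y" "y' \<in> carrier F" "t' = unit_tensor F y'"
      using rep_t by metis
    show "h (t \<oplus>\<^bsub>?TF\<^esub> t') = h t \<oplus>\<^bsub>?TG\<^esub> h t'"
      unfolding y(2,4) module_hom_add[OF uF(1) y(1,3), symmetric]
      by (simp only: h F.M.add.m_closed y(1,3) module_hom_add[OF f] module_hom_add[OF uG(1)] hom_into[OF f])
  qed
  moreover have "h (pure_tensor R k F c y) = pure_tensor R k G c (f y)"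
    if "c \<in> carrier k" "y \<in> carrier F" for c y
  proof -
    have "h (pure_tensor R k F c y) = h (unit_tensor F (rep c \<odot>\<^bsub>F\<^esub> y))"
      using pure_tensor_eq_unit_tensor[OF F rep(1)[OF that(1)] that(2)] rep(2)[OF that(1)] by simp
    also have "\<dots> = unit_tensor G (rep c \<odot>\<^bsub>G\<^esub> f y)"
      by (simp only: h F.smult_closed rep(1) that module_hom_smult[OF f])
    also have "\<dots> = pure_tensor R k G c (f y)"
      using pure_tensor_eq_unit_tensor[OF G rep(1)[OF that(1)] hom_into[OF f that(2)]] rep(2)[OF that(1)] by simp
    finally show ?thesis .
  qed
  ultimately have ex: "\<exists>h. h \<in> module_hom R ?TF ?TG \<and>
      (\<forall>x\<in>carrier k. \<forall>y\<in>carrier F. h (pure_tensor R k F x y) = pure_tensor R k G x (f y))"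
    by (intro exI[of _ h]) simp
  from someI_ex[OF ex] have t: "tensor_map R k F G f \<in> module_hom R ?TF ?TG"
    "\<forall>x\<in>carrier k. \<forall>y\<in>carrier F. tensor_map R k F G f (pure_tensor R k F x y) = pure_tensor R k G x (f y)"
    unfolding tensor_map_def by simp_all
  show "tensor_map R k F G f \<in> module_hom R ?TF ?TG" by (rule t(1))
  show "tensor_map R k F G f (unit_tensor F y) = unit_tensor G (f y)" if "y \<in> carrier F"
    unfolding unit_tensor_def using t(2) class_in_k[OF one_closed] that by simp
qed

end

section \<open>Independence modulo a subspace\<close>

text \<open>
  Fewer equations than unknowns. Families indexed by arbitrary sets avoid matrices of varying size.
\<close>

lemma homogeneous_system_nontrivial_solution:
  fixes \<gamma> :: "'j \<Rightarrow> 'i \<Rightarrow> 'k::field"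
  assumes "finite J" "finite I" "card I < card J"
  shows "\<exists>c. (\<exists>j\<in>J. c j \<noteq> 0) \<and> (\<forall>i\<in>I. (\<Sum>j\<in>J. c j * \<gamma> j i) = 0)"
  using assms(2,1,3)
proof (induction I arbitrary: J \<gamma> rule: finite_induct)
  case empty
  then show ?case by (auto intro!: exI[of _ "\<lambda>_. 1"] simp: card_gt_0_iff)
next
  case (insert i I)
  show ?case
  proof (cases "\<forall>j\<in>J. \<gamma> j i = 0")
    case True
    have "card I < card J" using insert by simp
    from insert.IH[OF insert.prems(1) this] obtain c where
      "\<exists>j\<in>J. c j \<noteq> 0" "\<forall>i\<in>I. (\<Sum>j\<in>J. c j * \<gamma> j i) = 0" by blast
    then show ?thesis using True by (intro exI[of _ c]) auto
  next
    case False
    then obtain p where p: "p \<in> J" "\<gamma> p i \<noteq> 0" by auto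
    let ?J = "J - {p}"
    define \<delta> where "\<delta> j l = \<gamma> j l - \<gamma> j i / \<gamma> p i * \<gamma> p l" for j l
    have "card I < card ?J" using insert p by (simp add: card_Diff_singleton)
    from insert.IH[of ?J \<delta>, OF _ this] insert.prems(1) obtain c where
      c: "\<exists>j\<in>?J. c j \<noteq> 0" "\<forall>l\<in>I. (\<Sum>j\<in>?J. c j * \<delta> j l) = 0" by auto
    define c' where "c' j = (if j = p then - (\<Sum>j\<in>?J. c j * \<gamma> j i) / \<gamma> p i else c j)" for j
    have sum: "(\<Sum>j\<in>J. c' j * \<gamma> j l) = c' p * \<gamma> p l + (\<Sum>j\<in>?J. c j * \<gamma> j l)" for l
    proof -
      have "(\<Sum>j\<in>J. c' j * \<gamma> j l) = c' p * \<gamma> p l + (\<Sum>j\<in>?J. c' j * \<gamma> j l)"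
        using p(1) insert.prems(1) by (simp add: sum.remove)
      also have "(\<Sum>j\<in>?J. c' j * \<gamma> j l) = (\<Sum>j\<in>?J. c j * \<gamma> j l)"
        by (rule sum.cong) (auto simp: c'_def)
      finally show ?thesis .
    qed
    have "(\<Sum>j\<in>J. c' j * \<gamma> j i) = 0" unfolding sum using p(2) by (simp add: c'_def)
    moreover have "(\<Sum>j\<in>J. c' j * \<gamma> j l) = 0" if "l \<in> I" for l
    proof -
      have "0 = (\<Sum>j\<in>?J. c j * \<delta> j l)" using c(2) that by simp
      also have "\<dots> = (\<Sum>j\<in>?J. c j * \<gamma> j l - (c j * \<gamma> j i) * (\<gamma> p l / \<gamma> p i))"
        by (rule sum.cong) (auto simp: \<delta>_def algebra_simps)
      also have "\<dots> = (\<Sum>j\<in>?J. c j * \<gamma> j l) - (\<Sum>j\<in>?J. c j * \<gamma> j i) * (\<gamma> p l / \<gamma> p i)"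
        by (simp add: sum_subtractf sum_distrib_right sum_divide_distrib)
      also have "\<dots> = (\<Sum>j\<in>?J. c j * \<gamma> j l) + c' p * \<gamma> p l" by (simp add: c'_def)
      finally show ?thesis unfolding sum by (simp add: add.commute)
    qed
    moreover have "\<exists>j\<in>J. c' j \<noteq> 0" using c(1) by (auto simp: c'_def)
    ultimately show ?thesis by (intro exI[of _ c']) auto
  qed
qed

context vector_space
begin

text \<open>
  Steinitz in the quotient by \<open>W\<close>, phrased with families so that repeated vectors count.
\<close>

lemma card_le_of_independent_modulo:
  assumes W: "subspace W" and "finite J" "finite I"
    and gen: "\<And>j. j \<in> J \<Longrightarrow> \<exists>\<gamma>. b j - (\<Sum>i\<in>I. scale (\<gamma> i) (t i)) \<in> W"
    and indep: "\<And>c. (\<Sum>j\<in>J. scale (c j) (b j)) \<in> W \<Longrightarrow> \<forall>j\<in>J. c j = 0"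
  shows "card J \<le> card I"
proof (rule ccontr)
  assume "\<not> card J \<le> card I"
  from gen obtain \<gamma> where \<gamma>: "\<And>j. j \<in> J \<Longrightarrow> b j - (\<Sum>i\<in>I. scale (\<gamma> j i) (t i)) \<in> W" by metis
  obtain c where c: "\<exists>j\<in>J. c j \<noteq> 0" "\<forall>i\<in>I. (\<Sum>j\<in>J. c j * \<gamma> j i) = 0"
    using homogeneous_system_nontrivial_solution[OF assms(2,3), of \<gamma>] \<open>\<not> card J \<le> card I\<close> by auto
  have "(\<Sum>j\<in>J. scale (c j) (b j - (\<Sum>i\<in>I. scale (\<gamma> j i) (t i)))) \<in> W"
    by (intro subspace_sum[OF W] subspace_scale[OF W] \<gamma>)
  also have "(\<Sum>j\<in>J. scale (c j) (b j - (\<Sum>i\<in>I. scale (\<gamma> j i) (t i))))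
      = (\<Sum>j\<in>J. scale (c j) (b j)) - (\<Sum>j\<in>J. \<Sum>i\<in>I. scale (c j * \<gamma> j i) (t i))"
    by (simp add: scale_right_diff_distrib sum_subtractf scale_sum_right)
  also have "(\<Sum>j\<in>J. \<Sum>i\<in>I. scale (c j * \<gamma> j i) (t i)) = (\<Sum>i\<in>I. \<Sum>j\<in>J. scale (c j * \<gamma> j i) (t i))"
    by (rule sum.swap)
  also have "\<dots> = (\<Sum>i\<in>I. scale (\<Sum>j\<in>J. c j * \<gamma> j i) (t i))"
    by (simp add: scale_sum_left)
  also have "\<dots> = 0" using c(2) by simp
  finally have "(\<Sum>j\<in>J. scale (c j) (b j)) \<in> W" by simp
  from indep[OF this] c(1) show False by blast
qed

text \<open>
  A nilpotent shift loses exactly the dimension of its kernel: if \<open>L\<close> is stable under \<open>S\<close>, has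
  finite dimension and contains \<open>b\<close> independent vectors killed by \<open>S\<close>, then by rank and nullity
  \<open>L / S L\<close> has dimension at least \<open>b\<close>.
\<close>

lemma independent_modulo_image:
  assumes L: "subspace L" "L \<subseteq> span T" "finite T"
    and S: "Vector_Spaces.linear scale scale S" "\<And>v. v \<in> L \<Longrightarrow> S v \<in> L"
    and K: "K \<subseteq> L" "finite K" "independent K" "\<And>v. v \<in> K \<Longrightarrow> S v = 0"
  shows "\<exists>C. C \<subseteq> L \<and> finite C \<and> card K \<le> card C \<and>
    (\<forall>c. (\<Sum>v\<in>C. scale (c v) v) \<in> S ` L \<longrightarrow> (\<forall>v\<in>C. c v = 0))"
proof -
  interpret S: Vector_Spaces.linear scale scale S by fact
  have SL: "subspace (S ` L)" by (rule S.subspace_image[OF L(1)])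
  obtain B where B: "B \<subseteq> S ` L" "independent B" "S ` L \<subseteq> span B"
    using maximal_independent_subset by blast
  have BL: "B \<subseteq> L" using B(1) S(2) by auto
  obtain D where D: "B \<subseteq> D" "D \<subseteq> L" "independent D" "L \<subseteq> span D"
    using maximal_independent_subset_extend[OF BL B(2)] by blast
  have fin: "finite A" if "A \<subseteq> L" "independent A" for A
    using independent_span_bound[OF L(3) that(2)] that(1) L(2) by blast
  have finD: "finite D" by (rule fin[OF D(2,3)])
  have finB: "finite B" using finD D(1) finite_subset by blast
  have "\<forall>b\<in>B. \<exists>v. v \<in> L \<and> S v = b" using B(1) by auto
  then obtain p where p: "\<forall>b\<in>B. p b \<in> L \<and> S (p b) = b" by metis
  have inj: "inj_on p B" by (rule inj_onI) (metis p)
  have SK: "S v = 0" if "v \<in> span K" for v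
  proof -
    have "span K \<subseteq> {v. S v = 0}" by (rule span_minimal) (use K(4) S.subspace_kernel in auto)
    then show ?thesis using that by auto
  qed
  have SpB: "(\<Sum>b\<in>B. scale (c b) (p b)) \<in> span K \<Longrightarrow> \<forall>b\<in>B. c b = 0" for c
  proof -
    assume "(\<Sum>b\<in>B. scale (c b) (p b)) \<in> span K"
    from SK[OF this] have "(\<Sum>b\<in>B. scale (c b) b) = 0"
      using p by (simp add: S.sum S.scale)
    then show "\<forall>b\<in>B. c b = 0" using B(2) finB independent_explicit_finite_subsets by blast
  qed
  have disj: "p ` B \<inter> K = {}"
  proof (rule ccontr)
    assume "p ` B \<inter> K \<noteq> {}"
    then obtain b where b: "b \<in> B" "p b \<in> K" by auto
    then have "b = 0" using p K(4) by metis
    then show False using b(1) B(2) dependent_zero by auto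
  qed
  have ind: "independent (p ` B \<union> K)"
  proof -
    have "\<forall>v\<in>p ` B \<union> K. u v = 0" if u: "(\<Sum>v\<in>p ` B \<union> K. scale (u v) v) = 0" for u
    proof -
      have "(\<Sum>v\<in>p ` B. scale (u v) v) + (\<Sum>v\<in>K. scale (u v) v) = 0"
        using u disj finB K(2) by (simp add: sum.union_disjoint)
      then have e: "(\<Sum>v\<in>p ` B. scale (u v) v) = - (\<Sum>v\<in>K. scale (u v) v)"
        by (simp add: eq_neg_iff_add_eq_0)
      have "- (\<Sum>v\<in>K. scale (u v) v) \<in> span K"
        by (intro span_neg span_sum span_scale span_base)
      then have "(\<Sum>b\<in>B. scale (u (p b)) (p b)) \<in> span K"
        using e inj by (simp add: sum.reindex)
      from SpB[OF this] have u1: "\<forall>b\<in>B. u (p b) = 0" .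
      then have "(\<Sum>v\<in>p ` B. scale (u v) v) = 0" by (intro sum.neutral) auto
      then have "(\<Sum>v\<in>K. scale (u v) v) = 0" using e by simp
      then have "\<forall>v\<in>K. u v = 0" using K(2,3) independent_explicit_finite_subsets by blast
      with u1 show ?thesis by auto
    qed
    then show ?thesis
      using finB K(2) by (subst dependent_finite) auto
  qed
  \<comment> \<open>D is a basis of L that extends the basis B of S L, and the preimages p B are independent of K.\<close>
  have sub: "p ` B \<union> K \<subseteq> span D" using p K(1) D(4) by blast
  have "card (p ` B \<union> K) \<le> card D"
    using independent_span_bound[OF finD ind sub] by simp
  moreover have "card (p ` B \<union> K) = card B + card K"
    using card_Un_disjoint[OF _ K(2) disj] finB card_image[OF inj] by simp
  moreover have "card D = card B + card (D - B)"
    using card_Un_disjoint[of B "D - B"] finD finB D(1) by (simp add: Un_absorb1)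
  ultimately have "card K \<le> card (D - B)" by linarith
  moreover have "\<forall>v\<in>D - B. c v = 0" if c: "(\<Sum>v\<in>D - B. scale (c v) v) \<in> S ` L" for c
  proof -
    from c B(3) have "(\<Sum>v\<in>D - B. scale (c v) v) \<in> span B" by blast
    then obtain g where g: "(\<Sum>v\<in>D - B. scale (c v) v) = (\<Sum>v\<in>B. scale (g v) v)"
      using span_finite[OF finB] by auto
    define u where "u v = (if v \<in> B then - g v else c v)" for v
    have "(\<Sum>v\<in>D. scale (u v) v) = (\<Sum>v\<in>D - B. scale (u v) v) + (\<Sum>v\<in>B. scale (u v) v)"
      using finD D(1) by (simp add: sum.subset_diff)
    also have "(\<Sum>v\<in>D - B. scale (u v) v) = (\<Sum>v\<in>D - B. scale (c v) v)"
      by (rule sum.cong) (auto simp: u_def)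
    also have "(\<Sum>v\<in>B. scale (u v) v) = - (\<Sum>v\<in>B. scale (g v) v)"
      by (simp add: u_def sum_negf)
    finally have "(\<Sum>v\<in>D. scale (u v) v) = 0" using g by simp
    then have "\<forall>v\<in>D. u v = 0" using D(3) finD independent_explicit_finite_subsets by blast
    then show ?thesis by (auto simp: u_def split: if_splits)
  qed
  ultimately show ?thesis using D(2) finD by (intro exI[of _ "D - B"]) auto
qed

end

section \<open>Betti numbers as numbers of generators\<close>

text \<open>
  Here \<open>H\<close> is the homology of \<open>k \<otimes> F\<close> in degree \<open>j + 1\<close>, and \<open>\<rho>\<close> sends a cycle \<open>y\<close> to the class of
  \<open>1 \<otimes> y\<close>. Its kernel being \<open>I F\<^sub>j\<^sub>+\<^sub>1 + d F\<^sub>j\<^sub>+\<^sub>2\<close>, generating sets of \<open>H\<close> correspond to sets of cycles as in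
  \<^const>\<open>tor_generated_by\<close>.
\<close>

locale residue_complex = residue_ring R I
  for R :: "('a, 'b) ring_scheme" and I :: "'a set" +
  fixes F :: "nat \<Rightarrow> ('a, 'f) module" and d :: "nat \<Rightarrow> 'f \<Rightarrow> 'f" and j :: nat
  assumes F: "module R (F i)" and d: "d i \<in> module_hom R (F (Suc i)) (F i)"
    and dd: "x \<in> carrier (F (Suc (Suc i))) \<Longrightarrow> d i (d (Suc i) x) = \<zero>\<^bsub>F i\<^esub>"
begin

abbreviation C where "C i \<equiv> tensor_product R k (F i)"
abbreviation D where "D i \<equiv> tensor_map R k (F (Suc i)) (F i) (d i)"
abbreviation \<pi> where "\<pi> \<equiv> unit_tensor (F (Suc j))"
abbreviation W where "W \<equiv> tor_cycles R I F d j"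
abbreviation IF where "IF \<equiv> ideal_smult R I (F (Suc j))"

definition cycles where "cycles = a_kernel (C (Suc j)) (C j) (D j)"
definition boundaries where "boundaries = D (Suc j) ` carrier (C (Suc (Suc j)))"
definition cycle_module where "cycle_module = (C (Suc j))\<lparr>carrier := cycles\<rparr>"
definition H where "H = quot_module cycle_module boundaries"
definition \<rho> where "\<rho> y = boundaries +>\<^bsub>cycle_module\<^esub> \<pi> y"

lemma homology_eq: "homology C D (Suc j) = H"
  by (simp add: homology_def H_def cycle_module_def cycles_def boundaries_def)

lemma C_module: "module R (C i)" by (rule tensor_module[OF F])

lemma D_hom: "D i \<in> module_hom R (C (Suc i)) (C i)"
  by (rule tensor_map_unit_tensor(1)[OF F F d])

lemma D_unit_tensor: "y \<in> carrier (F (Suc i)) \<Longrightarrow> D i (unit_tensor (F (Suc i)) y) = unit_tensor (F i) (d i y)"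
  by (rule tensor_map_unit_tensor(2)[OF F F d])

lemma W_iff: "y \<in> W \<longleftrightarrow> y \<in> carrier (F (Suc j)) \<and> d j y \<in> ideal_smult R I (F j)"
  by (simp add: tor_cycles_def)

lemma IF_submodule: "submodule R IF (F (Suc j))"
  by (rule ideal_smult_submodule[OF F I_subset])

lemma W_submodule: "submodule R W (F (Suc j))"
  unfolding tor_cycles_def by (rule submodule_preimage[OF F F d ideal_smult_submodule[OF F I_subset]])

lemma zero_submodule: assumes "module R M" shows "submodule R {\<zero>\<^bsub>M\<^esub>} M"
proof -
  interpret M: module R M by fact
  show ?thesis by (rule submodule.intro) (auto intro: assms)
qed

lemma IF_in_W: "IF \<subseteq> W"
proof
  fix y assume y: "y \<in> IF"
  show "y \<in> W" unfolding W_iff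
    using subsetD[OF submodule.subset[OF IF_submodule] y] ideal_smult_hom[OF F F d I_subset y] by simp
qed

lemma boundary_in_W: "z \<in> carrier (F (Suc (Suc j))) \<Longrightarrow> d (Suc j) z \<in> W"
  unfolding W_iff using hom_into[OF d] dd submodule.zero_closed[OF ideal_smult_submodule[OF F I_subset]]
  by simp

lemma cycles_iff: "t \<in> cycles \<longleftrightarrow> t \<in> carrier (C (Suc j)) \<and> D j t = \<zero>\<^bsub>C j\<^esub>"
  by (simp add: cycles_def a_kernel_def')

lemma cycles_submodule: "submodule R cycles (C (Suc j))"
proof -
  have "cycles = {t \<in> carrier (C (Suc j)). D j t \<in> {\<zero>\<^bsub>C j\<^esub>}}" using cycles_iff by auto
  then show ?thesis
    using submodule_preimage[OF C_module C_module D_hom zero_submodule[OF C_module]] by simp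
qed

lemma cycle_module_module: "module R cycle_module"
  unfolding cycle_module_def by (rule module.submodule_is_module[OF C_module cycles_submodule])

lemma \<pi>_in_cycles: "y \<in> carrier (F (Suc j)) \<Longrightarrow> \<pi> y \<in> cycles \<longleftrightarrow> y \<in> W"
  unfolding cycles_iff W_iff
  using hom_into[OF unit_tensor_hom(1)[OF F]] unit_tensor_kernel[OF F hom_into[OF d]]
  by (simp add: D_unit_tensor)

lemma boundaries_eq: "boundaries = (\<lambda>z. \<pi> (d (Suc j) z)) ` carrier (F (Suc (Suc j)))"
  unfolding boundaries_def unit_tensor_hom(2)[OF F, symmetric] image_image
  by (rule image_cong) (simp_all add: D_unit_tensor)

lemma boundaries_submodule: "submodule R boundaries cycle_module"
proof -
  have sub: "submodule R boundaries (C (Suc j))"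
    unfolding boundaries_def
    by (rule submodule_image[OF C_module C_module D_hom submodule_carrier[OF C_module]])
  have "boundaries \<subseteq> cycles"
    unfolding boundaries_eq using \<pi>_in_cycles boundary_in_W hom_into[OF d] by blast
  then show ?thesis
    using submodule.m_closed[OF sub] submodule.zero_closed[OF sub] submodule.smult_closed[OF sub]
    by (intro submodule.intro cycle_module_module) (simp_all add: cycle_module_def)
qed

lemma H_module: "module R H"
  unfolding H_def by (rule quot_module_projection(1)[OF boundaries_submodule])

lemma \<rho>_hom: "\<rho> \<in> module_hom R ((F (Suc j))\<lparr>carrier := W\<rparr>) H"
proof (rule module_homI)
  note q = quot_module_projection(2)[OF boundaries_submodule, folded H_def]
  note u = unit_tensor_hom(1)[OF F, of "Suc j"]
  have W: "y \<in> carrier (F (Suc j))" "\<pi> y \<in> carrier cycle_module" if "y \<in> W" for y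
    using that \<pi>_in_cycles[of y] by (simp_all add: W_iff cycle_module_def)
  fix x assume "x \<in> carrier ((F (Suc j))\<lparr>carrier := W\<rparr>)"
  then have x: "x \<in> W" by simp
  show "\<rho> x \<in> carrier H" unfolding \<rho>_def by (rule hom_into[OF q W(2)[OF x]])
  {
    fix r assume r: "r \<in> carrier R"
    show "\<rho> (r \<odot>\<^bsub>(F (Suc j))\<lparr>carrier := W\<rparr>\<^esub> x) = r \<odot>\<^bsub>H\<^esub> \<rho> x"
      using module_hom_smult[OF q r W(2)[OF x]] module_hom_smult[OF u r W(1)[OF x]]
      by (simp add: \<rho>_def cycle_module_def)
  next
    fix y assume "y \<in> carrier ((F (Suc j))\<lparr>carrier := W\<rparr>)"
    then have y: "y \<in> W" by simp
    show "\<rho> (x \<oplus>\<^bsub>(F (Suc j))\<lparr>carrier := W\<rparr>\<^esub> y) = \<rho> x \<oplus>\<^bsub>H\<^esub> \<rho> y"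
      using module_hom_add[OF q W(2)[OF x] W(2)[OF y]] module_hom_add[OF u W(1)[OF x] W(1)[OF y]]
      by (simp add: \<rho>_def cycle_module_def)
  }
qed

lemma \<rho>_surj: "\<rho> ` W = carrier H"
proof -
  have "\<pi> ` W = cycles"
  proof
    show "\<pi> ` W \<subseteq> cycles" using \<pi>_in_cycles W_iff by blast
    show "cycles \<subseteq> \<pi> ` W"
    proof
      fix t assume t: "t \<in> cycles"
      then have "t \<in> \<pi> ` carrier (F (Suc j))" using unit_tensor_hom(2)[OF F] cycles_iff by blast
      then obtain y where "y \<in> carrier (F (Suc j))" "t = \<pi> y" by blast
      then show "t \<in> \<pi> ` W" using \<pi>_in_cycles t by blast
    qed
  qed
  moreover have "(\<lambda>x. boundaries +>\<^bsub>cycle_module\<^esub> x) ` cycles = carrier H"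
    using quot_module_projection(3)[OF boundaries_submodule, folded H_def] by (simp add: cycle_module_def)
  ultimately show ?thesis unfolding \<rho>_def by (metis image_image)
qed

lemma \<rho>_eq_zero:
  assumes y: "y \<in> W"
  shows "\<rho> y = \<zero>\<^bsub>H\<^esub> \<longleftrightarrow> (\<exists>z\<in>carrier (F (Suc (Suc j))). y \<ominus>\<^bsub>F (Suc j)\<^esub> d (Suc j) z \<in> IF)"
proof -
  have yc: "y \<in> carrier (F (Suc j))" using y by (simp add: W_iff)
  have "\<zero>\<^bsub>H\<^esub> = boundaries" by (simp add: H_def quot_module_def)
  moreover have "\<pi> y \<in> carrier cycle_module" using \<pi>_in_cycles[OF yc] y by (simp add: cycle_module_def)
  ultimately have "\<rho> y = \<zero>\<^bsub>H\<^esub> \<longleftrightarrow> \<pi> y \<in> boundaries"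
    unfolding \<rho>_def using coset_eq_submodule_iff[OF boundaries_submodule] by simp
  also have "\<dots> \<longleftrightarrow> (\<exists>z\<in>carrier (F (Suc (Suc j))). \<pi> y = \<pi> (d (Suc j) z))"
    unfolding boundaries_eq by blast
  also have "\<dots> \<longleftrightarrow> (\<exists>z\<in>carrier (F (Suc (Suc j))). y \<ominus>\<^bsub>F (Suc j)\<^esub> d (Suc j) z \<in> IF)"
  proof (rule bex_cong[OF refl])
    fix z assume z: "z \<in> carrier (F (Suc (Suc j)))"
    note dz = hom_into[OF d z]
    note u = unit_tensor_hom(1)[OF F, of "Suc j"]
    have "\<pi> y = \<pi> (d (Suc j) z) \<longleftrightarrow> \<pi> y \<ominus>\<^bsub>C (Suc j)\<^esub> \<pi> (d (Suc j) z) = \<zero>\<^bsub>C (Suc j)\<^esub>"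
      using module_minus_eq_zeroD[OF C_module hom_into[OF u yc] hom_into[OF u dz]]
        module_minus_self[OF C_module hom_into[OF u dz]] by metis
    also have "\<dots> \<longleftrightarrow> \<pi> (y \<ominus>\<^bsub>F (Suc j)\<^esub> d (Suc j) z) = \<zero>\<^bsub>C (Suc j)\<^esub>"
      by (simp only: hom_minus_eq[OF F C_module u yc dz])
    also have "\<dots> \<longleftrightarrow> y \<ominus>\<^bsub>F (Suc j)\<^esub> d (Suc j) z \<in> IF"
      by (rule unit_tensor_kernel[OF F module_minus_closed[OF F yc dz]])
    finally show "\<pi> y = \<pi> (d (Suc j) z) \<longleftrightarrow> y \<ominus>\<^bsub>F (Suc j)\<^esub> d (Suc j) z \<in> IF" .
  qed
  finally show ?thesis .
qed

lemma W_module: "module R ((F (Suc j))\<lparr>carrier := W\<rparr>)"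
  by (rule module.submodule_is_module[OF F W_submodule])

text \<open>
  This makes the choice of representatives of scalars in \<^const>\<open>residue_vectorspace\<close> harmless.
\<close>

lemma I_kills_H:
  assumes r: "r \<in> I" and v: "v \<in> carrier H" shows "r \<odot>\<^bsub>H\<^esub> v = \<zero>\<^bsub>H\<^esub>"
proof -
  have rR: "r \<in> carrier R" using r I_subset by auto
  obtain y where y: "y \<in> W" "v = \<rho> y" using v \<rho>_surj by blast
  have yc: "y \<in> carrier (F (Suc j))" using y by (simp add: W_iff)
  have ry: "r \<odot>\<^bsub>F (Suc j)\<^esub> y \<in> IF" by (rule ideal_smult_mem[OF F I_subset r yc])
  have "\<zero>\<^bsub>F (Suc (Suc j))\<^esub> \<in> carrier (F (Suc (Suc j)))"
    using submodule.zero_closed[OF submodule_carrier[OF F]] .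
  moreover have "r \<odot>\<^bsub>F (Suc j)\<^esub> y \<ominus>\<^bsub>F (Suc j)\<^esub> d (Suc j) \<zero>\<^bsub>F (Suc (Suc j))\<^esub> \<in> IF"
    unfolding hom_zero[OF F F d]
    using module_minus_zero[OF F subsetD[OF submodule.subset[OF IF_submodule] ry]] ry by simp
  ultimately have "\<rho> (r \<odot>\<^bsub>F (Suc j)\<^esub> y) = \<zero>\<^bsub>H\<^esub>"
    using \<rho>_eq_zero[OF subsetD[OF IF_in_W ry]] by blast
  then show ?thesis using module_hom_smult[OF \<rho>_hom rR] y by simp
qed

abbreviation V where "V \<equiv> residue_vectorspace R H"

lemma carrier_residue_field: "carrier (residue_field R) = carrier k"
  by (simp add: residue_field_module_def)

lemma V_simps [simp]:
  "carrier V = carrier H" "\<zero>\<^bsub>V\<^esub> = \<zero>\<^bsub>H\<^esub>" "v \<oplus>\<^bsub>V\<^esub> w = v \<oplus>\<^bsub>H\<^esub> w"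
  by (simp_all add: residue_vectorspace_def)

lemma V_smult:
  assumes r: "r \<in> carrier R" and v: "v \<in> carrier H"
  shows "(I +>\<^bsub>R\<^esub> r) \<odot>\<^bsub>V\<^esub> v = r \<odot>\<^bsub>H\<^esub> v"
proof -
  interpret H: module R H by (rule H_module)
  note c = class_in_k[OF r]
  note rc = rep[OF c]
  have "rep (I +>\<^bsub>R\<^esub> r) \<ominus>\<^bsub>R\<^esub> r \<in> I" using class_eq_iff[OF rc(1) r] rc(2) by simp
  from I_kills_H[OF this v]
  have "rep (I +>\<^bsub>R\<^esub> r) \<odot>\<^bsub>H\<^esub> v \<ominus>\<^bsub>H\<^esub> r \<odot>\<^bsub>H\<^esub> v = \<zero>\<^bsub>H\<^esub>"
    using rc(1) r v by (simp add: a_minus_def H.smult_l_distr H.smult_l_minus)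
  from module_minus_eq_zeroD[OF H_module H.smult_closed[OF rc(1) v] H.smult_closed[OF r v] this]
  show ?thesis by (simp add: residue_vectorspace_def rep_def)
qed

lemma V_vectorspace: "vectorspace (residue_field R) V"
proof -
  interpret H: module R H by (rule H_module)
  interpret R: cring R by (rule cring)
  have fld: "field (residue_field R)"
    unfolding residue_field_def max_ideal_eq by (rule maximalideal.quotient_is_field[OF maximal cring])
  have kk: "(I +>\<^bsub>R\<^esub> r) \<otimes>\<^bsub>residue_field R\<^esub> (I +>\<^bsub>R\<^esub> s) = I +>\<^bsub>R\<^esub> (r \<otimes>\<^bsub>R\<^esub> s)"
    "(I +>\<^bsub>R\<^esub> r) \<oplus>\<^bsub>residue_field R\<^esub> (I +>\<^bsub>R\<^esub> s) = I +>\<^bsub>R\<^esub> (r \<oplus>\<^bsub>R\<^esub> s)"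
    if "r \<in> carrier R" "s \<in> carrier R" for r s
    using ideal.rcoset_mult_add[OF ideal_I that] k_add[OF that]
    by (simp_all add: residue_field_def max_ideal_eq FactRing_def residue_field_module_def)
  have one: "\<one>\<^bsub>residue_field R\<^esub> = I +>\<^bsub>R\<^esub> \<one>\<^bsub>R\<^esub>"
    by (simp add: residue_field_def max_ideal_eq FactRing_def)
  have cls: "\<exists>r\<in>carrier R. c = I +>\<^bsub>R\<^esub> r" if "c \<in> carrier (residue_field R)" for c
    using that unfolding carrier_residue_field carrier_k by blast
  have "module (residue_field R) V"
  proof (rule module_criteria; (intro allI impI ballI)?; (elim conjE)?)
    show "cring (residue_field R)" using fld by (simp add: field_def domain_def)
    show "\<zero>\<^bsub>V\<^esub> \<in> carrier V" by simp
  next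
    fix v assume "v \<in> carrier V"
    then have v: "v \<in> carrier H" by simp
    then show "\<exists>u\<in>carrier V. v \<oplus>\<^bsub>V\<^esub> u = \<zero>\<^bsub>V\<^esub>"
      by (intro bexI[of _ "\<ominus>\<^bsub>H\<^esub> v"]) (simp_all add: H.M.r_neg)
    show "\<one>\<^bsub>residue_field R\<^esub> \<odot>\<^bsub>V\<^esub> v = v" unfolding one using V_smult[OF one_closed v] v by simp
  next
    fix c v assume "c \<in> carrier (residue_field R)" "v \<in> carrier V"
    then obtain r where "r \<in> carrier R" "c = I +>\<^bsub>R\<^esub> r" "v \<in> carrier H" using cls by auto
    then show "c \<odot>\<^bsub>V\<^esub> v \<in> carrier V" by (simp add: V_smult)
  next
    fix a b v assume "a \<in> carrier (residue_field R)" "b \<in> carrier (residue_field R)" "v \<in> carrier V"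
    then obtain r s where rs: "r \<in> carrier R" "a = I +>\<^bsub>R\<^esub> r" "s \<in> carrier R" "b = I +>\<^bsub>R\<^esub> s"
      and v: "v \<in> carrier H" using cls by (metis V_simps(1))
    show "(a \<otimes>\<^bsub>residue_field R\<^esub> b) \<odot>\<^bsub>V\<^esub> v = a \<odot>\<^bsub>V\<^esub> (b \<odot>\<^bsub>V\<^esub> v)"
      using rs v by (simp add: kk V_smult H.smult_assoc1)
    show "(a \<oplus>\<^bsub>residue_field R\<^esub> b) \<odot>\<^bsub>V\<^esub> v = a \<odot>\<^bsub>V\<^esub> v \<oplus>\<^bsub>V\<^esub> b \<odot>\<^bsub>V\<^esub> v"
      using rs v by (simp add: kk V_smult H.smult_l_distr)
  next
    fix a v w assume "a \<in> carrier (residue_field R)" "v \<in> carrier V" "w \<in> carrier V"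
    then obtain r where "r \<in> carrier R" "a = I +>\<^bsub>R\<^esub> r" "v \<in> carrier H" "w \<in> carrier H"
      using cls by auto
    then show "a \<odot>\<^bsub>V\<^esub> (v \<oplus>\<^bsub>V\<^esub> w) = a \<odot>\<^bsub>V\<^esub> v \<oplus>\<^bsub>V\<^esub> a \<odot>\<^bsub>V\<^esub> w"
      by (simp add: V_smult H.smult_r_distr)
  qed (simp_all add: H.M.a_ac)
  then show ?thesis using fld by (simp add: vectorspace_def)
qed

lemma V_submodule_iff: "submodule (residue_field R) P V \<longleftrightarrow> submodule R P H"
proof
  assume "submodule (residue_field R) P V"
  then interpret P: submodule "residue_field R" P V .
  show "submodule R P H"
  proof (rule submodule.intro[OF H_module])
    show "P \<subseteq> carrier H" using P.subset by simp
    show "r \<odot>\<^bsub>H\<^esub> v \<in> P" if "r \<in> carrier R" "v \<in> P" for r v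
    proof -
      have "I +>\<^bsub>R\<^esub> r \<in> carrier (residue_field R)"
        unfolding carrier_residue_field by (rule class_in_k[OF that(1)])
      from P.smult_closed[OF this that(2)] show ?thesis
        using V_smult[OF that(1)] P.subset that(2) by auto
    qed
  qed (use P.m_closed P.zero_closed in simp_all)
next
  assume "submodule R P H"
  then interpret P: submodule R P H .
  show "submodule (residue_field R) P V"
  proof (rule submodule.intro)
    show "module (residue_field R) V" using V_vectorspace by (simp add: vectorspace_def)
    show "P \<subseteq> carrier V" using P.subset by simp
    show "c \<odot>\<^bsub>V\<^esub> v \<in> P" if c: "c \<in> carrier (residue_field R)" and v: "v \<in> P" for c v
    proof -
      obtain r where r: "r \<in> carrier R" "c = I +>\<^bsub>R\<^esub> r"
        using c unfolding carrier_residue_field carrier_k by auto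
      then show ?thesis using V_smult[OF r(1)] P.smult_closed[OF r(1) v] P.subset v by auto
    qed
  qed (use P.m_closed P.zero_closed in simp_all)
qed

lemma generating_set_imp_tor_generated:
  assumes A: "finite A" "A \<subseteq> carrier V" "module.span (residue_field R) V A = carrier V"
  shows "\<exists>Y. tor_generated_by R I F d j Y \<and> finite Y \<and> card Y \<le> card A"
proof -
  have modV: "module (residue_field R) V" using V_vectorspace by (simp add: vectorspace_def)
  have "\<forall>a\<in>A. \<exists>y. y \<in> W \<and> \<rho> y = a" using A(2) \<rho>_surj by (metis V_simps(1) imageE subsetD)
  then obtain y where y: "\<forall>a\<in>A. y a \<in> W \<and> \<rho> (y a) = a" by metis
  have "tor_generated_by R I F d j (y ` A)"
    unfolding tor_generated_by_def
  proof (intro conjI allI impI)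
    show "y ` A \<subseteq> W" using y by blast
    fix P assume P: "submodule R P (F (Suc j))" "y ` A \<subseteq> P" "IF \<subseteq> P"
      "d (Suc j) ` carrier (F (Suc (Suc j))) \<subseteq> P"
    have PW: "submodule R (P \<inter> W) ((F (Suc j))\<lparr>carrier := W\<rparr>)"
      using submodule.m_closed[OF P(1)] submodule.zero_closed[OF P(1)] submodule.smult_closed[OF P(1)]
        submodule.m_closed[OF W_submodule] submodule.zero_closed[OF W_submodule]
        submodule.smult_closed[OF W_submodule]
      by (intro submodule.intro W_module) simp_all
    have "submodule R (\<rho> ` (P \<inter> W)) H"
      by (rule submodule_image[OF W_module H_module \<rho>_hom PW])
    then have "submodule (residue_field R) (\<rho> ` (P \<inter> W)) V" by (simp add: V_submodule_iff)
    moreover have "A \<subseteq> \<rho> ` (P \<inter> W)"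
    proof
      fix a assume a: "a \<in> A"
      then have "y a \<in> P \<inter> W" using y P(2) by blast
      then show "a \<in> \<rho> ` (P \<inter> W)" using y a by (metis imageI)
    qed
    ultimately have "module.span (residue_field R) V A \<subseteq> \<rho> ` (P \<inter> W)" by (rule span_minimal)
    then have all: "carrier H \<subseteq> \<rho> ` (P \<inter> W)" using A(3) by simp
    show "W \<subseteq> P"
    proof
      fix w assume w: "w \<in> W"
      then obtain p where p: "p \<in> P" "p \<in> W" "\<rho> w = \<rho> p" using all \<rho>_surj by blast
      let ?M = "(F (Suc j))\<lparr>carrier := W\<rparr>"
      have wc: "w \<in> carrier (F (Suc j))" and pc: "p \<in> carrier (F (Suc j))" using w p by (simp_all add: W_iff)
      define x where "x = w \<ominus>\<^bsub>F (Suc j)\<^esub> p"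
      have xW: "x \<in> W" unfolding x_def by (rule submodule_minus[OF W_submodule w p(2)])
      have wx: "w = x \<oplus>\<^bsub>F (Suc j)\<^esub> p"
      proof -
        interpret M: module R "F (Suc j)" by (rule F)
        show ?thesis unfolding x_def using wc pc by (simp add: a_minus_def M.M.a_assoc M.M.l_neg)
      qed
      have "\<rho> w = \<rho> x \<oplus>\<^bsub>H\<^esub> \<rho> p"
        using module_hom_add[OF \<rho>_hom, of x p] xW p(2) wx by simp
      moreover have "\<rho> x \<in> carrier H" "\<rho> p \<in> carrier H" using xW p(2) \<rho>_surj by blast+
      ultimately have "\<rho> x = \<zero>\<^bsub>H\<^esub>"
      proof -
        interpret H: module R H by (rule H_module)
        show "\<rho> w = \<rho> x \<oplus>\<^bsub>H\<^esub> \<rho> p \<Longrightarrow> \<rho> x \<in> carrier H \<Longrightarrow> \<rho> p \<in> carrier H \<Longrightarrow> \<rho> x = \<zero>\<^bsub>H\<^esub>"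
          using p(3) by simp
      qed
      then obtain z where z: "z \<in> carrier (F (Suc (Suc j)))" "x \<ominus>\<^bsub>F (Suc j)\<^esub> d (Suc j) z \<in> IF"
        using \<rho>_eq_zero[OF xW] by blast
      have "x \<in> P"
        by (rule submodule_cancel_right[OF P(1) subsetD[OF P(3) z(2)] subsetD[OF P(4) imageI[OF z(1)]]])
          (use xW in \<open>simp add: W_iff\<close>)
      then show "w \<in> P" unfolding wx using submodule.m_closed[OF P(1)] p(1) by simp
    qed
  qed
  then show ?thesis using A(1) card_image_le[OF A(1)] by (intro exI[of _ "y ` A"]) simp
qed

lemma tor_generated_imp_generating_set:
  assumes Y: "tor_generated_by R I F d j Y"
  shows "\<rho> ` Y \<subseteq> carrier V" and "module.span (residue_field R) V (\<rho> ` Y) = carrier V"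
proof -
  have modV: "module (residue_field R) V" using V_vectorspace by (simp add: vectorspace_def)
  interpret V: module "residue_field R" V by (rule modV)
  have YW: "Y \<subseteq> W" using Y by (simp add: tor_generated_by_def)
  show YV: "\<rho> ` Y \<subseteq> carrier V" using YW \<rho>_surj by auto
  let ?S = "V.span (\<rho> ` Y)"
  have S: "submodule R ?S H" using V.span_is_submodule[OF YV] by (simp add: V_submodule_iff)
  let ?P = "{y \<in> carrier ((F (Suc j))\<lparr>carrier := W\<rparr>). \<rho> y \<in> ?S}"
  have "submodule R ?P ((F (Suc j))\<lparr>carrier := W\<rparr>)"
    by (rule submodule_preimage[OF W_module H_module \<rho>_hom S])
  then interpret P: submodule R ?P "(F (Suc j))\<lparr>carrier := W\<rparr>" .
  have P: "submodule R ?P (F (Suc j))"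
    using P.m_closed P.zero_closed P.smult_closed W_iff
    by (intro submodule.intro F) auto
  have z0: "\<rho> y \<in> ?S" if "\<rho> y = \<zero>\<^bsub>H\<^esub>" for y using that submodule.zero_closed[OF S] by simp
  have "W \<subseteq> ?P"
  proof -
    have 1: "Y \<subseteq> ?P" using V.in_own_span[OF YV] YW by auto
    have 2: "IF \<subseteq> ?P"
    proof
      fix y assume y: "y \<in> IF"
      have zc: "\<zero>\<^bsub>F (Suc (Suc j))\<^esub> \<in> carrier (F (Suc (Suc j)))"
        using submodule.zero_closed[OF submodule_carrier[OF F]] .
      have "y \<ominus>\<^bsub>F (Suc j)\<^esub> d (Suc j) \<zero>\<^bsub>F (Suc (Suc j))\<^esub> \<in> IF"
        unfolding hom_zero[OF F F d]
        using module_minus_zero[OF F subsetD[OF submodule.subset[OF IF_submodule] y]] y by simp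
      then have "\<rho> y = \<zero>\<^bsub>H\<^esub>" using \<rho>_eq_zero[OF subsetD[OF IF_in_W y]] zc by blast
      then show "y \<in> ?P" using z0 subsetD[OF IF_in_W y] by simp
    qed
    have 3: "d (Suc j) ` carrier (F (Suc (Suc j))) \<subseteq> ?P"
    proof (rule image_subsetI)
      fix z assume z: "z \<in> carrier (F (Suc (Suc j)))"
      have "d (Suc j) z \<ominus>\<^bsub>F (Suc j)\<^esub> d (Suc j) z \<in> IF"
        using module_minus_self[OF F hom_into[OF d z]] submodule.zero_closed[OF IF_submodule] by simp
      then have "\<rho> (d (Suc j) z) = \<zero>\<^bsub>H\<^esub>" using \<rho>_eq_zero[OF boundary_in_W[OF z]] z by blast
      then show "d (Suc j) z \<in> ?P" using z0 boundary_in_W[OF z] by simp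
    qed
    show ?thesis
      using Y P 1 2 3 unfolding tor_generated_by_def by (elim conjE allE[of _ ?P]) simp
  qed
  then have "\<rho> ` W \<subseteq> ?S" by auto
  then show "?S = carrier V" using \<rho>_surj V.span_is_subset2[OF YV] by auto
qed

text \<open>
  The dimension is the least size of a generating set, and taking images under \<open>\<rho>\<close> or choosing
  preimages does not increase the size.
\<close>

lemma dim_homology_eqI:
  assumes "tor_generated_by R I F d j Y" "finite Y"
    and "\<And>Y'. tor_generated_by R I F d j Y' \<Longrightarrow> finite Y' \<Longrightarrow> card Y \<le> card Y'"
  shows "vectorspace.dim (residue_field R) (residue_vectorspace R (homology C D (Suc j))) = card Y"
proof -
  interpret V: vectorspace "residue_field R" V by (rule V_vectorspace)
  note g = tor_generated_imp_generating_set[OF assms(1)]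
  have low: "card Y \<le> card A"
    if "finite A" "A \<subseteq> carrier V" "V.span A = carrier V" for A
    using generating_set_imp_tor_generated[OF that] assms(3) le_trans by blast
  have "card (\<rho> ` Y) = card Y"
    using low[OF finite_imageI[OF assms(2)] g] card_image_le[OF assms(2), of \<rho>] by simp
  then have "V.dim = card Y"
    unfolding V.dim_def using low g assms(2)
    by (intro Least_equality) (auto intro!: exI[of _ "\<rho> ` Y"])
  then show ?thesis by (simp add: homology_eq)
qed

end

context residue_ring
begin

text \<open>
  Betti numbers are defined through the resolution \<open>F\<close> picked by \<^const>\<open>chosen_resolution\<close>. All that
  is known of it is that it is a resolution, provided that one exists over its type, and this is what
  the hypothesis on \<open>F\<close> is for. The number of generators is then carried over from \<open>G\<close>.
\<close>

lemma betti_eqI: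
  fixes M :: "('a, 'm, 'c) module_scheme"
    and F :: "nat \<Rightarrow> ('a, ('a + 'm) list) module"
  assumes M: "module R M" and F: "free_resolution R M F d e" and G: "free_resolution R M G d' e'"
    and Y: "tor_generated_by R I G d' j Y" "finite Y"
      "\<And>Y'. tor_generated_by R I G d' j Y' \<Longrightarrow> finite Y' \<Longrightarrow> card Y \<le> card Y'"
  shows "betti R M (Suc j) = card Y"
proof -
  obtain F0 d0 e0 where c: "chosen_resolution R M = (F0, d0, e0)" by (rule prod_cases3)
  have "(case chosen_resolution R M of (F, d, e) \<Rightarrow> free_resolution R M F d e)"
    unfolding chosen_resolution_def by (rule someI[of _ "(F, d, e)"]) (simp add: F)
  then have F0: "free_resolution R M F0 d0 e0" by (simp add: c)
  note F0' = free_resolutionD[OF F0]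
  interpret residue_complex R I F0 d0 j
  proof (rule residue_complex.intro[OF residue_ring_axioms], rule residue_complex_axioms.intro)
    show "d0 i (d0 (Suc i) x) = \<zero>\<^bsub>F0 i\<^esub>" if "x \<in> carrier (F0 (Suc (Suc i)))" for i x
      using F0'(7)[OF that] unfolding F0'(10) by simp
  qed (rule F0')+
  obtain Y0 where Y0: "tor_generated_by R I F0 d0 j Y0" "finite Y0" "card Y0 \<le> card Y"
    using tor_generated_transfer[OF M G F0 I_subset Y(1,2)] by blast
  have low: "card Y \<le> card Y'" if "tor_generated_by R I F0 d0 j Y'" "finite Y'" for Y'
    using tor_generated_transfer[OF M F0 G I_subset that] Y(3) le_trans by blast
  have "vectorspace.dim (residue_field R) (residue_vectorspace R (homology C D (Suc j))) = card Y0"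
    by (rule dim_homology_eqI[OF Y0(1,2)]) (rule le_trans[OF Y0(3) low])
  moreover have "Tor R (Suc j) k M = homology C D (Suc j)" by (simp add: Tor_def c)
  moreover have "card Y0 = card Y" using Y0 low by (metis le_antisym)
  ultimately show ?thesis by (simp add: betti_def)
qed

end

section \<open>Minimal free resolutions\<close>

lemma free_module_transport:
  assumes G: "free_module R G" and F: "module R F" and \<phi>: "\<phi> \<in> module_hom R G F"
    and bij: "bij_betw \<phi> (carrier G) (carrier F)"
  shows "free_module R F"
proof -
  have modG: "module R G" using G by (simp add: free_module_def)
  interpret G: module R G by fact
  interpret F: module R F by fact
  obtain B where B: "B \<subseteq> carrier G" "\<not> G.lin_dep B" "G.span B = carrier G"
    using G unfolding free_module_def by auto
  have \<phi>B: "\<phi> ` B \<subseteq> carrier F" using B(1) hom_into[OF \<phi>] by blast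
  have inj: "inj_on \<phi> (carrier G)" using bij by (simp add: bij_betw_def)
  have "\<not> F.lin_dep (\<phi> ` B)"
  proof
    assume "F.lin_dep (\<phi> ` B)"
    then obtain A a v where A: "finite A" "A \<subseteq> \<phi> ` B" "a \<in> A \<rightarrow> carrier R"
      "F.lincomb a A = \<zero>\<^bsub>F\<^esub>" "v \<in> A" "a v \<noteq> \<zero>\<^bsub>R\<^esub>"
      unfolding F.lin_dep_def by auto
    obtain A' where A': "A' \<subseteq> B" "finite A'" "A = \<phi> ` A'"
      using finite_subset_image[OF A(1,2)] by blast
    have A'G: "A' \<subseteq> carrier G" using A'(1) B(1) by blast
    have ac: "x \<in> A' \<Longrightarrow> a (\<phi> x) \<in> carrier R" for x using A(3) A'(3) by blast
    have "\<phi> (G.lincomb (\<lambda>x. a (\<phi> x)) A') = (\<Oplus>\<^bsub>F\<^esub>x\<in>A'. \<phi> (a (\<phi> x) \<odot>\<^bsub>G\<^esub> x))"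
      unfolding G.lincomb_def using ac A'G
      by (intro hom_finsum[OF modG F \<phi> A'(2)] Pi_I G.smult_closed) auto
    also have "\<dots> = (\<Oplus>\<^bsub>F\<^esub>x\<in>A'. a (\<phi> x) \<odot>\<^bsub>F\<^esub> \<phi> x)"
      using ac A'G hom_into[OF \<phi>] by (intro F.M.finsum_cong' refl Pi_I F.smult_closed module_hom_smult[OF \<phi>]) auto
    also have "\<dots> = F.lincomb a A"
      unfolding F.lincomb_def A'(3)
      by (rule F.M.finsum_reindex[symmetric])
        (use ac A'G hom_into[OF \<phi>] inj_on_subset[OF inj A'G] in \<open>auto intro!: F.smult_closed\<close>)
    also have "\<dots> = \<phi> \<zero>\<^bsub>G\<^esub>" using A(4) hom_zero[OF modG F \<phi>] by simp
    finally have "G.lincomb (\<lambda>x. a (\<phi> x)) A' = \<zero>\<^bsub>G\<^esub>"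
      by (rule inj_onD[OF inj]) (use A'G ac in \<open>auto intro!: G.lincomb_closed\<close>)
    moreover obtain x where "x \<in> A'" "a (\<phi> x) \<noteq> \<zero>\<^bsub>R\<^esub>" using A(5,6) A'(3) by blast
    ultimately have "G.lin_dep B"
      unfolding G.lin_dep_def using A'(1,2) ac
      by (intro exI[of _ A'] exI[of _ "\<lambda>x. a (\<phi> x)"] exI[of _ x]) auto
    with B(2) show False by simp
  qed
  moreover have "F.span (\<phi> ` B) = carrier F"
  proof
    show "F.span (\<phi> ` B) \<subseteq> carrier F" by (rule F.span_is_subset2[OF \<phi>B])
    have "G.span B \<subseteq> {x \<in> carrier G. \<phi> x \<in> F.span (\<phi> ` B)}"
    proof (rule span_minimal)
      show "submodule R {x \<in> carrier G. \<phi> x \<in> F.span (\<phi> ` B)} G"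
        by (rule submodule_preimage[OF modG F \<phi> F.span_is_submodule[OF \<phi>B]])
      show "B \<subseteq> {x \<in> carrier G. \<phi> x \<in> F.span (\<phi> ` B)}" using B(1) F.in_own_span[OF \<phi>B] by blast
    qed
    then have "\<phi> ` carrier G \<subseteq> F.span (\<phi> ` B)" unfolding B(3) by blast
    then show "carrier F \<subseteq> F.span (\<phi> ` B)" using bij by (simp add: bij_betw_def)
  qed
  ultimately show ?thesis using F \<phi>B unfolding free_module_def by blast
qed

text \<open>
  Transport of structure. It is used to bring a resolution into the one type over which Betti numbers
  are defined.
\<close>

lemma free_resolution_transport:
  fixes G :: "nat \<Rightarrow> ('a, 'g) module" and \<phi> :: "nat \<Rightarrow> 'g \<Rightarrow> 'f"
  assumes M: "module R M" and G: "free_resolution R M G d e"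
    and inj: "\<And>i. inj_on (\<phi> i) (carrier (G i))"
  shows "\<exists>(F :: nat \<Rightarrow> ('a, 'f) module) d' e'. free_resolution R M F d' e'"
proof -
  note G' = free_resolutionD[OF G]
  define \<psi> where "\<psi> i = inv_into (carrier (G i)) (\<phi> i)" for i
  have \<psi>\<phi>: "\<psi> i (\<phi> i x) = x" if "x \<in> carrier (G i)" for i x
    unfolding \<psi>_def by (rule inv_into_f_f[OF inj that])
  define F :: "nat \<Rightarrow> ('a, 'f) module" where "F i =
    \<lparr> carrier = \<phi> i ` carrier (G i), mult = (\<lambda>x y. x), one = \<phi> i \<zero>\<^bsub>G i\<^esub>, zero = \<phi> i \<zero>\<^bsub>G i\<^esub>,
      add = (\<lambda>x y. \<phi> i (\<psi> i x \<oplus>\<^bsub>G i\<^esub> \<psi> i y)), smult = (\<lambda>r x. \<phi> i (r \<odot>\<^bsub>G i\<^esub> \<psi> i x)) \<rparr>" for i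
  have cF: "carrier (F i) = \<phi> i ` carrier (G i)" for i by (simp add: F_def)
  have F: "module R (F i)" "\<phi> i \<in> module_hom R (G i) (F i)" for i
  proof -
    have a: "\<phi> i (x \<oplus>\<^bsub>G i\<^esub> y) = \<phi> i x \<oplus>\<^bsub>F i\<^esub> \<phi> i y"
      if "x \<in> carrier (G i)" "y \<in> carrier (G i)" for x y
      by (simp add: F_def \<psi>\<phi> that)
    have s: "\<phi> i (r \<odot>\<^bsub>G i\<^esub> x) = r \<odot>\<^bsub>F i\<^esub> \<phi> i x" if "r \<in> carrier R" "x \<in> carrier (G i)" for r x
      by (simp add: F_def \<psi>\<phi> that)
    have z: "\<phi> i \<zero>\<^bsub>G i\<^esub> = \<zero>\<^bsub>F i\<^esub>" by (simp add: F_def)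
    show "module R (F i)" by (rule module_of_surjection(1)[OF G'(2) cF[symmetric] a s z])
    show "\<phi> i \<in> module_hom R (G i) (F i)" by (rule module_of_surjection(2)[OF G'(2) cF[symmetric] a s z])
  qed
  have bij: "bij_betw (\<phi> i) (carrier (G i)) (carrier (F i))" for i
    using inj by (simp add: bij_betw_def cF)
  have \<psi>: "\<psi> i \<in> module_hom R (F i) (G i)" for i
    unfolding \<psi>_def by (rule hom_inverse[OF G'(2) F bij])
  define d' where "d' i x = \<phi> i (d i (\<psi> (Suc i) x))" for i x
  define e' where "e' x = e (\<psi> 0 x)" for x
  have im: "d' i ` carrier (F (Suc i)) = \<phi> i ` d i ` carrier (G (Suc i))" for i
    unfolding cF d'_def image_image by (rule image_cong) (simp_all add: \<psi>\<phi>)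
  have "free_resolution R M F d' e'"
    unfolding free_resolution_def
  proof (intro conjI allI)
    show "free_module R (F i)" for i by (rule free_module_transport[OF G'(1) F bij])
    show "d' i \<in> module_hom R (F (Suc i)) (F i)" for i
      unfolding d'_def by (rule hom_compose[OF F(1) \<psi> hom_compose[OF G'(2) G'(3) F(2)]])
    show "e' \<in> module_hom R (F 0) M"
      unfolding e'_def by (rule hom_compose[OF F(1) \<psi> G'(4)])
    show "e' ` carrier (F 0) = carrier M"
      unfolding G'(5)[symmetric] cF e'_def image_image by (rule image_cong) (simp_all add: \<psi>\<phi>)
    have Z0: "resolution_kernel M G d e 0 = {x \<in> carrier (G 0). e x = \<zero>\<^bsub>M\<^esub>}"
      by (simp add: set_eq_iff G'(9))
    have "a_kernel (F 0) M e' = \<phi> 0 ` resolution_kernel M G d e 0"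
      unfolding a_kernel_def' cF e'_def Z0 by (auto simp: \<psi>\<phi>)
    then show "a_kernel (F 0) M e' = d' 0 ` carrier (F 1)" using im[of 0] G'(6)[of 0] by simp
    show "a_kernel (F (Suc i)) (F i) (d' i) = d' (Suc i) ` carrier (F (Suc (Suc i)))" for i
    proof -
      have "d' i (\<phi> (Suc i) x) = \<zero>\<^bsub>F i\<^esub> \<longleftrightarrow> d i x = \<zero>\<^bsub>G i\<^esub>" if x: "x \<in> carrier (G (Suc i))" for x
      proof -
        have "d' i (\<phi> (Suc i) x) = \<phi> i (d i x)" by (simp add: d'_def \<psi>\<phi> x)
        moreover have "\<zero>\<^bsub>F i\<^esub> = \<phi> i \<zero>\<^bsub>G i\<^esub>" by (simp add: F_def)
        moreover have "\<zero>\<^bsub>G i\<^esub> \<in> carrier (G i)" using submodule.zero_closed[OF submodule_carrier[OF G'(2)]] .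
        ultimately show ?thesis using inj_on_eq_iff[OF inj hom_into[OF G'(3) x], of "\<zero>\<^bsub>G i\<^esub>"] by simp
      qed
      moreover have "resolution_kernel M G d e (Suc i) = {x \<in> carrier (G (Suc i)). d i x = \<zero>\<^bsub>G i\<^esub>}"
        by (simp add: set_eq_iff G'(10))
      ultimately have "a_kernel (F (Suc i)) (F i) (d' i) = \<phi> (Suc i) ` resolution_kernel M G d e (Suc i)"
        unfolding a_kernel_def' cF by auto
      then show ?thesis using im[of "Suc i"] G'(6)[of "Suc i"] by simp
    qed
  qed
  then show ?thesis by blast
qed

lemma sum_fun_apply: "(\<Sum>v\<in>A. f v) s = (\<Sum>v\<in>A. f v s)"
  for f :: "'a \<Rightarrow> 'b \<Rightarrow> 'c::comm_monoid_add"
  by (induct A rule: infinite_finite_induct) auto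

lemma vector_space_functions: "vector_space (\<lambda>(c::'k::field) f i. c * f i)"
  by unfold_locales (simp_all add: fun_eq_iff distrib_left distrib_right mult.assoc)

text \<open>
  Generation is expressed by the submodules of the ambient \<open>M\<close>, so that \<open>Z\<close> can be any submodule
  without being given a module structure of its own.
\<close>

definition fin_gen_in :: "('a, 'b) ring_scheme \<Rightarrow> ('a, 'm, 'c) module_scheme \<Rightarrow> 'm set \<Rightarrow> 'm set \<Rightarrow> bool"
  where "fin_gen_in R M Z A \<longleftrightarrow> finite A \<and> A \<subseteq> Z \<and> (\<forall>P. submodule R P M \<longrightarrow> A \<subseteq> P \<longrightarrow> Z \<subseteq> P)"

abbreviation std_free :: "('a, 'b) ring_scheme \<Rightarrow> nat \<Rightarrow> ('a, nat \<Rightarrow> 'a) module"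
  where "std_free R r \<equiv> free_module_on R {..<r}"

definition submodules_fin_gen :: "('a, 'b) ring_scheme \<Rightarrow> bool"
  where "submodules_fin_gen R \<longleftrightarrow>
    (\<forall>r Z. submodule R Z (std_free R r) \<longrightarrow> (\<exists>A. fin_gen_in R (std_free R r) Z A))"

text \<open>
  The residue map takes its values in a type of class \<open>field\<close>, which makes the linear algebra of
  type classes available for counting generators.
\<close>

locale local_noetherian = residue_ring R I
  for R :: "('a, 'b) ring_scheme" and I :: "'a set" +
  fixes res :: "'a \<Rightarrow> 'k::field"
  assumes res_add: "x \<in> carrier R \<Longrightarrow> y \<in> carrier R \<Longrightarrow> res (x \<oplus>\<^bsub>R\<^esub> y) = res x + res y"
    and res_mult: "x \<in> carrier R \<Longrightarrow> y \<in> carrier R \<Longrightarrow> res (x \<otimes>\<^bsub>R\<^esub> y) = res x * res y"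
    and res_one: "res \<one>\<^bsub>R\<^esub> = 1"
    and in_I_iff: "x \<in> carrier R \<Longrightarrow> x \<in> I \<longleftrightarrow> res x = 0"
    and unit: "x \<in> carrier R \<Longrightarrow> res x \<noteq> 0 \<Longrightarrow> \<exists>u\<in>carrier R. u \<otimes>\<^bsub>R\<^esub> x = \<one>\<^bsub>R\<^esub>"
    and noetherian: "submodules_fin_gen R"
begin

lemma zero_in_I: "\<zero>\<^bsub>R\<^esub> \<in> I"
  using additive_subgroup.zero_closed[OF ideal.axioms(1)[OF ideal_I]] .

lemma res_zero: "res \<zero>\<^bsub>R\<^esub> = 0"
  using in_I_iff[OF zero_closed] zero_in_I by simp

lemma one_neq_zero: "\<one>\<^bsub>R\<^esub> \<noteq> \<zero>\<^bsub>R\<^esub>"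
proof
  assume "\<one>\<^bsub>R\<^esub> = \<zero>\<^bsub>R\<^esub>"
  then have "res \<one>\<^bsub>R\<^esub> = 0" by (simp only: res_zero)
  then show False by (simp add: res_one)
qed

lemma std_free_module: "module R (std_free R r)"
  by (rule free_module_on_module[OF cring])

text \<open>
  A minimal set of generators of \<open>Z\<close>: by minimality a relation among them has no unit coefficient.
\<close>

lemma minimal_cover:
  assumes M: "module R M" and Z: "submodule R Z M" and A: "fin_gen_in R M Z A"
  shows "\<exists>r g. g \<in> {..<r} \<rightarrow> Z \<and> lin_ext R M g ` carrier (std_free R r) = Z \<and>
    (\<forall>f\<in>carrier (std_free R r). lin_ext R M g f = \<zero>\<^bsub>M\<^esub> \<longrightarrow> (\<forall>s. f s \<in> I))"
proof -
  interpret M: module R M by fact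
  interpret Z: submodule R Z M by fact
  define A0 where "A0 = (ARG_MIN card A. fin_gen_in R M Z A)"
  have A0: "fin_gen_in R M Z A0" and least: "\<And>B. fin_gen_in R M Z B \<Longrightarrow> card A0 \<le> card B"
    unfolding A0_def using arg_min_nat_lemma[of "fin_gen_in R M Z" A card] A by auto
  then have A0': "finite A0" "A0 \<subseteq> Z" "\<And>P. submodule R P M \<Longrightarrow> A0 \<subseteq> P \<Longrightarrow> Z \<subseteq> P"
    by (auto simp: fin_gen_in_def)
  define r where "r = card A0"
  obtain g where g: "bij_betw g {..<r} A0"
    using ex_bij_betw_nat_finite[OF A0'(1)] unfolding r_def atLeast0LessThan by blast
  have gA: "g s \<in> A0" if "s < r" for s using g that by (auto simp: bij_betw_def)
  have gZ: "g \<in> {..<r} \<rightarrow> Z" and gM: "g \<in> {..<r} \<rightarrow> carrier M" using gA A0'(2) Z.subset by auto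
  note hom = lin_ext_hom[OF M gM]
  note gen = lin_ext_gen[OF M gM]
  have "lin_ext R M g ` carrier (std_free R r) = Z"
  proof
    have "carrier (std_free R r) \<subseteq> {f \<in> carrier (std_free R r). lin_ext R M g f \<in> Z}"
    proof (rule free_module_on_generated[OF cring submodule_preimage[OF std_free_module M hom Z]])
      fix s assume s: "s \<in> {..<r}"
      then show "free_gen R s \<in> {f \<in> carrier (std_free R r). lin_ext R M g f \<in> Z}"
        using gen[OF s] gZ free_gen_closed[OF cring s] by auto
    qed
    then show "lin_ext R M g ` carrier (std_free R r) \<subseteq> Z" by blast
    show "Z \<subseteq> lin_ext R M g ` carrier (std_free R r)"
    proof (rule A0'(3)[OF submodule_image[OF std_free_module M hom submodule_carrier[OF std_free_module]]], rule subsetI)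
      fix a assume "a \<in> A0"
      then obtain s where s: "s \<in> {..<r}" "a = g s" using g by (auto simp: bij_betw_def)
      show "a \<in> lin_ext R M g ` carrier (std_free R r)"
        unfolding s(2) gen[OF s(1), symmetric] by (rule imageI[OF free_gen_closed[OF cring s(1)]])
    qed
  qed
  moreover have "f s \<in> I" if f: "f \<in> carrier (std_free R r)" "lin_ext R M g f = \<zero>\<^bsub>M\<^esub>" for f s
  proof (rule ccontr)
    assume fs: "f s \<notin> I"
    have fc: "f t \<in> carrier R" for t by (rule free_module_on_coeff[OF cring f(1)])
    have s: "s < r" using f(1) fs zero_in_I by (auto simp: carrier_free_module_on)
    obtain u where u: "u \<in> carrier R" "u \<otimes>\<^bsub>R\<^esub> f s = \<one>\<^bsub>R\<^esub>" using unit[OF fc] fs in_I_iff[OF fc] by blast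
    let ?B = "A0 - {g s}"
    have "fin_gen_in R M Z ?B"
      unfolding fin_gen_in_def
    proof (intro conjI allI impI)
      fix P assume P: "submodule R P M" "?B \<subseteq> P"
      have gs: "g s \<in> carrier M" using gM s by auto
      have "lin_ext R M g f = (\<Oplus>\<^bsub>M\<^esub>t\<in>{..<r}. f t \<odot>\<^bsub>M\<^esub> g t)"
        by (rule lin_ext_eq_finsum[OF M f(1) gM]) (use free_module_on_support[OF f(1)] in auto)
      also have "{..<r} = insert s ({..<r} - {s})" using s by auto
      also have "(\<Oplus>\<^bsub>M\<^esub>t\<in>insert s ({..<r} - {s}). f t \<odot>\<^bsub>M\<^esub> g t)
          = f s \<odot>\<^bsub>M\<^esub> g s \<oplus>\<^bsub>M\<^esub> (\<Oplus>\<^bsub>M\<^esub>t\<in>{..<r} - {s}. f t \<odot>\<^bsub>M\<^esub> g t)"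
        by (rule M.M.finsum_insert) (use gM s fc in auto)
      finally have e: "f s \<odot>\<^bsub>M\<^esub> g s \<oplus>\<^bsub>M\<^esub> (\<Oplus>\<^bsub>M\<^esub>t\<in>{..<r} - {s}. f t \<odot>\<^bsub>M\<^esub> g t) = \<zero>\<^bsub>M\<^esub>" using f(2) by simp
      have sumP: "(\<Oplus>\<^bsub>M\<^esub>t\<in>{..<r} - {s}. f t \<odot>\<^bsub>M\<^esub> g t) \<in> P"
      proof (rule submodule_finsum[OF P(1)])
        fix t assume t: "t \<in> {..<r} - {s}"
        then have "g t \<noteq> g s" using g s by (auto simp: bij_betw_def inj_on_def)
        then have "g t \<in> P" using P(2) gA t by auto
        then show "f t \<odot>\<^bsub>M\<^esub> g t \<in> P" by (rule submodule.smult_closed[OF P(1) fc])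
      qed simp
      have sumc: "(\<Oplus>\<^bsub>M\<^esub>t\<in>{..<r} - {s}. f t \<odot>\<^bsub>M\<^esub> g t) \<in> carrier M"
        by (rule subsetD[OF submodule.subset[OF P(1)] sumP])
      have "f s \<odot>\<^bsub>M\<^esub> g s = \<ominus>\<^bsub>M\<^esub> (\<Oplus>\<^bsub>M\<^esub>t\<in>{..<r} - {s}. f t \<odot>\<^bsub>M\<^esub> g t)"
        by (rule M.M.minus_equality[symmetric]) (use e sumc gs fc in auto)
      then have "f s \<odot>\<^bsub>M\<^esub> g s \<in> P" using submodule_uminus[OF P(1) sumP] by simp
      from submodule.smult_closed[OF P(1) u(1) this]
      have "g s \<in> P" using M.smult_assoc1[OF u(1) fc gs, of s] u(2) gs by simp
      then have "A0 \<subseteq> P" using P(2) by blast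
      then show "Z \<subseteq> P" by (rule A0'(3)[OF P(1)])
    qed (use A0' in auto)
    from least[OF this] show False using gA[OF s] A0'(1) by (metis card_Diff1_less not_less)
  qed
  ultimately show ?thesis using gZ by blast
qed

lemma ideal_smult_std_free: "ideal_smult R I (std_free R r) = {f \<in> carrier (std_free R r). \<forall>s. f s \<in> I}"
proof
  let ?P = "{f \<in> carrier (std_free R r). \<forall>s. f s \<in> I}"
  interpret R: cring R by (rule cring)
  interpret I: ideal I R by (rule ideal_I)
  interpret L: module R "std_free R r" by (rule std_free_module)
  note fc = free_module_on_coeff[OF cring]
  have "submodule R ?P (std_free R r)"
  proof (rule submodule.intro[OF std_free_module])
    show "\<zero>\<^bsub>std_free R r\<^esub> \<in> ?P" using L.M.zero_closed zero_in_I by simp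
    show "v \<oplus>\<^bsub>std_free R r\<^esub> w \<in> ?P" if "v \<in> ?P" "w \<in> ?P" for v w
      using that L.M.a_closed[of v w] I.a_closed by simp
    show "c \<odot>\<^bsub>std_free R r\<^esub> v \<in> ?P" if "c \<in> carrier R" "v \<in> ?P" for c v
      using that L.smult_closed[of c v] I.I_l_closed by simp
  qed auto
  then show "ideal_smult R I (std_free R r) \<subseteq> ?P"
  proof (rule ideal_smult_least)
    fix c f assume c: "c \<in> I" and f: "f \<in> carrier (std_free R r)"
    have cR: "c \<in> carrier R" using c I_subset by auto
    show "c \<odot>\<^bsub>std_free R r\<^esub> f \<in> ?P"
      using L.smult_closed[OF cR f] I.I_r_closed[OF c fc[OF f]] by simp
  qed
  note IL = ideal_smult_submodule[OF std_free_module[of r] I_subset]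
  show "?P \<subseteq> ideal_smult R I (std_free R r)"
  proof
    fix f assume f: "f \<in> ?P"
    then have fL: "f \<in> carrier (std_free R r)" by simp
    have "lin_ext R (std_free R r) (free_gen R) f \<in> ideal_smult R I (std_free R r)"
      unfolding lin_ext_def
    proof (rule submodule_finsum[OF IL])
      fix s assume s: "s \<in> {s. f s \<noteq> \<zero>\<^bsub>R\<^esub>}"
      then have "s \<in> {..<r}" using free_module_on_support(1)[OF fL] by blast
      from ideal_smult_mem[OF std_free_module I_subset _ free_gen_closed[OF cring this]]
      show "f s \<odot>\<^bsub>std_free R r\<^esub> free_gen R s \<in> ideal_smult R I (std_free R r)" using f by blast
    qed (rule free_module_on_support(2)[OF fL])
    then show "f \<in> ideal_smult R I (std_free R r)" using free_module_on_expand[OF cring fL] by simp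
  qed
qed

text \<open>
  Iterating \<open>minimal_cover\<close>: the kernel of each cover lies in \<open>I\<close> times the free module, and the next
  cover is a minimal one of that kernel.
\<close>

lemma minimal_resolution_exists:
  assumes "fin_gen_module R M"
  shows "\<exists>r g e. free_resolution R M (\<lambda>i. std_free R (r i)) (\<lambda>i. lin_ext R (std_free R (r i)) (g i)) e \<and>
    (\<forall>i. g i \<in> {..<r (Suc i)} \<rightarrow> {f \<in> carrier (std_free R (r i)). \<forall>s. f s \<in> I})"
proof -
  have M: "module R M" using assms by (simp add: fin_gen_module_def)
  interpret M: module R M by fact
  obtain A where A: "A \<subseteq> carrier M" "finite A" "M.span A = carrier M"
    using assms by (auto simp: fin_gen_module_def)
  have "fin_gen_in R M (carrier M) A"
    unfolding fin_gen_in_def using A(1,2) span_minimal[of R _ M A] A(3) by blast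
  from minimal_cover[OF M submodule_carrier[OF M] this]
  obtain r0 g0 where g0: "g0 \<in> {..<r0} \<rightarrow> carrier M"
    "lin_ext R M g0 ` carrier (std_free R r0) = carrier M"
    "\<forall>f\<in>carrier (std_free R r0). lin_ext R M g0 f = \<zero>\<^bsub>M\<^esub> \<longrightarrow> (\<forall>s. f s \<in> I)"
    by (elim exE conjE) (rule that)
  define e where "e = lin_ext R M g0"
  have e: "e \<in> module_hom R (std_free R r0) M" unfolding e_def by (rule lin_ext_hom[OF M g0(1)])
  define Z0 where "Z0 = {f \<in> carrier (std_free R r0). e f \<in> {\<zero>\<^bsub>M\<^esub>}}"
  have zero_sub: "submodule R {\<zero>\<^bsub>N\<^esub>} N" if "module R N" for N :: "('a, 'n, 'e) module_scheme"
  proof -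
    interpret N: module R N by fact
    show ?thesis by (rule submodule.intro) (auto intro: that)
  qed
  define Ok where "Ok r Z \<longleftrightarrow> submodule R Z (std_free R r) \<and> (\<forall>f\<in>Z. \<forall>s. f s \<in> I)" for r Z
  have Ok0: "Ok r0 Z0"
    unfolding Ok_def Z0_def
    using submodule_preimage[OF std_free_module M e zero_sub[OF M]] g0(3) by (simp add: e_def)
  define Next where "Next x y \<longleftrightarrow> (\<exists>g. g \<in> {..<fst y} \<rightarrow> snd x \<and>
      lin_ext R (std_free R (fst x)) g ` carrier (std_free R (fst y)) = snd x \<and>
      snd y = {f \<in> carrier (std_free R (fst y)).
        lin_ext R (std_free R (fst x)) g f \<in> {\<zero>\<^bsub>std_free R (fst x)\<^esub>}})" for x y :: "nat \<times> (nat \<Rightarrow> 'a) set"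
  define P where "P n x \<longleftrightarrow> Ok (fst x) (snd x) \<and> (n = 0 \<longrightarrow> x = (r0, Z0))" for n :: nat and x
  have "\<exists>x. P 0 x" using Ok0 by (intro exI[of _ "(r0, Z0)"]) (simp add: P_def)
  moreover have "\<exists>y. P (Suc n) y \<and> Next x y" if "P n x" for n x
  proof -
    obtain r Z where x: "x = (r, Z)" by (rule prod.exhaust)
    have Z: "submodule R Z (std_free R r)" using that by (simp add: P_def Ok_def x)
    obtain B where "fin_gen_in R (std_free R r) Z B"
      using noetherian Z unfolding submodules_fin_gen_def by blast
    from minimal_cover[OF std_free_module Z this] obtain r' g where g: "g \<in> {..<r'} \<rightarrow> Z"
      "lin_ext R (std_free R r) g ` carrier (std_free R r') = Z"
      "\<forall>f\<in>carrier (std_free R r'). lin_ext R (std_free R r) g f = \<zero>\<^bsub>std_free R r\<^esub> \<longrightarrow> (\<forall>s. f s \<in> I)"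
      by (elim exE conjE) (rule that)
    define Z' where "Z' = {f \<in> carrier (std_free R r'). lin_ext R (std_free R r) g f \<in> {\<zero>\<^bsub>std_free R r\<^esub>}}"
    have gc: "g \<in> {..<r'} \<rightarrow> carrier (std_free R r)" using g(1) submodule.subset[OF Z] by blast
    have "submodule R Z' (std_free R r')"
      unfolding Z'_def
      by (rule submodule_preimage[OF std_free_module std_free_module lin_ext_hom[OF std_free_module gc]
            zero_sub[OF std_free_module]])
    moreover have "\<forall>f\<in>Z'. \<forall>s. f s \<in> I" using g(3) unfolding Z'_def by blast
    ultimately have "P (Suc n) (r', Z')" by (simp add: P_def Ok_def)
    moreover have "Next x (r', Z')"
      unfolding Next_def x using g(1,2) by (intro exI[of _ g]) (simp add: Z'_def)
    ultimately show ?thesis by blast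
  qed
  ultimately have "\<exists>x. \<forall>n. P n (x n) \<and> Next (x n) (x (Suc n))"
    by (rule dependent_nat_choice[where P = P and Q = "\<lambda>n. Next"])
  then obtain x where x: "\<forall>n. P n (x n) \<and> Next (x n) (x (Suc n))" by (rule exE)
  then have xP: "P n (x n)" and xN: "Next (x n) (x (Suc n))" for n by simp_all
  define r where "r n = fst (x n)" for n
  define Z where "Z n = snd (x n)" for n
  have "\<forall>n. \<exists>g. g \<in> {..<r (Suc n)} \<rightarrow> Z n \<and>
      lin_ext R (std_free R (r n)) g ` carrier (std_free R (r (Suc n))) = Z n \<and>
      Z (Suc n) = {f \<in> carrier (std_free R (r (Suc n))). lin_ext R (std_free R (r n)) g f \<in> {\<zero>\<^bsub>std_free R (r n)\<^esub>}}"
    using xN unfolding Next_def r_def Z_def by blast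
  from choice[OF this] obtain g where g: "\<forall>n. g n \<in> {..<r (Suc n)} \<rightarrow> Z n \<and>
      lin_ext R (std_free R (r n)) (g n) ` carrier (std_free R (r (Suc n))) = Z n \<and>
      Z (Suc n) = {f \<in> carrier (std_free R (r (Suc n))). lin_ext R (std_free R (r n)) (g n) f \<in> {\<zero>\<^bsub>std_free R (r n)\<^esub>}}"
    by (rule exE)
  have r0: "r 0 = r0" "Z 0 = Z0" using xP[of 0] by (simp_all add: P_def r_def Z_def)
  have gZ: "g n \<in> {..<r (Suc n)} \<rightarrow> {f \<in> carrier (std_free R (r n)). \<forall>s. f s \<in> I}" for n
    using g xP[of n] submodule.subset[of R "Z n" "std_free R (r n)"]
    unfolding P_def Ok_def r_def[symmetric] Z_def[symmetric] by blast
  have gc: "g n \<in> {..<r (Suc n)} \<rightarrow> carrier (std_free R (r n))" for n using gZ[of n] by blast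
  have "free_resolution R M (\<lambda>i. std_free R (r i)) (\<lambda>i. lin_ext R (std_free R (r i)) (g i)) e"
    unfolding free_resolution_def
  proof (intro conjI allI)
    show "free_module R (std_free R (r i))" for i
      by (rule free_module_free_module_on[OF cring one_neq_zero])
    show "lin_ext R (std_free R (r i)) (g i) \<in> module_hom R (std_free R (r (Suc i))) (std_free R (r i))" for i
      by (rule lin_ext_hom[OF std_free_module gc])
    show "e \<in> module_hom R (std_free R (r 0)) M" using e r0 by simp
    show "e ` carrier (std_free R (r 0)) = carrier M" using g0(2) r0 by (simp add: e_def)
    have "a_kernel (std_free R (r 0)) M e = Z 0" using r0 by (auto simp: a_kernel_def' Z0_def)
    then show "a_kernel (std_free R (r 0)) M e
        = lin_ext R (std_free R (r 0)) (g 0) ` carrier (std_free R (r 1))" using g by simp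
    show "a_kernel (std_free R (r (Suc i))) (std_free R (r i)) (lin_ext R (std_free R (r i)) (g i))
        = lin_ext R (std_free R (r (Suc i))) (g (Suc i)) ` carrier (std_free R (r (Suc (Suc i))))" for i
    proof -
      have "a_kernel (std_free R (r (Suc i))) (std_free R (r i)) (lin_ext R (std_free R (r i)) (g i)) = Z (Suc i)"
        using g by (simp add: a_kernel_def')
      then show ?thesis using g by simp
    qed
  qed
  with gZ show ?thesis by blast
qed

text \<open>
  For a minimal resolution the differentials of \<open>k \<otimes> G\<close> vanish, so the cycles are all of \<open>G\<^sub>j\<^sub>+\<^sub>1\<close> and the
  boundaries are in \<open>I G\<^sub>j\<^sub>+\<^sub>1\<close>. The basis vectors generate, and reducing coefficients with \<open>res\<close> shows that
  fewer elements do not. To bring the resolution into the type over which Betti numbers are defined,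
  a vector is encoded by the list of its coefficients.
\<close>

lemma betti_eq_rank:
  fixes M :: "('a, 'm, 'c) module_scheme"
  assumes M: "module R M"
    and G: "free_resolution R M (\<lambda>i. std_free R (r i)) (\<lambda>i. lin_ext R (std_free R (r i)) (g i)) e"
    and g: "\<And>i. g i \<in> {..<r (Suc i)} \<rightarrow> {f \<in> carrier (std_free R (r i)). \<forall>s. f s \<in> I}"
  shows "betti R M (Suc j) = r (Suc j)"
proof -
  let ?G = "\<lambda>i. std_free R (r i)" and ?d = "\<lambda>i. lin_ext R (std_free R (r i)) (g i)"
  let ?\<phi> = "\<lambda>i f. map (\<lambda>s. Inl (f s) :: 'a + 'm) [0..<r i]"
  have "inj_on (?\<phi> i) (carrier (?G i))" for i
  proof (rule inj_onI)
    fix f f' assume f: "f \<in> carrier (?G i)" "f' \<in> carrier (?G i)" "?\<phi> i f = ?\<phi> i f'"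
    have "f s = f' s" for s
    proof (cases "s < r i")
      case True
      then have "?\<phi> i f ! s = ?\<phi> i f' ! s" using f(3) by simp
      then show ?thesis using True by simp
    next
      case False
      then show ?thesis using f(1,2) by (simp add: carrier_free_module_on)
    qed
    then show "f = f'" by (rule ext)
  qed
  from free_resolution_transport[OF M G this]
  obtain F :: "nat \<Rightarrow> ('a, ('a + 'm) list) module" and d' e' where F: "free_resolution R M F d' e'"
    by (elim exE) (rule that)
  have gc: "g i \<in> {..<r (Suc i)} \<rightarrow> carrier (?G i)" for i using g[of i] by blast
  have dI: "?d i f \<in> ideal_smult R I (?G i)" if f: "f \<in> carrier (?G (Suc i))" for i f
  proof -
    note sub = ideal_smult_submodule[OF std_free_module I_subset]
    have "carrier (?G (Suc i)) \<subseteq> {f \<in> carrier (?G (Suc i)). ?d i f \<in> ideal_smult R I (?G i)}"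
    proof (rule free_module_on_generated[OF cring
          submodule_preimage[OF std_free_module std_free_module lin_ext_hom[OF std_free_module gc] sub]])
      fix s assume s: "s \<in> {..<r (Suc i)}"
      show "free_gen R s \<in> {f \<in> carrier (?G (Suc i)). ?d i f \<in> ideal_smult R I (?G i)}"
      proof -
        have "g i s \<in> {f \<in> carrier (?G i). \<forall>s. f s \<in> I}" by (rule funcset_mem[OF g s])
        then have "g i s \<in> ideal_smult R I (?G i)" unfolding ideal_smult_std_free .
        then show ?thesis
          using free_gen_closed[OF cring s] lin_ext_gen[OF std_free_module gc s] by simp
      qed
    qed
    from subsetD[OF this f] show ?thesis by simp
  qed
  have cyc: "tor_cycles R I ?G ?d j = carrier (?G (Suc j))"
  proof
    show "tor_cycles R I ?G ?d j \<subseteq> carrier (?G (Suc j))" by (rule subsetI) (simp add: tor_cycles_def)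
    show "carrier (?G (Suc j)) \<subseteq> tor_cycles R I ?G ?d j"
      by (rule subsetI) (simp only: tor_cycles_def mem_Collect_eq dI conj_assoc simp_thms)
  qed
  let ?Y = "free_gen R ` {..<r (Suc j)} :: (nat \<Rightarrow> 'a) set"
  have inj: "inj_on (free_gen R) {..<r (Suc j)}"
  proof (rule inj_onI)
    fix s t assume "free_gen R s = free_gen R t"
    then have "free_gen R s s = free_gen R t s" by (rule fun_cong)
    then show "s = t" using one_neq_zero by (simp add: free_gen_def split: if_splits)
  qed
  have Y: "tor_generated_by R I ?G ?d j ?Y"
    unfolding tor_generated_by_def cyc
  proof (intro conjI allI impI)
    show "?Y \<subseteq> carrier (?G (Suc j))" by (rule image_subsetI) (rule free_gen_closed[OF cring])
    show "carrier (?G (Suc j)) \<subseteq> P" if "submodule R P (?G (Suc j))" "?Y \<subseteq> P" for P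
      by (rule free_module_on_generated[OF cring that(1)]) (rule subsetD[OF that(2) imageI])
  qed
  have "card ?Y \<le> card Y'" if Y': "tor_generated_by R I ?G ?d j Y'" "finite Y'" for Y'
  proof -
    interpret vs: vector_space "\<lambda>(c::'k) (f::nat \<Rightarrow> 'k) i. c * f i" by (rule vector_space_functions)
    define \<eta> where "\<eta> f = (\<lambda>s. res (f s))" for f :: "nat \<Rightarrow> 'a"
    let ?S = "vs.span (\<eta> ` Y')"
    let ?P = "{f \<in> carrier (?G (Suc j)). \<eta> f \<in> ?S}"
    note fc = free_module_on_coeff[OF cring]
    interpret L: module R "?G (Suc j)" by (rule std_free_module)
    have "submodule R ?P (?G (Suc j))"
    proof (rule submodule.intro[OF std_free_module])
      have "\<eta> \<zero>\<^bsub>?G (Suc j)\<^esub> = 0" by (simp add: \<eta>_def res_zero zero_fun_def)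
      then show "\<zero>\<^bsub>?G (Suc j)\<^esub> \<in> ?P" using L.M.zero_closed vs.span_zero by simp
      show "v \<oplus>\<^bsub>?G (Suc j)\<^esub> w \<in> ?P" if vw: "v \<in> ?P" "w \<in> ?P" for v w
      proof -
        have vw': "v \<in> carrier (?G (Suc j))" "w \<in> carrier (?G (Suc j))" using vw by simp_all
        note c = fc[OF vw'(1)] fc[OF vw'(2)]
        have "\<eta> (v \<oplus>\<^bsub>?G (Suc j)\<^esub> w) = \<eta> v + \<eta> w"
          by (simp add: fun_eq_iff \<eta>_def res_add c)
        then show ?thesis using vw L.M.a_closed[of v w] vs.span_add by auto
      qed
      show "c \<odot>\<^bsub>?G (Suc j)\<^esub> v \<in> ?P" if c: "c \<in> carrier R" and v: "v \<in> ?P" for c v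
      proof -
        have v': "v \<in> carrier (?G (Suc j))" using v by simp
        note vc = fc[OF v']
        have "\<eta> (c \<odot>\<^bsub>?G (Suc j)\<^esub> v) = (\<lambda>i. res c * \<eta> v i)"
          by (simp add: fun_eq_iff \<eta>_def res_mult c vc)
        then show ?thesis using v L.smult_closed[OF c, of v] vs.span_scale[of "\<eta> v" _ "res c"] by auto
      qed
    qed auto
    moreover have "Y' \<subseteq> ?P"
    proof
      fix y assume y: "y \<in> Y'"
      have "y \<in> carrier (?G (Suc j))" using Y'(1) y unfolding tor_generated_by_def cyc by (elim conjE) (rule subsetD)
      then show "y \<in> ?P" using vs.span_base[OF imageI[OF y]] by simp
    qed
    moreover have IP: "ideal_smult R I (?G (Suc j)) \<subseteq> ?P"
    proof
      fix f assume f: "f \<in> ideal_smult R I (?G (Suc j))"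
      then have fI: "f \<in> carrier (?G (Suc j))" "f s \<in> I" for s unfolding ideal_smult_std_free by simp_all
      have "\<eta> f = 0" using in_I_iff[OF fc[OF fI(1)]] fI(2) by (simp add: fun_eq_iff \<eta>_def)
      then show "f \<in> ?P" using f vs.span_zero by (simp add: ideal_smult_std_free)
    qed
    moreover have "?d (Suc j) ` carrier (?G (Suc (Suc j))) \<subseteq> ?P"
      by (rule image_subsetI) (rule subsetD[OF IP dI])
    ultimately have P: "carrier (?G (Suc j)) \<subseteq> ?P"
      using Y'(1) unfolding tor_generated_by_def cyc by (elim conjE allE[of _ ?P]) simp
    define E where "E = (\<lambda>s t. if t = s then 1 else 0 :: 'k) ` {..<r (Suc j)}"
    have \<eta>gen: "\<eta> (free_gen R s) = (\<lambda>t. if t = s then 1 else 0)" for s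
      by (auto simp: \<eta>_def free_gen_def res_one res_zero)
    have injE: "inj_on (\<lambda>s t. if t = s then 1 else 0 :: 'k) {..<r (Suc j)}"
    proof (rule inj_onI)
      fix s s' assume "(\<lambda>t. if t = s then 1 else 0 :: 'k) = (\<lambda>t. if t = s' then 1 else 0)"
      from fun_cong[OF this, of s] show "s = s'" by (simp split: if_splits)
    qed
    have "E \<subseteq> ?S"
    proof
      fix v assume "v \<in> E"
      then obtain s where s: "s \<in> {..<r (Suc j)}" "v = (\<lambda>t. if t = s then 1 else 0)" by (auto simp: E_def)
      then show "v \<in> ?S" using subsetD[OF P free_gen_closed[OF cring s(1)]] \<eta>gen by auto
    qed
    moreover have "\<not> vs.dependent E"
    proof -
      have "\<forall>v\<in>E. u v = 0" if "(\<Sum>v\<in>E. (\<lambda>i. u v * v i)) = 0" for u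
      proof
        fix v assume "v \<in> E"
        then obtain s where s: "s \<in> {..<r (Suc j)}" "v = (\<lambda>t. if t = s then 1 else 0)" by (auto simp: E_def)
        have "(\<Sum>v\<in>E. (\<lambda>i. u v * v i)) s = (\<Sum>v\<in>E. u v * v s)"
          by (simp add: sum_fun_apply)
        also have "\<dots> = (\<Sum>t<r (Suc j). u (\<lambda>i. if i = t then 1 else 0) * (if s = t then 1 else 0))"
          unfolding E_def by (subst sum.reindex[OF injE]) simp
        also have "\<dots> = u v" using s by (simp add: if_distrib cong: if_cong)
        finally show "u v = 0" using that by simp
      qed
      moreover have "finite E" by (simp add: E_def)
      ultimately show ?thesis by (subst vs.dependent_finite) auto
    qed
    ultimately have "card E \<le> card (\<eta> ` Y')"
      using vs.independent_span_bound[of "\<eta> ` Y'" E] Y'(2) by simp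
    also have "\<dots> \<le> card Y'" by (rule card_image_le[OF Y'(2)])
    finally have "card E \<le> card Y'" .
    moreover have "card E = card ?Y" unfolding E_def card_image[OF injE] card_image[OF inj] ..
    ultimately show ?thesis by simp
  qed
  from betti_eqI[OF M F G Y _ this] show ?thesis by (simp add: card_image[OF inj])
qed

end

section \<open>The truncated polynomial ring\<close>

definition mdeg :: "nat \<Rightarrow> (nat \<Rightarrow>\<^sub>0 nat) \<Rightarrow> nat"
  where "mdeg d m = (\<Sum>i<d. Poly_Mapping.lookup m i)"

text \<open>
  The power \<open>\<nn>\<^sup>j\<close>, described by monomials; \<open>j = 0\<close> gives the polynomial ring itself.
\<close>

definition deg_ideal :: "nat \<Rightarrow> nat \<Rightarrow> 'k::field mpoly set"
  where "deg_ideal d j = {p. \<forall>m. Poly_Mapping.lookup p m \<noteq> 0 \<longrightarrow>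
    Poly_Mapping.keys m \<subseteq> {..<d} \<and> j \<le> mdeg d m}"

lemma mdeg_add: "mdeg d (m + m') = mdeg d m + mdeg d m'"
  by (simp add: mdeg_def lookup_add sum.distrib)

lemma mdeg_single: "i < d \<Longrightarrow> mdeg d (Poly_Mapping.single i j) = j"
  by (simp add: mdeg_def lookup_single when_def)

lemma mdeg_zero: "mdeg d 0 = 0"
  by (simp add: mdeg_def)

lemma keys_add_subset:
  "Poly_Mapping.keys m \<subseteq> S \<Longrightarrow> Poly_Mapping.keys m' \<subseteq> S \<Longrightarrow> Poly_Mapping.keys (m + m') \<subseteq> S"
  using keys_add[of m m'] by blast

lemma deg_ideal_zero: "0 \<in> deg_ideal d j"
  by (simp add: deg_ideal_def)

lemma deg_ideal_add: "p \<in> deg_ideal d j \<Longrightarrow> q \<in> deg_ideal d j \<Longrightarrow> p + q \<in> deg_ideal d j"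
proof -
  assume p: "p \<in> deg_ideal d j" and q: "q \<in> deg_ideal d j"
  show ?thesis
    unfolding deg_ideal_def
  proof (intro CollectI allI impI)
    fix m assume "Poly_Mapping.lookup (p + q) m \<noteq> 0"
    then have "Poly_Mapping.lookup p m \<noteq> 0 \<or> Poly_Mapping.lookup q m \<noteq> 0" by (auto simp: lookup_add)
    then show "Poly_Mapping.keys m \<subseteq> {..<d} \<and> j \<le> mdeg d m"
    proof
      assume "Poly_Mapping.lookup p m \<noteq> 0"
      then show ?thesis using p by (simp add: deg_ideal_def)
    next
      assume "Poly_Mapping.lookup q m \<noteq> 0"
      then show ?thesis using q by (simp add: deg_ideal_def)
    qed
  qed
qed

lemma deg_ideal_uminus: "p \<in> deg_ideal d j \<Longrightarrow> - p \<in> deg_ideal d j"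
  by (simp add: deg_ideal_def)

lemma deg_ideal_minus: "p \<in> deg_ideal d j \<Longrightarrow> q \<in> deg_ideal d j \<Longrightarrow> p - q \<in> deg_ideal d j"
  using deg_ideal_add[OF _ deg_ideal_uminus, of p d j q] by simp

lemma deg_ideal_sum: "(\<And>x. x \<in> A \<Longrightarrow> f x \<in> deg_ideal d j) \<Longrightarrow> (\<Sum>x\<in>A. f x) \<in> deg_ideal d j"
  by (induct A rule: infinite_finite_induct) (simp_all add: deg_ideal_zero deg_ideal_add)

lemma deg_ideal_mono: "p \<in> deg_ideal d j \<Longrightarrow> l \<le> j \<Longrightarrow> p \<in> deg_ideal d l"
  by (auto simp: deg_ideal_def)

lemma deg_ideal_single:
  "Poly_Mapping.keys m \<subseteq> {..<d} \<Longrightarrow> j \<le> mdeg d m \<Longrightarrow> Poly_Mapping.single m c \<in> deg_ideal d j"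
  by (simp add: deg_ideal_def lookup_single when_def)

lemma deg_ideal_lookup:
  "p \<in> deg_ideal d j \<Longrightarrow> mdeg d m < j \<Longrightarrow> Poly_Mapping.lookup p m = 0"
  by (auto simp: deg_ideal_def)

lemma mpoly_expand:
  fixes p :: "'k::field mpoly"
  shows "p = (\<Sum>m\<in>Poly_Mapping.keys p. Poly_Mapping.single m (Poly_Mapping.lookup p m))"
proof (rule poly_mapping_eqI)
  fix m
  show "Poly_Mapping.lookup p m =
      Poly_Mapping.lookup (\<Sum>m\<in>Poly_Mapping.keys p. Poly_Mapping.single m (Poly_Mapping.lookup p m)) m"
    by (simp add: lookup_sum lookup_single when_def in_keys_iff)
qed

lemma single_times_expand:
  fixes p :: "'k::field mpoly"
  shows "Poly_Mapping.single a c * p =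
    (\<Sum>m\<in>Poly_Mapping.keys p. Poly_Mapping.single (a + m) (c * Poly_Mapping.lookup p m))"
proof -
  have "Poly_Mapping.single a c * p = Poly_Mapping.single a c *
      (\<Sum>m\<in>Poly_Mapping.keys p. Poly_Mapping.single m (Poly_Mapping.lookup p m))"
    using mpoly_expand[of p] by (rule arg_cong)
  also have "\<dots> = (\<Sum>m\<in>Poly_Mapping.keys p. Poly_Mapping.single (a + m) (c * Poly_Mapping.lookup p m))"
    by (simp only: sum_distrib_left mult_single)
  finally show ?thesis .
qed

lemma lookup_single_times:
  fixes p :: "'k::field mpoly"
  shows "Poly_Mapping.lookup (Poly_Mapping.single a c * p) (a + m) = c * Poly_Mapping.lookup p m"
  by (simp add: single_times_expand lookup_sum lookup_single when_def in_keys_iff)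

lemma lookup_single_times_eq_zero:
  fixes p :: "'k::field mpoly"
  assumes "\<And>m'. m \<noteq> a + m'"
  shows "Poly_Mapping.lookup (Poly_Mapping.single a c * p) m = 0"
  using assms[symmetric] by (simp add: single_times_expand lookup_sum lookup_single when_def)

lemma lookup_const_times:
  fixes p :: "'k::field mpoly"
  shows "Poly_Mapping.lookup (Poly_Mapping.single 0 c * p) m = c * Poly_Mapping.lookup p m"
  using lookup_single_times[of 0 c p m] by simp

lemma deg_ideal_mult:
  assumes p: "p \<in> deg_ideal d j" and q: "q \<in> deg_ideal d l"
  shows "p * q \<in> deg_ideal d (j + l)"
proof -
  have key: "Poly_Mapping.keys m \<subseteq> {..<d} \<and> j \<le> mdeg d m" if "m \<in> Poly_Mapping.keys p" for m
    using p that unfolding deg_ideal_def in_keys_iff by blast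
  have key': "Poly_Mapping.keys m \<subseteq> {..<d} \<and> l \<le> mdeg d m" if "m \<in> Poly_Mapping.keys q" for m
    using q that unfolding deg_ideal_def in_keys_iff by blast
  have "p * q = (\<Sum>m\<in>Poly_Mapping.keys p. Poly_Mapping.single m (Poly_Mapping.lookup p m)) * q"
    using mpoly_expand[of p] by (rule arg_cong)
  also have "\<dots> = (\<Sum>m\<in>Poly_Mapping.keys p. Poly_Mapping.single m (Poly_Mapping.lookup p m) * q)"
    by (rule sum_distrib_right)
  also have "\<dots> \<in> deg_ideal d (j + l)"
    unfolding single_times_expand
    by (intro deg_ideal_sum deg_ideal_single keys_add_subset)
      (simp_all add: key key' mdeg_add add_mono)
  finally show ?thesis .
qed

lemma deg_ideal_mult_left: "p \<in> deg_ideal d 0 \<Longrightarrow> q \<in> deg_ideal d l \<Longrightarrow> p * q \<in> deg_ideal d l"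
  using deg_ideal_mult[of p d 0 q l] by simp

lemma deg_ideal_mult_right: "p \<in> deg_ideal d l \<Longrightarrow> q \<in> deg_ideal d 0 \<Longrightarrow> p * q \<in> deg_ideal d l"
  using deg_ideal_mult[of p d l q 0] by simp

lemma deg_ideal_const: "Poly_Mapping.single 0 c \<in> deg_ideal d 0"
  by (rule deg_ideal_single) simp_all

lemma deg_ideal_one: "1 \<in> deg_ideal d 0"
  using deg_ideal_const[of 1 d] by simp

lemma mpoly_var_deg_ideal: "i < d \<Longrightarrow> mpoly_var i \<in> deg_ideal d 1"
  unfolding mpoly_var_def by (rule deg_ideal_single) (simp_all add: mdeg_single)

lemma monomial_split:
  assumes "Poly_Mapping.lookup m i > 0" "Poly_Mapping.keys m \<subseteq> {..<d}" "i < d"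
  obtains m' where "m = Poly_Mapping.single i 1 + m'" "Poly_Mapping.keys m' \<subseteq> {..<d}"
    "mdeg d m = Suc (mdeg d m')"
proof -
  define m' where "m' = m - Poly_Mapping.single i 1"
  have m: "m = Poly_Mapping.single i 1 + m'"
    by (rule poly_mapping_eqI) (use assms(1) in \<open>auto simp: m'_def lookup_add lookup_minus lookup_single when_def\<close>)
  have "Poly_Mapping.keys m' \<subseteq> Poly_Mapping.keys m"
    by (rule subsetI) (auto simp: in_keys_iff m'_def lookup_minus)
  moreover have "mdeg d m = mdeg d (Poly_Mapping.single i 1) + mdeg d m'"
    by (subst m) (rule mdeg_add)
  ultimately show thesis using that[OF m] assms(2,3) by (simp add: mdeg_single)
qed

lemma mdeg_pos_imp: "0 < mdeg d m \<Longrightarrow> \<exists>i<d. 0 < Poly_Mapping.lookup m i"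
  unfolding mdeg_def by (metis lessThan_iff not_gr0 sum.neutral)

text \<open>
  Every monomial of positive degree is divisible by one of the variables. This is what identifies
  \<^const>\<open>deg_ideal\<close> with the ideal powers and, later, puts vectors of high degree into \<open>\<nn> K\<close>.
\<close>

lemma deg_ideal_Suc_decompose:
  assumes "p \<in> deg_ideal d (Suc j)"
  shows "\<exists>q. (\<forall>i. q i \<in> deg_ideal d j) \<and> p = (\<Sum>i<d. mpoly_var i * q i)"
proof -
  define P where "P p \<longleftrightarrow> (\<exists>q. (\<forall>i. q i \<in> deg_ideal d j) \<and> p = (\<Sum>i<d. mpoly_var i * q i))"
    for p :: "'a mpoly"
  have P0: "P 0" unfolding P_def by (intro exI[of _ "\<lambda>_. 0"]) (simp add: deg_ideal_zero)
  have Padd: "P (a + b)" if ab: "P a" "P b" for a b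
  proof -
    obtain q q' where "\<forall>i. q i \<in> deg_ideal d j" "a = (\<Sum>i<d. mpoly_var i * q i)"
      "\<forall>i. q' i \<in> deg_ideal d j" "b = (\<Sum>i<d. mpoly_var i * q' i)"
      using ab unfolding P_def by blast
    then show ?thesis unfolding P_def
      by (intro exI[of _ "\<lambda>i. q i + q' i"]) (simp add: deg_ideal_add sum.distrib distrib_left)
  qed
  have Psingle: "P (Poly_Mapping.single m c)" if m: "Poly_Mapping.keys m \<subseteq> {..<d}" "Suc j \<le> mdeg d m" for m c
  proof -
    have "0 < mdeg d m" using m(2) by simp
    then obtain i where i: "i < d" "0 < Poly_Mapping.lookup m i" using mdeg_pos_imp by blast
    obtain m' where m': "m = Poly_Mapping.single i 1 + m'" "Poly_Mapping.keys m' \<subseteq> {..<d}"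
      "mdeg d m = Suc (mdeg d m')" using monomial_split[OF i(2) m(1) i(1)] .
    define q where "q l = (if l = i then Poly_Mapping.single m' c else 0)" for l
    have "q l \<in> deg_ideal d j" for l
      using m(2) m' by (simp add: q_def deg_ideal_zero deg_ideal_single)
    moreover have "(\<Sum>l<d. mpoly_var l * q l) = mpoly_var i * Poly_Mapping.single m' c"
      using i(1) by (simp add: q_def if_distrib cong: if_cong)
    moreover have "mpoly_var i * Poly_Mapping.single m' c = Poly_Mapping.single m c"
      by (simp add: mpoly_var_def mult_single m'(1))
    ultimately show ?thesis unfolding P_def by (intro exI[of _ q]) simp
  qed
  have "P (\<Sum>m\<in>A. Poly_Mapping.single m (Poly_Mapping.lookup p m))" if "A \<subseteq> Poly_Mapping.keys p" for A
    using that
  proof (induct A rule: infinite_finite_induct)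
    case (insert m A)
    have "m \<in> Poly_Mapping.keys p" using insert by simp
    then have "Poly_Mapping.keys m \<subseteq> {..<d}" "Suc j \<le> mdeg d m"
      using assms unfolding deg_ideal_def in_keys_iff by blast+
    then show ?case using insert Padd Psingle by simp
  qed (simp_all add: P0)
  from this[OF order_refl] show ?thesis unfolding mpoly_expand[symmetric] P_def .
qed

lemma mpoly_ring_simps [simp]:
  "carrier (mpoly_ring d) = deg_ideal d 0"
  "x \<otimes>\<^bsub>mpoly_ring d\<^esub> y = x * y" "x \<oplus>\<^bsub>mpoly_ring d\<^esub> y = x + y"
  "\<zero>\<^bsub>mpoly_ring d\<^esub> = 0" "\<one>\<^bsub>mpoly_ring d\<^esub> = 1"
  by (auto simp: mpoly_ring_def ring_of_type_algebra_def deg_ideal_def in_keys_iff)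

lemma mpoly_ring_cring: "cring (mpoly_ring d :: 'k::field mpoly ring)" (is "cring ?Q")
proof (rule cringI)
  show "abelian_group ?Q"
  proof (rule abelian_groupI)
    show "\<exists>y\<in>carrier ?Q. y \<oplus>\<^bsub>?Q\<^esub> x = \<zero>\<^bsub>?Q\<^esub>"
      if "x \<in> carrier ?Q" for x :: "'k mpoly"
      using that by (intro bexI[of _ "- x"]) (simp_all add: deg_ideal_uminus)
  qed (simp_all add: deg_ideal_add deg_ideal_zero add.assoc add.commute)
  show "comm_monoid ?Q"
    by (rule comm_monoidI) (simp_all add: deg_ideal_mult_left deg_ideal_one mult.assoc mult.commute)
qed (simp add: distrib_right)

lemma deg_ideal_ideal: "ideal (deg_ideal d j) (mpoly_ring d :: 'k::field mpoly ring)" (is "ideal ?J ?Q")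
proof (rule idealI)
  show "ring ?Q" using mpoly_ring_cring by (rule cring.axioms(1))
  interpret cring ?Q by (rule mpoly_ring_cring)
  show "subgroup (deg_ideal d j) (add_monoid ?Q)"
  proof (rule add.subgroupI)
    show "deg_ideal d j \<subseteq> carrier ?Q" by (rule subsetI) (simp add: deg_ideal_mono)
    show "deg_ideal d j \<noteq> {}" using deg_ideal_zero by blast
    show "\<ominus>\<^bsub>?Q\<^esub> p \<in> deg_ideal d j" if p: "p \<in> deg_ideal d j" for p
    proof -
      have "\<ominus>\<^bsub>?Q\<^esub> p = - p"
        by (rule minus_equality) (use p deg_ideal_mono[OF p] in \<open>simp_all add: deg_ideal_uminus\<close>)
      then show ?thesis using p by (simp add: deg_ideal_uminus)
    qed
  qed (simp add: deg_ideal_add)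
qed (simp_all add: deg_ideal_mult_left deg_ideal_mult_right)

lemma vars_ideal_eq: "vars_ideal d = (deg_ideal d 1 :: 'k::field mpoly set)"
proof
  let ?Q = "mpoly_ring d :: 'k mpoly ring" and ?V = "vars_ideal d :: 'k mpoly set"
  interpret cring ?Q by (rule mpoly_ring_cring)
  have sub: "mpoly_var ` {..<d} \<subseteq> carrier ?Q"
    by (rule image_subsetI) (simp add: deg_ideal_mono[OF mpoly_var_deg_ideal])
  show "?V \<subseteq> deg_ideal d 1"
    unfolding vars_ideal_def
    by (rule genideal_minimal[OF deg_ideal_ideal]) (rule image_subsetI, rule mpoly_var_deg_ideal, simp)
  interpret V: ideal ?V ?Q unfolding vars_ideal_def by (rule genideal_ideal[OF sub])
  show "deg_ideal d 1 \<subseteq> ?V"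
  proof
    fix p :: "'k mpoly" assume "p \<in> deg_ideal d 1"
    then obtain q where q: "\<forall>i. q i \<in> deg_ideal d 0" "p = (\<Sum>i<d. mpoly_var i * q i)"
      using deg_ideal_Suc_decompose[of p d 0] by auto
    have "(\<Sum>i\<in>A. mpoly_var i * q i) \<in> ?V" if "A \<subseteq> {..<d}" for A
      using that
    proof (induct A rule: infinite_finite_induct)
      case (insert i A)
      have "mpoly_var i \<in> ?V"
        unfolding vars_ideal_def using insert.prems by (intro subsetD[OF genideal_self[OF sub]] imageI) simp
      then have 1: "mpoly_var i * q i \<in> ?V" using V.I_r_closed[of "mpoly_var i" "q i"] q(1) by simp
      have "(\<Sum>i\<in>A. mpoly_var i * q i) \<in> ?V" using insert by simp
      from V.a_closed[OF 1 this] show ?case using insert.hyps by simp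
    qed (use V.zero_closed in simp_all)
    then show "p \<in> ?V" using q(2) by simp
  qed
qed

lemma deg_ideal_Suc:
  "(deg_ideal d (Suc j) :: 'k::field mpoly set) = ideal_prod (mpoly_ring d) (deg_ideal d j) (deg_ideal d 1)"
proof
  let ?Q = "mpoly_ring d :: 'k mpoly ring"
  show "deg_ideal d (Suc j) \<subseteq> ideal_prod ?Q (deg_ideal d j) (deg_ideal d 1)"
  proof
    fix p :: "'k mpoly" assume "p \<in> deg_ideal d (Suc j)"
    then obtain q where q: "\<forall>i. q i \<in> deg_ideal d j" "p = (\<Sum>i<d. mpoly_var i * q i)"
      using deg_ideal_Suc_decompose by blast
    have "(\<Sum>i\<in>A. mpoly_var i * q i) \<in> ideal_prod ?Q (deg_ideal d j) (deg_ideal d 1)"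
      if "finite A" "A \<subseteq> {..<d}" for A
      using that
    proof (induct A rule: finite_induct)
      case empty
      show ?case using ideal_prod.prod[of 0 "deg_ideal d j" 0 "deg_ideal d 1" ?Q]
        by (simp add: deg_ideal_zero)
    next
      case (insert i A)
      have "q i \<otimes>\<^bsub>?Q\<^esub> mpoly_var i \<in> ideal_prod ?Q (deg_ideal d j) (deg_ideal d 1)"
        using q(1) insert.prems by (intro ideal_prod.prod mpoly_var_deg_ideal) simp_all
      then show ?case
        using insert ideal_prod.sum[of "mpoly_var i * q i" ?Q "deg_ideal d j" "deg_ideal d 1"]
        by (simp add: mult.commute)
    qed
    then show "p \<in> ideal_prod ?Q (deg_ideal d j) (deg_ideal d 1)" using q(2) by simp
  qed
  show "ideal_prod ?Q (deg_ideal d j) (deg_ideal d 1) \<subseteq> deg_ideal d (Suc j)"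
  proof
    fix p :: "'k mpoly" assume "p \<in> ideal_prod ?Q (deg_ideal d j) (deg_ideal d 1)"
    then show "p \<in> deg_ideal d (Suc j)"
    proof (induct rule: ideal_prod.induct)
      case (prod a b)
      then show ?case using deg_ideal_mult[of a d j b 1] by simp
    qed (simp add: deg_ideal_add)
  qed
qed

lemma vars_ideal_power:
  "vars_ideal d [^]\<^bsub>ideals_set (mpoly_ring d)\<^esub> n = (deg_ideal d n :: 'k::field mpoly set)"
proof (induct n)
  case 0
  show ?case by (simp add: nat_pow_def ideals_set_def)
next
  case (Suc n)
  have "vars_ideal d [^]\<^bsub>ideals_set (mpoly_ring d)\<^esub> Suc n
      = ideal_prod (mpoly_ring d) (vars_ideal d [^]\<^bsub>ideals_set (mpoly_ring d)\<^esub> n) (vars_ideal d :: 'k mpoly set)"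
    by (simp add: nat_pow_def ideals_set_def)
  also have "\<dots> = deg_ideal d (Suc n)" unfolding Suc unfolding vars_ideal_eq by (rule deg_ideal_Suc[symmetric])
  finally show ?case .
qed

locale truncated =
  fixes d n :: nat and R :: "'k::field mpoly set ring"
  assumes n_pos: "0 < n" and R_def: "R = truncated_mpoly_ring d n"
begin

abbreviation J :: "nat \<Rightarrow> 'k mpoly set" where "J \<equiv> deg_ideal d"

definition proj :: "'k mpoly \<Rightarrow> 'k mpoly set" where "proj p = J n +>\<^bsub>mpoly_ring d\<^esub> p"
definition lft :: "'k mpoly set \<Rightarrow> 'k mpoly" where "lft c = (SOME p. p \<in> J 0 \<and> proj p = c)"
definition coef :: "'k mpoly set \<Rightarrow> (nat \<Rightarrow>\<^sub>0 nat) \<Rightarrow> 'k" where "coef c m = Poly_Mapping.lookup (lft c) m"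
definition max_J :: "'k mpoly set set" where "max_J = proj ` J 1"

lemma R_eq: "R = mpoly_ring d Quot J n"
  by (simp add: R_def truncated_mpoly_ring_def vars_ideal_power)

lemma R_cring: "cring R"
  unfolding R_eq by (rule ideal.quotient_is_cring[OF deg_ideal_ideal mpoly_ring_cring])

lemma carrier_R: "carrier R = proj ` J 0"
  by (auto simp: R_eq FactRing_def A_RCOSETS_def' proj_def)

lemma proj_closed: "p \<in> J 0 \<Longrightarrow> proj p \<in> carrier R"
  unfolding carrier_R by (rule imageI)

lemma proj_eq_iff:
  assumes "p \<in> J 0" "q \<in> J 0" shows "proj p = proj q \<longleftrightarrow> p - q \<in> J n"
proof -
  interpret Q: cring "mpoly_ring d :: 'k mpoly ring" by (rule mpoly_ring_cring)
  interpret A: abelian_subgroup "J n" "mpoly_ring d"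
    by (rule abelian_subgroupI3[OF ideal.axioms(1)[OF deg_ideal_ideal] Q.abelian_group_axioms])
  have mem: "p \<in> J n +>\<^bsub>mpoly_ring d\<^esub> q \<longleftrightarrow> p - q \<in> J n"
  proof
    assume "p \<in> J n +>\<^bsub>mpoly_ring d\<^esub> q"
    then obtain h where "h \<in> J n" "p = h + q" by (auto simp: a_r_coset_def')
    then show "p - q \<in> J n" by simp
  next
    assume h: "p - q \<in> J n"
    show "p \<in> J n +>\<^bsub>mpoly_ring d\<^esub> q"
      unfolding a_r_coset_def' by (rule UN_I[OF h]) simp
  qed
  show ?thesis
  proof
    assume "proj p = proj q"
    then show "p - q \<in> J n" using A.a_rcos_self[of p] assms(1) mem by (simp add: proj_def)
  next
    assume "p - q \<in> J n"
    then have "p \<in> J n +>\<^bsub>mpoly_ring d\<^esub> q" using mem by simp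
    from A.a_repr_independence'[OF this] assms(2) show "proj p = proj q" by (simp add: proj_def)
  qed
qed

lemma proj_hom:
  assumes "p \<in> J 0" "q \<in> J 0"
  shows "proj (p + q) = proj p \<oplus>\<^bsub>R\<^esub> proj q" and "proj (p * q) = proj p \<otimes>\<^bsub>R\<^esub> proj q"
proof -
  have "proj \<in> ring_hom (mpoly_ring d) R"
    using ideal.rcos_ring_hom[OF deg_ideal_ideal[of d n]] by (simp add: R_eq proj_def[abs_def])
  then show "proj (p + q) = proj p \<oplus>\<^bsub>R\<^esub> proj q" "proj (p * q) = proj p \<otimes>\<^bsub>R\<^esub> proj q"
    using assms by (simp_all add: ring_hom_def)
qed

lemma proj_one: "proj 1 = \<one>\<^bsub>R\<^esub>" and proj_zero: "proj 0 = \<zero>\<^bsub>R\<^esub>"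
proof -
  show "proj 1 = \<one>\<^bsub>R\<^esub>" by (simp add: R_eq proj_def FactRing_def)
  interpret cring R by (rule R_cring)
  have "proj 0 \<oplus>\<^bsub>R\<^esub> proj 0 = proj 0" using proj_hom(1)[OF deg_ideal_zero deg_ideal_zero] by simp
  then show "proj 0 = \<zero>\<^bsub>R\<^esub>" using proj_closed[OF deg_ideal_zero] by simp
qed

lemma proj_eq_zero: "p \<in> J 0 \<Longrightarrow> proj p = \<zero>\<^bsub>R\<^esub> \<longleftrightarrow> p \<in> J n"
  using proj_eq_iff[OF _ deg_ideal_zero] by (simp add: proj_zero)

lemma proj_sum:
  assumes "finite A" "\<And>x. x \<in> A \<Longrightarrow> f x \<in> J 0"
  shows "proj (\<Sum>x\<in>A. f x) = (\<Oplus>\<^bsub>R\<^esub>x\<in>A. proj (f x))"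
proof -
  interpret cring R by (rule R_cring)
  show ?thesis using assms
  proof (induct A rule: finite_induct)
    case (insert x A)
    have "(\<Oplus>\<^bsub>R\<^esub>x\<in>insert x A. proj (f x)) = proj (f x) \<oplus>\<^bsub>R\<^esub> (\<Oplus>\<^bsub>R\<^esub>x\<in>A. proj (f x))"
      by (rule finsum_insert) (use insert proj_closed in auto)
    moreover have "(\<Sum>x\<in>A. f x) \<in> J 0" by (rule deg_ideal_sum) (use insert in simp)
    ultimately show ?case using insert by (simp add: proj_hom(1))
  qed (simp add: proj_zero)
qed

lemma lft:
  assumes "c \<in> carrier R" shows "lft c \<in> J 0" and "proj (lft c) = c"
proof -
  have "\<exists>p. p \<in> J 0 \<and> proj p = c" using assms unfolding carrier_R by auto
  from someI_ex[OF this] show "lft c \<in> J 0" "proj (lft c) = c" unfolding lft_def by simp_all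
qed

lemma coef_proj: "p \<in> J 0 \<Longrightarrow> mdeg d m < n \<Longrightarrow> coef (proj p) m = Poly_Mapping.lookup p m"
proof -
  assume p: "p \<in> J 0" and m: "mdeg d m < n"
  have "lft (proj p) - p \<in> J n"
    using lft[OF proj_closed[OF p]] proj_eq_iff[OF _ p] by simp
  from deg_ideal_lookup[OF this m] show ?thesis by (simp add: coef_def lookup_minus)
qed

lemma lookup_zero_iff: "p \<in> J 0 \<Longrightarrow> Poly_Mapping.lookup p 0 = 0 \<longleftrightarrow> p \<in> J 1"
proof
  assume p: "p \<in> J 0"
  show "Poly_Mapping.lookup p 0 = 0" if "p \<in> J 1"
    by (rule deg_ideal_lookup[OF that]) (simp add: mdeg_zero)
  assume 0: "Poly_Mapping.lookup p 0 = 0"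
  show "p \<in> J 1"
    unfolding deg_ideal_def
  proof (intro CollectI allI impI conjI)
    fix m assume m: "Poly_Mapping.lookup p m \<noteq> 0"
    show k: "Poly_Mapping.keys m \<subseteq> {..<d}" using p m unfolding deg_ideal_def by blast
    have "m \<noteq> 0" using m 0 by auto
    then obtain i where i: "Poly_Mapping.lookup m i \<noteq> 0" using poly_mapping_eqI[of m 0] by auto
    then have "i \<in> Poly_Mapping.keys m" by (simp add: in_keys_iff)
    then have "i < d" using k by auto
    then have "Poly_Mapping.lookup m i \<le> mdeg d m" unfolding mdeg_def by (intro member_le_sum) simp_all
    then show "1 \<le> mdeg d m" using i by simp
  qed
qed

definition res :: "'k mpoly set \<Rightarrow> 'k" where "res c = coef c 0"

lemma res_proj: "p \<in> J 0 \<Longrightarrow> res (proj p) = Poly_Mapping.lookup p 0"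
  unfolding res_def using n_pos by (simp add: coef_proj mdeg_zero)

lemma const_decompose:
  assumes "p \<in> J 0"
  shows "p - Poly_Mapping.single 0 (Poly_Mapping.lookup p 0) \<in> J 1"
  by (rule iffD1[OF lookup_zero_iff[OF deg_ideal_minus[OF assms deg_ideal_const]]])
    (simp add: lookup_minus)

lemma lookup_mult_zero:
  assumes "p \<in> J 0" "q \<in> J 0"
  shows "Poly_Mapping.lookup (p * q) 0 = Poly_Mapping.lookup p 0 * Poly_Mapping.lookup q 0"
proof -
  have "(p - Poly_Mapping.single 0 (Poly_Mapping.lookup p 0)) * q \<in> J (1 + 0)"
    by (rule deg_ideal_mult[OF const_decompose[OF assms(1)] assms(2)])
  from deg_ideal_lookup[OF this, of 0] show ?thesis
    by (simp add: mdeg_zero left_diff_distrib lookup_minus lookup_const_times)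
qed

lemma res_add: "x \<in> carrier R \<Longrightarrow> y \<in> carrier R \<Longrightarrow> res (x \<oplus>\<^bsub>R\<^esub> y) = res x + res y"
  and res_mult: "x \<in> carrier R \<Longrightarrow> y \<in> carrier R \<Longrightarrow> res (x \<otimes>\<^bsub>R\<^esub> y) = res x * res y"
proof -
  assume x: "x \<in> carrier R" and y: "y \<in> carrier R"
  note lx = lft[OF x] and ly = lft[OF y]
  show "res (x \<oplus>\<^bsub>R\<^esub> y) = res x + res y"
    using res_proj[OF deg_ideal_add[OF lx(1) ly(1)]] res_proj[OF lx(1)] res_proj[OF ly(1)]
      proj_hom(1)[OF lx(1) ly(1)] lx(2) ly(2) by (simp add: lookup_add)
  show "res (x \<otimes>\<^bsub>R\<^esub> y) = res x * res y"
    using res_proj[OF deg_ideal_mult_left[OF lx(1) ly(1)]] res_proj[OF lx(1)] res_proj[OF ly(1)]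
      proj_hom(2)[OF lx(1) ly(1)] lx(2) ly(2) lookup_mult_zero[OF lx(1) ly(1)] by simp
qed

lemma in_max_J_iff: "x \<in> carrier R \<Longrightarrow> x \<in> max_J \<longleftrightarrow> res x = 0"
proof
  assume x: "x \<in> carrier R"
  show "res x = 0" if xJ: "x \<in> max_J"
  proof -
    obtain p where p: "p \<in> J 1" "x = proj p" using xJ unfolding max_J_def by auto
    have p0: "p \<in> J 0" by (rule deg_ideal_mono[OF p(1)]) simp
    show ?thesis unfolding p(2) res_proj[OF p0] using lookup_zero_iff[OF p0] p(1) by simp
  qed
  assume "res x = 0"
  then have "lft x \<in> J 1" using lookup_zero_iff[OF lft(1)[OF x]] by (simp add: res_def coef_def)
  from imageI[OF this, of proj] show "x \<in> max_J" unfolding max_J_def by (simp add: lft(2)[OF x])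
qed

lemma max_J_lft: "x \<in> max_J \<Longrightarrow> x \<in> carrier R \<Longrightarrow> lft x \<in> J 1"
  using in_max_J_iff lookup_zero_iff[OF lft(1)] by (simp add: res_def coef_def)

lemma deg_ideal_power: "t \<in> J 1 \<Longrightarrow> t ^ j \<in> J j"
proof (induct j)
  case (Suc j)
  then show ?case using deg_ideal_mult[of t d 1 "t ^ j" j] by simp
qed (simp add: deg_ideal_one)

text \<open>
  Up to a scalar an element outside the maximal ideal is \<open>1 - t\<close> with \<open>t\<close> nilpotent, and the
  geometric series inverts it.
\<close>

lemma unit_exists:
  assumes x: "x \<in> carrier R" "res x \<noteq> 0" shows "\<exists>u\<in>carrier R. u \<otimes>\<^bsub>R\<^esub> x = \<one>\<^bsub>R\<^esub>"
proof -
  define p where "p = lft x"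
  have p: "p \<in> J 0" "proj p = x" using lft[OF x(1)] by (simp_all add: p_def)
  define a where "a = Poly_Mapping.lookup p 0"
  have a: "a \<noteq> 0" using x(2) res_proj[OF p(1)] p(2) by (simp add: a_def)
  define t where "t = 1 - Poly_Mapping.single 0 (inverse a) * p"
  define u where "u = Poly_Mapping.single 0 (inverse a) * (\<Sum>i<n. t ^ i)"
  have cp: "Poly_Mapping.single 0 (inverse a) * p \<in> J 0" by (rule deg_ideal_mult_left[OF deg_ideal_const p(1)])
  have t0: "t \<in> J 0" unfolding t_def by (rule deg_ideal_minus[OF deg_ideal_one cp])
  have "Poly_Mapping.lookup t 0 = 0"
    using a by (simp add: t_def lookup_minus lookup_const_times a_def[symmetric])
  then have t1: "t \<in> J 1" using lookup_zero_iff[OF t0] by simp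
  have ti: "t ^ i \<in> J 0" for i using deg_ideal_mono[OF deg_ideal_power[OF t1]] by simp
  have u: "u \<in> J 0" unfolding u_def by (intro deg_ideal_mult_left deg_ideal_const deg_ideal_sum ti)
  have "u * p = (1 - t) * (\<Sum>i<n. t ^ i)" by (simp add: u_def t_def mult.commute mult.left_commute)
  also have "\<dots> = 1 - t ^ n" by (rule one_diff_power_eq[symmetric])
  finally have "1 - u * p = t ^ n" by simp
  then have "proj 1 = proj (u * p)"
    using proj_eq_iff[OF deg_ideal_one deg_ideal_mult_left[OF u p(1)]] deg_ideal_power[OF t1] by simp
  then have "proj u \<otimes>\<^bsub>R\<^esub> x = \<one>\<^bsub>R\<^esub>" using proj_hom(2)[OF u p(1)] p(2) proj_one by simp
  then show ?thesis using proj_closed[OF u] by blast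
qed

lemma max_J_subset: "max_J \<subseteq> carrier R"
  unfolding max_J_def carrier_R by (rule image_mono) (auto intro: deg_ideal_mono)

lemma max_J_ideal: "ideal max_J R"
proof (rule idealI)
  interpret cring R by (rule R_cring)
  note nz = res_add res_mult
  show "ring R" by (rule ring_axioms)
  have res0: "res \<zero>\<^bsub>R\<^esub> = 0" using res_proj[OF deg_ideal_zero] by (simp add: proj_zero)
  show "subgroup max_J (add_monoid R)"
  proof (rule add.subgroupI)
    show "max_J \<subseteq> carrier R" by (rule max_J_subset)
    show "max_J \<noteq> {}" using in_max_J_iff[OF zero_closed] res0 by auto
    show "\<ominus>\<^bsub>R\<^esub> a \<in> max_J" if a: "a \<in> max_J" for a
    proof -
      have ac: "a \<in> carrier R" using a max_J_subset by auto
      have "res (a \<oplus>\<^bsub>R\<^esub> \<ominus>\<^bsub>R\<^esub> a) = res a + res (\<ominus>\<^bsub>R\<^esub> a)" by (rule res_add) (simp_all add: ac)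
      then have "res (\<ominus>\<^bsub>R\<^esub> a) = 0" using ac res0 in_max_J_iff[OF ac] a by (simp add: r_neg)
      then show ?thesis using in_max_J_iff[of "\<ominus>\<^bsub>R\<^esub> a"] ac by simp
    qed
    show "a \<oplus>\<^bsub>R\<^esub> b \<in> max_J" if ab: "a \<in> max_J" "b \<in> max_J" for a b
    proof -
      have c: "a \<in> carrier R" "b \<in> carrier R" using ab max_J_subset by auto
      then show ?thesis using ab in_max_J_iff[of "a \<oplus>\<^bsub>R\<^esub> b"] in_max_J_iff[of a] in_max_J_iff[of b] res_add by simp
    qed
  qed
  fix a x assume a: "a \<in> max_J" and x: "x \<in> carrier R"
  have ac: "a \<in> carrier R" using a max_J_subset by auto
  show "x \<otimes>\<^bsub>R\<^esub> a \<in> max_J" "a \<otimes>\<^bsub>R\<^esub> x \<in> max_J"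
    using a x ac in_max_J_iff[of "x \<otimes>\<^bsub>R\<^esub> a"] in_max_J_iff[of "a \<otimes>\<^bsub>R\<^esub> x"] in_max_J_iff[OF ac] res_mult by simp_all
qed

text \<open>
  An ideal with an element outside \<open>max_J\<close> contains a unit, so the ring is local.
\<close>

lemma proper_ideal_in_max_J:
  assumes K: "ideal K R" "K \<noteq> carrier R" shows "K \<subseteq> max_J"
proof
  interpret K: ideal K R by (rule K(1))
  fix x assume x: "x \<in> K"
  have xc: "x \<in> carrier R" using x K.a_subset by auto
  show "x \<in> max_J"
  proof (rule ccontr)
    assume "x \<notin> max_J"
    then obtain u where u: "u \<in> carrier R" "u \<otimes>\<^bsub>R\<^esub> x = \<one>\<^bsub>R\<^esub>"
      using unit_exists[OF xc] in_max_J_iff[OF xc] by blast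
    have "\<one>\<^bsub>R\<^esub> \<in> K" using K.I_l_closed[OF x u(1)] u(2) by simp
    then show False using K.one_imp_carrier K(2) by blast
  qed
qed

lemma res_one: "res \<one>\<^bsub>R\<^esub> = 1"
  using res_proj[OF deg_ideal_one] by (simp add: proj_one lookup_one)

lemma max_J_maximal: "maximalideal max_J R"
proof (rule maximalidealI[OF max_J_ideal])
  interpret cring R by (rule R_cring)
  show "carrier R \<noteq> max_J" using in_max_J_iff[OF one_closed] res_one one_closed by auto
  show "K = max_J \<or> K = carrier R" if "ideal K R" "max_J \<subseteq> K" "K \<subseteq> carrier R" for K
    using proper_ideal_in_max_J[OF that(1)] that(2) by blast
qed

lemma max_ideal_R: "max_ideal R = max_J"
  unfolding max_ideal_def
proof (rule the_equality[where P = "\<lambda>K. maximalideal K R" and a = max_J, OF max_J_maximal])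
  fix K assume K: "maximalideal K R"
  have "K \<subseteq> max_J"
    using proper_ideal_in_max_J[of K] K by (auto simp: maximalideal_def maximalideal_axioms_def)
  then show "K = max_J"
    using maximalideal.I_maximal[OF K max_J_ideal _ max_J_subset]
      maximalideal.I_notcarr[OF max_J_maximal] by blast
qed

text \<open>
  A submodule of \<open>R\<^sup>r\<close> is a subspace of the space of its finitely many coefficients, hence
  finitely generated.
\<close>

lemma R_submodules_fin_gen: "submodules_fin_gen R"
  unfolding submodules_fin_gen_def
proof (intro allI impI)
  fix r Z assume Z: "submodule R Z (std_free R r)"
  interpret vs: vector_space "\<lambda>(c::'k) (f::nat \<times> (nat \<Rightarrow>\<^sub>0 nat) \<Rightarrow> 'k) i. c * f i"
    by (rule vector_space_functions)
  define Mon where "Mon = {m. Poly_Mapping.keys m \<subseteq> {..<d} \<and> mdeg d m < n}"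
  define \<kappa> where "\<kappa> f = (\<lambda>(s, m). if m \<in> Mon \<and> s < r then coef (f s) m else 0)" for f
  note L = free_module_on_module[OF R_cring, of "{..<r}"]
  note fc = free_module_on_coeff[OF R_cring]
  note Zc = subsetD[OF submodule.subset[OF Z]]
  have coef_add: "coef (x \<oplus>\<^bsub>R\<^esub> y) m = coef x m + coef y m"
    if "x \<in> carrier R" "y \<in> carrier R" "m \<in> Mon" for x y m
  proof -
    note lx = lft[OF that(1)] and ly = lft[OF that(2)]
    have m: "mdeg d m < n" using that(3) by (simp add: Mon_def)
    show ?thesis
      using coef_proj[OF deg_ideal_add[OF lx(1) ly(1)] m] proj_hom(1)[OF lx(1) ly(1)] lx(2) ly(2)
      by (simp add: lookup_add coef_def)
  qed
  have coef_const: "coef (proj (Poly_Mapping.single 0 c) \<otimes>\<^bsub>R\<^esub> x) m = c * coef x m"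
    if "x \<in> carrier R" "m \<in> Mon" for x m c
  proof -
    note lx = lft[OF that(1)]
    have m: "mdeg d m < n" using that(2) by (simp add: Mon_def)
    show ?thesis
      using coef_proj[OF deg_ideal_mult_left[OF deg_ideal_const lx(1)] m, of c]
        proj_hom(2)[OF deg_ideal_const lx(1), of c] lx(2)
      by (simp add: lookup_const_times coef_def)
  qed
  have coef_inj: "x = y" if "x \<in> carrier R" "y \<in> carrier R" "\<And>m. m \<in> Mon \<Longrightarrow> coef x m = coef y m" for x y
  proof -
    note lx = lft[OF that(1)] and ly = lft[OF that(2)]
    have "lft x - lft y \<in> J n"
      unfolding deg_ideal_def
    proof (intro CollectI allI impI)
      fix m assume m: "Poly_Mapping.lookup (lft x - lft y) m \<noteq> 0"
      have k: "Poly_Mapping.keys m \<subseteq> {..<d}"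
        using deg_ideal_minus[OF lx(1) ly(1)] m unfolding deg_ideal_def by blast
      have "m \<notin> Mon" using m that(3)[of m] by (auto simp: lookup_minus coef_def)
      with k show "Poly_Mapping.keys m \<subseteq> {..<d} \<and> n \<le> mdeg d m" by (auto simp: Mon_def)
    qed
    then show ?thesis using proj_eq_iff[OF lx(1) ly(1)] lx(2) ly(2) by simp
  qed
  have \<kappa>_add: "\<kappa> (f \<oplus>\<^bsub>std_free R r\<^esub> g) = \<kappa> f + \<kappa> g"
    if "f \<in> carrier (std_free R r)" "g \<in> carrier (std_free R r)" for f g
    by (rule ext) (simp add: \<kappa>_def coef_add fc[OF that(1)] fc[OF that(2)] split: prod.splits)
  have \<kappa>_scale: "\<kappa> (proj (Poly_Mapping.single 0 c) \<odot>\<^bsub>std_free R r\<^esub> f) = (\<lambda>i. c * \<kappa> f i)"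
    if "f \<in> carrier (std_free R r)" for f c
    by (rule ext) (simp add: \<kappa>_def coef_const fc[OF that] split: prod.splits)
  have \<kappa>_inj: "f = g" if "f \<in> carrier (std_free R r)" "g \<in> carrier (std_free R r)" "\<kappa> f = \<kappa> g" for f g
  proof
    fix s show "f s = g s"
    proof (cases "s < r")
      case True
      show ?thesis
      proof (rule coef_inj[OF fc[OF that(1)] fc[OF that(2)]])
        fix m assume "m \<in> Mon"
        then show "coef (f s) m = coef (g s) m"
          using fun_cong[OF that(3), of "(s, m)"] True by (simp add: \<kappa>_def)
      qed
    next
      case False
      then show ?thesis using that(1,2) by (simp add: carrier_free_module_on)
    qed
  qed
  have sub: "vs.subspace (\<kappa> ` P)" if P: "submodule R P (std_free R r)" for P
  proof (rule vs.subspaceI)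
    note Pc = subsetD[OF submodule.subset[OF P]]
    have z: "\<zero>\<^bsub>std_free R r\<^esub> \<in> P" by (rule submodule.zero_closed[OF P])
    show "0 \<in> \<kappa> ` P"
    proof (rule image_eqI[OF _ submodule.smult_closed[OF P proj_closed[OF deg_ideal_const[of 0]] z]])
      show "0 = \<kappa> (proj (Poly_Mapping.single 0 0) \<odot>\<^bsub>std_free R r\<^esub> \<zero>\<^bsub>std_free R r\<^esub>)"
        unfolding \<kappa>_scale[OF Pc[OF z]] by (simp add: zero_fun_def)
    qed
    show "x + y \<in> \<kappa> ` P" if xy: "x \<in> \<kappa> ` P" "y \<in> \<kappa> ` P" for x y
    proof -
      obtain f g where f: "f \<in> P" "x = \<kappa> f" "g \<in> P" "y = \<kappa> g" using xy by blast
      show ?thesis unfolding f(2,4) \<kappa>_add[OF Pc[OF f(1)] Pc[OF f(3)], symmetric]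
        by (rule imageI[OF submodule.m_closed[OF P f(1,3)]])
    qed
    show "(\<lambda>i. c * x i) \<in> \<kappa> ` P" if x: "x \<in> \<kappa> ` P" for c x
    proof -
      obtain f where f: "f \<in> P" "x = \<kappa> f" using x by blast
      show ?thesis unfolding f(2) \<kappa>_scale[OF Pc[OF f(1)], symmetric]
        by (rule imageI[OF submodule.smult_closed[OF P proj_closed[OF deg_ideal_const] f(1)]])
    qed
  qed
  have finMon: "finite Mon"
  proof -
    let ?F = "{f :: nat \<Rightarrow> nat. \<forall>i. (i \<in> {..<d} \<longrightarrow> f i \<in> {..<n}) \<and> (i \<notin> {..<d} \<longrightarrow> f i = 0)}"
    have "finite ?F" by (rule finite_set_of_finite_funs) simp_all
    moreover have "Poly_Mapping.lookup ` Mon \<subseteq> ?F"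
    proof (rule image_subsetI, intro CollectI allI conjI impI)
      fix m i assume m: "m \<in> Mon"
      show "Poly_Mapping.lookup m i \<in> {..<n}" if "i \<in> {..<d}"
      proof -
        have "Poly_Mapping.lookup m i \<le> mdeg d m"
          unfolding mdeg_def by (rule member_le_sum) (use that in simp_all)
        then show ?thesis using m by (simp add: Mon_def)
      qed
      show "Poly_Mapping.lookup m i = 0" if "i \<notin> {..<d}"
        using m that by (auto simp: Mon_def in_keys_iff)
    qed
    ultimately have "finite (Poly_Mapping.lookup ` Mon)" by (rule finite_subset[rotated])
    moreover have "inj_on Poly_Mapping.lookup Mon"
      unfolding inj_on_def poly_mapping_eq_iff by blast
    ultimately show ?thesis by (rule finite_imageD)
  qed
  define T where "T = (\<lambda>i j. if j = i then 1 else 0 :: 'k) ` ({..<r} \<times> Mon)"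
  have finT: "finite T" using finMon by (simp add: T_def)
  have spanT: "\<kappa> f \<in> vs.span T" for f
  proof -
    have "\<kappa> f = (\<Sum>i\<in>{..<r} \<times> Mon. (\<lambda>j. \<kappa> f i * (if j = i then 1 else 0)))"
    proof
      fix j
      have "(\<Sum>i\<in>{..<r} \<times> Mon. (\<lambda>j. \<kappa> f i * (if j = i then 1 else 0))) j
          = (\<Sum>i\<in>{..<r} \<times> Mon. if j = i then \<kappa> f i else 0)"
        unfolding sum_fun_apply by (rule sum.cong) auto
      also have "\<dots> = (if j \<in> {..<r} \<times> Mon then \<kappa> f j else 0)" using finMon by simp
      also have "\<dots> = \<kappa> f j" by (cases j) (auto simp: \<kappa>_def)
      finally show "\<kappa> f j = (\<Sum>i\<in>{..<r} \<times> Mon. (\<lambda>j. \<kappa> f i * (if j = i then 1 else 0))) j" by simp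
    qed
    also have "\<dots> \<in> vs.span T"
    proof (rule vs.span_sum)
      fix i assume "i \<in> {..<r} \<times> Mon"
      then have "(\<lambda>j. if j = i then 1 else 0) \<in> T" unfolding T_def by (rule imageI)
      from vs.span_scale[OF vs.span_base[OF this]]
      show "(\<lambda>j. \<kappa> f i * (if j = i then 1 else 0)) \<in> vs.span T" .
    qed
    finally show ?thesis .
  qed
  obtain B where B: "B \<subseteq> \<kappa> ` Z" "vs.independent B" "\<kappa> ` Z \<subseteq> vs.span B"
    using vs.maximal_independent_subset by blast
  have "B \<subseteq> vs.span T" using B(1) spanT by blast
  then have "finite B" using vs.independent_span_bound[OF finT B(2)] by simp
  then obtain A where A: "A \<subseteq> Z" "finite A" "B = \<kappa> ` A" using finite_subset_image[OF _ B(1)] by blast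
  have "fin_gen_in R (std_free R r) Z A"
    unfolding fin_gen_in_def
  proof (intro conjI allI impI)
    show "finite A" "A \<subseteq> Z" by (rule A)+
    fix P assume P: "submodule R P (std_free R r)" "A \<subseteq> P"
    have "vs.span B \<subseteq> \<kappa> ` P"
      by (rule vs.span_minimal[OF _ sub[OF P(1)]]) (use A(3) P(2) in blast)
    show "Z \<subseteq> P"
    proof
      fix z assume z: "z \<in> Z"
      have "\<kappa> z \<in> \<kappa> ` P"
        by (rule subsetD[OF \<open>vs.span B \<subseteq> \<kappa> ` P\<close> subsetD[OF B(3) imageI[OF z]]])
      then obtain p where p: "\<kappa> z = \<kappa> p" "p \<in> P" by (rule imageE)
      have "z = p" by (rule \<kappa>_inj[OF Zc[OF z] subsetD[OF submodule.subset[OF P(1)] p(2)] p(1)])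
      then show "z \<in> P" using p(2) by simp
    qed
  qed
  then show "\<exists>A. fin_gen_in R (std_free R r) Z A" by (rule exI)
qed

lemma local_noetherian_R: "local_noetherian R max_J res"
proof -
  have 1: "residue_ring R max_J"
    by (rule residue_ring.intro[OF R_cring]) (use max_J_maximal max_ideal_R in simp_all)
  have 2: "local_noetherian_axioms R max_J res"
  proof (rule local_noetherian_axioms.intro)
    show "submodules_fin_gen R" by (rule R_submodules_fin_gen)
  qed (rule res_add res_mult res_one in_max_J_iff unit_exists; assumption)+
  show ?thesis by (rule local_noetherian.intro[OF 1 2])
qed

end

section \<open>Counting generators of the kernel of a matrix\<close>

definition monomials_of_degree :: "nat \<Rightarrow> nat \<Rightarrow> (nat \<Rightarrow>\<^sub>0 nat) set"
  where "monomials_of_degree d n = {m. Poly_Mapping.keys m \<subseteq> {..<d} \<and> mdeg d m = n}"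

lemma card_monomials_of_degree:
  "finite (monomials_of_degree d n)"
  "0 < d \<Longrightarrow> card (monomials_of_degree d n) = (d + n - 1) choose (d - 1)"
proof -
  let ?S = "{l :: nat list. length l = d \<and> sum_list l = n}"
  let ?f = "\<lambda>m. map (Poly_Mapping.lookup m) [0..<d]"
  have bij: "bij_betw ?f (monomials_of_degree d n) ?S"
    unfolding bij_betw_def
  proof
    show "inj_on ?f (monomials_of_degree d n)"
    proof (rule inj_onI, rule poly_mapping_eqI)
      fix m m' i assume m: "m \<in> monomials_of_degree d n" "m' \<in> monomials_of_degree d n" "?f m = ?f m'"
      show "Poly_Mapping.lookup m i = Poly_Mapping.lookup m' i"
      proof (cases "i < d")
        case True
        then have "?f m ! i = ?f m' ! i" using m(3) by simp
        then show ?thesis using True by simp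
      next
        case False
        then have "i \<notin> Poly_Mapping.keys m" "i \<notin> Poly_Mapping.keys m'"
          using m(1,2) by (auto simp: monomials_of_degree_def)
        then show ?thesis by (simp add: in_keys_iff)
      qed
    qed
    have sum: "sum_list (?f m) = mdeg d m" for m
      by (simp add: mdeg_def sum_list_sum_nth atLeast0LessThan)
    show "?f ` monomials_of_degree d n = ?S"
    proof
      show "?f ` monomials_of_degree d n \<subseteq> ?S"
        by (rule image_subsetI) (simp only: mem_Collect_eq sum, simp add: monomials_of_degree_def)
      show "?S \<subseteq> ?f ` monomials_of_degree d n"
      proof
        fix l assume l: "l \<in> ?S"
        define m where "m = Poly_Mapping.nth l"
        have lk: "Poly_Mapping.lookup m i = (if i < d then l ! i else 0)" for i
          using l by (simp add: m_def nth_default_def)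
        have fm: "?f m = l" by (rule nth_equalityI) (use l lk in simp_all)
        have "Poly_Mapping.keys m \<subseteq> {..<d}"
          by (rule subsetI) (simp add: in_keys_iff lk split: if_splits)
        moreover have "mdeg d m = n" using sum[of m] l unfolding fm by simp
        ultimately have "m \<in> monomials_of_degree d n" by (simp add: monomials_of_degree_def)
        then show "l \<in> ?f ` monomials_of_degree d n" using fm by (rule image_eqI[rotated, OF _ sym])
      qed
    qed
  qed
  have finS: "finite ?S"
  proof (rule finite_subset)
    show "?S \<subseteq> {l. set l \<subseteq> {..n} \<and> length l = d}"
      using member_le_sum_list by fastforce
    show "finite {l. set l \<subseteq> {..n} \<and> length l = d}" by (rule finite_lists_length_eq) simp
  qed
  show "finite (monomials_of_degree d n)" using bij_betw_finite[OF bij] finS by simp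
  assume d: "0 < d"
  have "card (monomials_of_degree d n) = card ?S" by (rule bij_betw_same_card[OF bij])
  also have "\<dots> = (n + d - 1) choose n" by (rule card_length_sum_list)
  also have "\<dots> = (n + d - 1) choose (n + d - 1 - n)" by (rule binomial_symmetric) (use d in simp)
  finally show "card (monomials_of_degree d n) = (d + n - 1) choose (d - 1)"
    using d by (simp add: add.commute)
qed

lemma vector_space_mpoly_vectors:
  "vector_space (\<lambda>(c::'k::field) (v :: nat \<Rightarrow> 'k mpoly) t. Poly_Mapping.single 0 c * v t)"
proof unfold_locales
  show "(\<lambda>t. Poly_Mapping.single 0 a * (x + y) t)
      = (\<lambda>t. Poly_Mapping.single 0 a * x t) + (\<lambda>t. Poly_Mapping.single 0 a * y t)"
    for a :: 'k and x y :: "nat \<Rightarrow> 'k mpoly"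
    by (simp add: fun_eq_iff distrib_left)
  show "(\<lambda>t. Poly_Mapping.single 0 (a + b) * x t)
      = (\<lambda>t. Poly_Mapping.single 0 a * x t) + (\<lambda>t. Poly_Mapping.single 0 b * x t)"
    for a b :: 'k and x :: "nat \<Rightarrow> 'k mpoly"
    by (simp add: fun_eq_iff single_add distrib_right)
  show "(\<lambda>t. Poly_Mapping.single 0 a * (Poly_Mapping.single 0 b * x t))
      = (\<lambda>t. Poly_Mapping.single 0 (a * b) * x t)"
    for a b :: 'k and x :: "nat \<Rightarrow> 'k mpoly"
    by (simp add: fun_eq_iff mult.assoc[symmetric] mult_single)
  show "(\<lambda>t. Poly_Mapping.single 0 1 * x t) = x" for x :: "nat \<Rightarrow> 'k mpoly"
    by (simp add: fun_eq_iff)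
qed

text \<open>
  The combinatorial core. Here \<open>a\<close> is a \<open>b\<^sub>0 \<times> b\<^sub>1\<close> matrix of polynomials without constant term whose
  image contains \<open>\<nn>\<^sup>n\<^sup>-\<^sup>1\<close> modulo \<open>\<nn>\<^sup>n\<close>.
\<close>

locale poly_matrix =
  fixes d n b0 b1 :: nat and a :: "nat \<Rightarrow> nat \<Rightarrow> 'k::field mpoly"
  assumes d_pos: "0 < d" and n_pos: "0 < n"
    and a: "\<And>s t. s < b0 \<Longrightarrow> t < b1 \<Longrightarrow> a s t \<in> deg_ideal d 1"
    and a_surj: "\<And>w. (\<And>s. w s \<in> deg_ideal d (n - 1)) \<Longrightarrow>
      \<exists>v. (\<forall>t. v t \<in> deg_ideal d 0) \<and> (\<forall>t\<ge>b1. v t = 0) \<and> (\<forall>s<b0. (\<Sum>t<b1. a s t * v t) - w s \<in> deg_ideal d n)"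
begin

abbreviation J where "J \<equiv> deg_ideal d :: nat \<Rightarrow> 'k mpoly set"
abbreviation scl :: "'k \<Rightarrow> (nat \<Rightarrow> 'k mpoly) \<Rightarrow> nat \<Rightarrow> 'k mpoly"
  where "scl \<equiv> \<lambda>c v t. Poly_Mapping.single 0 c * v t"

sublocale vs: vector_space scl by (rule vector_space_mpoly_vectors)
sublocale cs: vector_space "\<lambda>(c::'k) (f::nat \<times> nat \<Rightarrow> 'k) i. c * f i" by (rule vector_space_functions)

definition act :: "(nat \<Rightarrow> 'k mpoly) \<Rightarrow> nat \<Rightarrow> 'k mpoly"
  where "act v s = (\<Sum>t<b1. a s t * v t)"

text \<open>
  The polynomial vectors that represent elements of the kernel of the matrix over \<open>k[x] / \<nn>\<^sup>n\<close>.
  Vectors are functions on all of \<open>nat\<close>, so the components from \<open>b\<^sub>1\<close> on are required to be zero.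
\<close>

definition K :: "(nat \<Rightarrow> 'k mpoly) set"
  where "K = {v. (\<forall>t. v t \<in> J 0) \<and> (\<forall>t\<ge>b1. v t = 0) \<and> (\<forall>s<b0. act v s \<in> J n)}"

text \<open>
  As \<open>K\<close> is stable under multiplication by polynomials, this linear span is \<open>\<nn> K\<close>.
\<close>

definition nK :: "(nat \<Rightarrow> 'k mpoly) set"
  where "nK = vs.span {(\<lambda>t. mpoly_var i * v t) | i v. i < d \<and> v \<in> K}"

text \<open>
  Restriction to the line \<open>x\<^sub>1 = x\<^sub>2 = \<cdots> = 0\<close>, modulo \<open>x\<^sub>0\<^sup>n\<close>: only the coefficients of powers of \<open>x\<^sub>0\<close>
  are kept. On the line, \<open>x\<^sub>0\<close> acts by \<open>shift\<close> and the other variables act by zero.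
\<close>

definition line :: "(nat \<Rightarrow> 'k mpoly) \<Rightarrow> nat \<times> nat \<Rightarrow> 'k"
  where "line v = (\<lambda>(t, j). if t < b1 \<and> j < n
    then Poly_Mapping.lookup (v t) (Poly_Mapping.single 0 j) else 0)"

definition shift :: "(nat \<times> nat \<Rightarrow> 'k) \<Rightarrow> nat \<times> nat \<Rightarrow> 'k"
  where "shift f = (\<lambda>(t, j). if 0 < j \<and> j < n then f (t, j - 1) else 0)"

lemma act_add: "act (v + w) s = act v s + act w s"
  by (simp add: act_def distrib_left sum.distrib)

lemma act_mult: "act (\<lambda>t. p * v t) s = p * act v s"
  by (simp add: act_def sum_distrib_left mult.left_commute)

lemma act_zero: "act 0 s = 0"
  by (simp add: act_def)

lemma K_add: "v \<in> K \<Longrightarrow> w \<in> K \<Longrightarrow> v + w \<in> K"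
  by (simp add: K_def act_add deg_ideal_add)

lemma K_mult: "p \<in> J 0 \<Longrightarrow> v \<in> K \<Longrightarrow> (\<lambda>t. p * v t) \<in> K"
  by (simp add: K_def act_mult deg_ideal_mult_left)

lemma K_subspace: "vs.subspace K"
proof (rule vs.subspaceI)
  show "0 \<in> K" by (simp add: K_def act_zero deg_ideal_zero)
qed (auto intro: K_add K_mult deg_ideal_const)

lemma K_of_degree:
  assumes "\<And>t. v t \<in> J (n - 1)" "\<And>t. b1 \<le> t \<Longrightarrow> v t = 0" shows "v \<in> K"
proof -
  have "a s t * v t \<in> J n" if "s < b0" "t < b1" for s t
    using deg_ideal_mult[OF a[OF that] assms(1)[of t]] n_pos by simp
  then have "act v s \<in> J n" if "s < b0" for s
    unfolding act_def using that by (intro deg_ideal_sum) simp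
  moreover have "v t \<in> J 0" for t by (rule deg_ideal_mono[OF assms(1)]) simp
  ultimately show ?thesis using assms(2) by (simp add: K_def)
qed

lemma var_times_K: "i < d \<Longrightarrow> v \<in> K \<Longrightarrow> (\<lambda>t. mpoly_var i * v t) \<in> nK"
  unfolding nK_def by (rule vs.span_base) blast

lemma nK_of_coefficients:
  assumes "\<And>i. q i \<in> K" shows "(\<lambda>t. \<Sum>i<d. mpoly_var i * q i t) \<in> nK"
proof -
  have "(\<lambda>t. \<Sum>i<d. mpoly_var i * q i t) = (\<Sum>i<d. (\<lambda>t. mpoly_var i * q i t))"
    by (simp add: fun_eq_iff sum_fun_apply)
  also have "\<dots> \<in> nK"
    unfolding nK_def
    by (rule vs.span_sum) (rule var_times_K[unfolded nK_def], use assms in simp_all)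
  finally show ?thesis .
qed

lemma nK_mult:
  assumes p: "p \<in> J 1" and v: "v \<in> K" shows "(\<lambda>t. p * v t) \<in> nK"
proof -
  obtain q where q: "\<forall>i. q i \<in> J 0" "p = (\<Sum>i<d. mpoly_var i * q i)"
    using deg_ideal_Suc_decompose[of p d 0] p by auto
  have "(\<lambda>t. p * v t) = (\<lambda>t. \<Sum>i<d. mpoly_var i * (q i * v t))"
    unfolding q(2) by (simp add: sum_distrib_right mult.assoc)
  also have "\<dots> \<in> nK" by (rule nK_of_coefficients) (rule K_mult[OF q(1)[rule_format] v])
  finally show ?thesis .
qed

text \<open>
  Vectors in \<open>\<nn>\<^sup>n\<^sup>-\<^sup>1\<close> are in \<open>K\<close> because the entries of the matrix are in \<open>\<nn>\<close>. Therefore \<open>\<nn> K\<close> contains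
  the vectors in \<open>\<nn>\<^sup>n\<close>, and generators of the kernel over \<open>k[x] / \<nn>\<^sup>n\<close> span \<open>K\<close> modulo \<open>\<nn> K\<close>.
\<close>

lemma nK_of_degree:
  assumes "\<And>t. v t \<in> J n" "\<And>t. b1 \<le> t \<Longrightarrow> v t = 0" shows "v \<in> nK"
proof -
  have "\<forall>t. \<exists>q. (\<forall>i. q i \<in> J (n - 1) \<and> (b1 \<le> t \<longrightarrow> q i = 0)) \<and> v t = (\<Sum>i<d. mpoly_var i * q i)"
  proof
    fix t
    show "\<exists>q. (\<forall>i. q i \<in> J (n - 1) \<and> (b1 \<le> t \<longrightarrow> q i = 0)) \<and> v t = (\<Sum>i<d. mpoly_var i * q i)"
    proof (cases "b1 \<le> t")
      case True
      then show ?thesis using assms(2) by (intro exI[of _ "\<lambda>_. 0"]) (simp add: deg_ideal_zero)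
    next
      case False
      have "v t \<in> J (Suc (n - 1))" using assms(1) n_pos by simp
      from deg_ideal_Suc_decompose[OF this] show ?thesis using False by simp
    qed
  qed
  from choice[OF this] obtain q where q: "\<forall>t. (\<forall>i. q t i \<in> J (n - 1) \<and> (b1 \<le> t \<longrightarrow> q t i = 0)) \<and>
      v t = (\<Sum>i<d. mpoly_var i * q t i)"
    by (rule exE)
  have "v = (\<lambda>t. \<Sum>i<d. mpoly_var i * q t i)" using q by (simp add: fun_eq_iff)
  also have "\<dots> \<in> nK" by (rule nK_of_coefficients) (rule K_of_degree, use q in simp_all)
  finally show ?thesis .
qed

lemma line_add: "line (v + w) = line v + line w"
  by (simp add: line_def fun_eq_iff lookup_add)

lemma line_scale: "line (scl c v) = (\<lambda>i. c * line v i)"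
  by (simp add: line_def fun_eq_iff lookup_const_times)

lemma line_zero: "line 0 = 0"
  by (simp add: line_def fun_eq_iff)

lemma line_sum: "line (\<Sum>x\<in>A. f x) = (\<Sum>x\<in>A. line (f x))"
  by (auto simp: line_def fun_eq_iff sum_fun_apply lookup_sum)

lemma shift_linear: "Vector_Spaces.linear (\<lambda>(c::'k) f i. c * f i) (\<lambda>c f i. c * f i) shift"
  by unfold_locales (simp_all add: shift_def fun_eq_iff)

lemma lookup_var_times:
  "Poly_Mapping.lookup (mpoly_var i * p) (Poly_Mapping.single i 1 + m) = Poly_Mapping.lookup p m"
  for p :: "'k mpoly"
  unfolding mpoly_var_def by (simp add: lookup_single_times)

lemma lookup_var_times_eq_zero:
  "Poly_Mapping.lookup m i = 0 \<Longrightarrow> Poly_Mapping.lookup (mpoly_var i * p) m = 0"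
  for p :: "'k mpoly"
  unfolding mpoly_var_def
  by (rule lookup_single_times_eq_zero) (auto simp: lookup_add)

lemma line_var_0: "line (\<lambda>t. mpoly_var 0 * v t) = shift (line v)"
proof (rule ext, clarify)
  fix t j
  show "line (\<lambda>t. mpoly_var 0 * v t) (t, j) = shift (line v) (t, j)"
  proof (cases j)
    case 0
    then show ?thesis by (simp add: line_def shift_def lookup_var_times_eq_zero)
  next
    case (Suc l)
    have "Poly_Mapping.single 0 (Suc l) = Poly_Mapping.single (0::nat) 1 + Poly_Mapping.single 0 l"
      by (simp add: single_add[symmetric])
    then show ?thesis using Suc lookup_var_times[of 0 "v t" "Poly_Mapping.single 0 l"]
      by (simp add: line_def shift_def)
  qed
qed

lemma line_var: "0 < i \<Longrightarrow> line (\<lambda>t. mpoly_var i * v t) = 0"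
  by (simp add: line_def fun_eq_iff lookup_var_times_eq_zero lookup_single)

lemma line_K_subspace: "cs.subspace (line ` K)"
proof (rule cs.subspaceI)
  have "line 0 \<in> line ` K" by (rule imageI[OF vs.subspace_0[OF K_subspace]])
  then show "0 \<in> line ` K" by (simp only: line_zero)
  show "x + y \<in> line ` K" if xy: "x \<in> line ` K" "y \<in> line ` K" for x y
  proof -
    obtain v w where v: "v \<in> K" "x = line v" "w \<in> K" "y = line w" using xy by blast
    show ?thesis unfolding v(2,4) line_add[symmetric] by (rule imageI[OF K_add[OF v(1,3)]])
  qed
  show "(\<lambda>i. c * x i) \<in> line ` K" if x: "x \<in> line ` K" for c x
  proof -
    obtain v where v: "v \<in> K" "x = line v" using x by blast
    show ?thesis unfolding v(2) line_scale[symmetric]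
      by (rule imageI[OF vs.subspace_scale[OF K_subspace v(1)]])
  qed
qed

text \<open>
  Of the variables only \<open>x\<^sub>0\<close> contributes on the line.
\<close>

lemma line_nK: "w \<in> nK \<Longrightarrow> line w \<in> shift ` line ` K"
proof -
  assume w: "w \<in> nK"
  interpret S: Vector_Spaces.linear "\<lambda>(c::'k) (f::nat \<times> nat \<Rightarrow> 'k) i. c * f i" "\<lambda>c f i. c * f i" shift
    by (rule shift_linear)
  have sub: "cs.subspace (shift ` line ` K)" by (rule S.subspace_image[OF line_K_subspace])
  have "vs.subspace {w. line w \<in> shift ` line ` K}"
    by (rule vs.subspaceI)
      (simp_all add: line_zero line_add line_scale cs.subspace_0[OF sub] cs.subspace_add[OF sub]
        cs.subspace_scale[OF sub])
  then have "nK \<subseteq> {w. line w \<in> shift ` line ` K}"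
    unfolding nK_def
  proof (rule vs.span_minimal[rotated], intro subsetI CollectI)
    fix w assume "w \<in> {(\<lambda>t. mpoly_var i * v t) | i v. i < d \<and> v \<in> K}"
    then obtain i v where w: "w = (\<lambda>t. mpoly_var i * v t)" "v \<in> K" by blast
    show "line w \<in> shift ` line ` K"
    proof (cases "i = 0")
      case True
      show ?thesis unfolding w(1) True line_var_0 by (intro imageI w(2))
    next
      case False
      then show ?thesis unfolding w(1) using line_var[of i v] cs.subspace_0[OF sub] by simp
    qed
  qed
  then show "line w \<in> shift ` line ` K" using w by blast
qed

lemma act_nK: "w \<in> nK \<Longrightarrow> s < b0 \<Longrightarrow> act w s \<in> J (Suc n)"
proof -
  assume w: "w \<in> nK" and s: "s < b0"
  have "vs.subspace {w. act w s \<in> J (Suc n)}"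
    by (rule vs.subspaceI)
      (simp_all add: act_zero act_add act_mult deg_ideal_zero deg_ideal_add
        deg_ideal_mult_left[OF deg_ideal_const])
  then have "nK \<subseteq> {w. act w s \<in> J (Suc n)}"
    unfolding nK_def
  proof (rule vs.span_minimal[rotated], intro subsetI CollectI)
    fix w assume "w \<in> {(\<lambda>t. mpoly_var i * v t) | i v. i < d \<and> v \<in> K}"
    then obtain i v where w: "w = (\<lambda>t. mpoly_var i * v t)" "i < d" "v \<in> K" by blast
    have "act v s \<in> J n" using w(3) s by (simp add: K_def)
    from deg_ideal_mult[OF mpoly_var_deg_ideal[OF w(2)] this]
    show "act w s \<in> J (Suc n)" unfolding w(1) act_mult by simp
  qed
  then show "act w s \<in> J (Suc n)" using w by blast
qed

text \<open>
  The restriction \<open>L\<close> of \<open>K\<close> to the line is stable under \<open>shift\<close> and contains the \<open>b\<^sub>1\<close> vectors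
  \<open>x\<^sub>0\<^sup>n\<^sup>-\<^sup>1 e\<^sub>t\<close>, which \<open>shift\<close> kills. So \<open>L\<close> modulo its shift has dimension at least \<open>b\<^sub>1\<close>.
\<close>

lemma line_independent:
  "\<exists>C. C \<subseteq> line ` K \<and> finite C \<and> b1 \<le> card C \<and>
    (\<forall>c. (\<Sum>f\<in>C. (\<lambda>i. c f * f i)) \<in> shift ` line ` K \<longrightarrow> (\<forall>f\<in>C. c f = 0))"
proof -
  let ?u = "\<lambda>i j. if j = i then 1 else 0 :: 'k"
  let ?T = "?u ` ({..<b1} \<times> {..<n})" and ?E = "(\<lambda>t. ?u (t, n - 1)) ` {..<b1}"
  have injE: "inj_on (\<lambda>t. ?u (t, n - 1)) {..<b1}"
  proof (rule inj_onI)
    fix t t' assume "?u (t, n - 1) = ?u (t', n - 1)"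
    from fun_cong[OF this, of "(t, n - 1)"] show "t = t'" by (simp split: if_splits)
  qed
  have span: "line v \<in> cs.span ?T" for v
  proof -
    have "line v = (\<Sum>i\<in>{..<b1} \<times> {..<n}. (\<lambda>j. line v i * ?u i j))"
    proof
      fix j
      have "(\<Sum>i\<in>{..<b1} \<times> {..<n}. (\<lambda>j. line v i * ?u i j)) j
          = (\<Sum>i\<in>{..<b1} \<times> {..<n}. if j = i then line v i else 0)"
        unfolding sum_fun_apply by (rule sum.cong) auto
      also have "\<dots> = (if j \<in> {..<b1} \<times> {..<n} then line v j else 0)" by simp
      also have "\<dots> = line v j" by (cases j) (auto simp: line_def)
      finally show "line v j = (\<Sum>i\<in>{..<b1} \<times> {..<n}. (\<lambda>j. line v i * ?u i j)) j" by simp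
    qed
    also have "\<dots> \<in> cs.span ?T"
    proof (rule cs.span_sum)
      fix i assume "i \<in> {..<b1} \<times> {..<n}"
      from cs.span_scale[OF cs.span_base[OF imageI[OF this]]]
      show "(\<lambda>j. line v i * ?u i j) \<in> cs.span ?T" .
    qed
    finally show ?thesis .
  qed
  have "\<exists>C. C \<subseteq> line ` K \<and> finite C \<and> card ?E \<le> card C \<and>
    (\<forall>c. (\<Sum>f\<in>C. (\<lambda>i. c f * f i)) \<in> shift ` (line ` K) \<longrightarrow> (\<forall>f\<in>C. c f = 0))"
  proof (rule cs.independent_modulo_image[OF line_K_subspace _ _ shift_linear])
    show "line ` K \<subseteq> cs.span ?T" using span by blast
    show "finite ?T" by simp
    show "shift f \<in> line ` K" if f: "f \<in> line ` K" for f
    proof -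
      obtain v where v: "v \<in> K" "f = line v" using f by blast
      show ?thesis unfolding v(2) line_var_0[symmetric]
        by (rule imageI[OF K_mult[OF deg_ideal_mono[OF mpoly_var_deg_ideal[OF d_pos]] v(1)]]) simp
    qed
    show "?E \<subseteq> line ` K"
    proof (rule image_subsetI)
      fix t assume t: "t \<in> {..<b1}"
      define v :: "nat \<Rightarrow> 'k mpoly"
        where "v t' = (if t' = t then Poly_Mapping.single (Poly_Mapping.single 0 (n - 1)) 1 else 0)" for t'
      have "v t' \<in> J (n - 1)" for t'
        unfolding v_def using d_pos by (simp add: deg_ideal_zero deg_ideal_single mdeg_single)
      moreover have "v t' = 0" if "b1 \<le> t'" for t' using t that by (simp add: v_def)
      ultimately have vK: "v \<in> K" by (rule K_of_degree)
      have lv: "line v = ?u (t, n - 1)"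
      proof (rule ext, clarify)
        fix t' j
        have "(Poly_Mapping.single (0::nat) (n - 1) = Poly_Mapping.single 0 j) = (j = n - 1)"
          by (metis lookup_single_eq)
        then show "line v (t', j) = ?u (t, n - 1) (t', j)"
          using t n_pos by (auto simp: line_def v_def lookup_single when_def)
      qed
      from imageI[OF vK, of line] show "?u (t, n - 1) \<in> line ` K" by (simp only: lv)
    qed
    show "finite ?E" by simp
    show "\<not> cs.dependent ?E"
    proof -
      have "\<forall>v\<in>?E. u v = 0" if 0: "(\<Sum>v\<in>?E. (\<lambda>i. u v * v i)) = 0" for u
      proof (rule ballI)
        fix v assume "v \<in> ?E"
        then obtain t where t: "t < b1" "v = ?u (t, n - 1)" by blast
        have "(\<Sum>v\<in>?E. (\<lambda>i. u v * v i)) (t, n - 1) = (\<Sum>v\<in>?E. u v * v (t, n - 1))"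
          by (rule sum_fun_apply)
        also have "\<dots> = (\<Sum>t'<b1. u (?u (t', n - 1)) * ?u (t', n - 1) (t, n - 1))"
          by (rule sum.reindex[OF injE, unfolded comp_def])
        also have "\<dots> = (\<Sum>t'<b1. if t = t' then u (?u (t', n - 1)) else 0)"
          by (rule sum.cong) auto
        also have "\<dots> = u v" using t by simp
        finally show "u v = 0" using 0 by simp
      qed
      then show ?thesis by (subst cs.dependent_finite) auto
    qed
    show "shift f = 0" if f: "f \<in> ?E" for f
    proof -
      obtain t where t: "f = ?u (t, n - 1)" using f by blast
      show ?thesis unfolding t by (auto simp: shift_def fun_eq_iff)
    qed
  qed
  then show ?thesis unfolding card_image[OF injE] by simp
qed

text \<open>
  For each monomial \<open>\<mu>\<close> of degree \<open>n\<close> other than \<open>x\<^sub>0\<^sup>n\<close> and each row \<open>s\<close>, a vector that the matrix maps to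
  \<open>\<mu> e\<^sub>s\<close> up to higher degree, and that vanishes on the line: with \<open>\<mu> = x\<^sub>i \<mu>'\<close> and \<open>i > 0\<close> it is \<open>x\<^sub>i\<close>
  times a preimage of \<open>\<mu>' e\<^sub>s\<close>.
\<close>

lemma monomial_lift:
  assumes \<mu>: "\<mu> \<in> monomials_of_degree d n - {Poly_Mapping.single 0 n}" and s: "s < b0"
  shows "\<exists>v. v \<in> K \<and> line v = 0 \<and>
    (\<forall>s'<b0. act v s' - (if s' = s then Poly_Mapping.single \<mu> 1 else 0) \<in> J (Suc n))"
proof -
  have k: "Poly_Mapping.keys \<mu> \<subseteq> {..<d}" and deg: "mdeg d \<mu> = n"
    using \<mu> by (simp_all add: monomials_of_degree_def)
  have "\<exists>i. 0 < i \<and> i < d \<and> 0 < Poly_Mapping.lookup \<mu> i"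
  proof (rule ccontr)
    assume no: "\<not> (\<exists>i. 0 < i \<and> i < d \<and> 0 < Poly_Mapping.lookup \<mu> i)"
    have z: "Poly_Mapping.lookup \<mu> i = 0" if "0 < i" for i
    proof (cases "i < d")
      case True
      then show ?thesis using no that by auto
    next
      case False
      then have "i \<notin> Poly_Mapping.keys \<mu>" using k by auto
      then show ?thesis by (simp add: in_keys_iff)
    qed
    have "mdeg d \<mu> = Poly_Mapping.lookup \<mu> 0 + (\<Sum>i\<in>{..<d} - {0}. Poly_Mapping.lookup \<mu> i)"
      unfolding mdeg_def using d_pos by (intro sum.remove) simp_all
    also have "(\<Sum>i\<in>{..<d} - {0}. Poly_Mapping.lookup \<mu> i) = 0" by (rule sum.neutral) (use z in simp)
    finally have "Poly_Mapping.lookup \<mu> 0 = n" using deg by simp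
    then have "\<mu> = Poly_Mapping.single 0 n"
      by (intro poly_mapping_eqI) (use z in \<open>auto simp: lookup_single when_def\<close>)
    then show False using \<mu> by simp
  qed
  then obtain i where i: "0 < i" "i < d" "0 < Poly_Mapping.lookup \<mu> i" by blast
  obtain \<mu>' where \<mu>': "\<mu> = Poly_Mapping.single i 1 + \<mu>'" "Poly_Mapping.keys \<mu>' \<subseteq> {..<d}"
    "mdeg d \<mu> = Suc (mdeg d \<mu>')" using monomial_split[OF i(3) k i(2)] .
  define w :: "nat \<Rightarrow> 'k mpoly" where "w s' = (if s' = s then Poly_Mapping.single \<mu>' 1 else 0)" for s'
  have w: "w s' \<in> J (n - 1)" for s'
    unfolding w_def using \<mu>' deg by (simp add: deg_ideal_zero deg_ideal_single)
  have "\<exists>v. (\<forall>t. v t \<in> J 0) \<and> (\<forall>t\<ge>b1. v t = 0) \<and> (\<forall>s<b0. act v s - w s \<in> J n)"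
    unfolding act_def by (rule a_surj[OF w])
  then obtain v where v: "\<forall>t. v t \<in> J 0" "\<forall>t\<ge>b1. v t = 0" "\<forall>s<b0. act v s - w s \<in> J n"
    by (elim exE conjE) (rule that)
  let ?v = "\<lambda>t. mpoly_var i * v t"
  have vw: "mpoly_var i * w s' = (if s' = s then Poly_Mapping.single \<mu> 1 else 0)" for s'
    by (simp add: w_def mpoly_var_def mult_single \<mu>'(1))
  have e: "act ?v s' - (if s' = s then Poly_Mapping.single \<mu> 1 else 0) \<in> J (Suc n)" if s': "s' < b0" for s'
  proof -
    have "act ?v s' - (if s' = s then Poly_Mapping.single \<mu> 1 else 0) = mpoly_var i * (act v s' - w s')"
      by (simp only: act_mult vw[symmetric] right_diff_distrib)
    also have "\<dots> \<in> J (Suc n)"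
      using deg_ideal_mult[OF mpoly_var_deg_ideal[OF i(2)], of "act v s' - w s'" n] v(3) s' by simp
    finally show ?thesis .
  qed
  have "?v \<in> K"
    unfolding K_def
  proof (intro CollectI conjI allI impI)
    show "mpoly_var i * v t \<in> J 0" for t
      by (rule deg_ideal_mult_left[OF deg_ideal_mono[OF mpoly_var_deg_ideal[OF i(2)]]]) (simp_all add: v(1))
    show "mpoly_var i * v t = 0" if "b1 \<le> t" for t using v(2) that by simp
    fix s' assume s': "s' < b0"
    have "(if s' = s then Poly_Mapping.single \<mu> 1 else 0) \<in> J n"
      using k deg by (simp add: deg_ideal_zero deg_ideal_single)
    from deg_ideal_add[OF deg_ideal_mono[OF e[OF s']] this] show "act ?v s' \<in> J n" by simp
  qed
  then show ?thesis using e line_var[OF i(1)] by blast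
qed

text \<open>
  A relation modulo \<open>\<nn> K\<close> between lifts of the independent vectors on the line and the monomial lifts
  is first restricted to the line, where the monomial lifts disappear; this kills the coefficients of
  the former. Comparing the terms of degree \<open>n\<close> after applying the matrix, where \<open>\<nn> K\<close> contributes
  nothing, kills the others.
\<close>

lemma card_generators_ge:
  assumes gen: "\<And>v. v \<in> K \<Longrightarrow> \<exists>\<gamma>. v - (\<Sum>i<c. scl (\<gamma> i) (t i)) \<in> nK"
  shows "b1 + b0 * (card (monomials_of_degree d n) - 1) \<le> c"
proof -
  obtain C where C: "C \<subseteq> line ` K" "finite C" "b1 \<le> card C"
    "\<forall>c. (\<Sum>f\<in>C. (\<lambda>i. c f * f i)) \<in> shift ` line ` K \<longrightarrow> (\<forall>f\<in>C. c f = 0)"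
    using line_independent by (elim exE conjE) (rule that)
  define E where "E = {..<b0} \<times> (monomials_of_degree d n - {Poly_Mapping.single 0 n})"
  have finE: "finite E" using card_monomials_of_degree(1) by (simp add: E_def)
  have "\<forall>f\<in>C. \<exists>v. v \<in> K \<and> line v = f" using C(1) by blast
  from bchoice[OF this] obtain p where p: "\<forall>f\<in>C. p f \<in> K \<and> line (p f) = f" by (rule exE)
  have "\<forall>x\<in>E. \<exists>v. v \<in> K \<and> line v = 0 \<and>
      (\<forall>s'<b0. act v s' - (if s' = fst x then Poly_Mapping.single (snd x) 1 else 0) \<in> J (Suc n))"
    using monomial_lift by (auto simp: E_def)
  from bchoice[OF this] obtain q where q: "\<forall>x\<in>E. q x \<in> K \<and> line (q x) = 0 \<and>
      (\<forall>s'<b0. act (q x) s' - (if s' = fst x then Poly_Mapping.single (snd x) 1 else 0) \<in> J (Suc n))"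
    by (rule exE)
  define b where "b = case_sum p q"
  let ?J = "C <+> E"
  have sum_split: "(\<Sum>j\<in>?J. scl (e j) (b j)) = (\<Sum>f\<in>C. scl (e (Inl f)) (p f)) + (\<Sum>x\<in>E. scl (e (Inr x)) (q x))"
    for e
    using C(2) finE by (simp add: sum.Plus b_def)
  have "card ?J \<le> card {..<c}"
  proof (rule vs.card_le_of_independent_modulo[of nK])
    show "vs.subspace nK" unfolding nK_def by (rule vs.subspace_span)
    show "finite ?J" using C(2) finE by simp
    show "\<exists>\<gamma>. b j - (\<Sum>i<c. scl (\<gamma> i) (t i)) \<in> nK" if "j \<in> ?J" for j
      using that gen p q by (auto simp: b_def)
    fix e assume e: "(\<Sum>j\<in>?J. scl (e j) (b j)) \<in> nK"
    have "line (\<Sum>j\<in>?J. scl (e j) (b j)) = (\<Sum>f\<in>C. (\<lambda>i. e (Inl f) * f i))"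
    proof -
      have "(\<Sum>x\<in>E. line (scl (e (Inr x)) (q x))) = 0"
        by (rule sum.neutral) (use q in \<open>simp add: line_scale fun_eq_iff\<close>)
      moreover have "(\<Sum>f\<in>C. line (scl (e (Inl f)) (p f))) = (\<Sum>f\<in>C. (\<lambda>i. e (Inl f) * f i))"
        by (rule sum.cong) (use p in \<open>simp_all add: line_scale\<close>)
      ultimately show ?thesis by (simp add: sum_split line_add line_sum)
    qed
    with line_nK[OF e] have "(\<Sum>f\<in>C. (\<lambda>i. e (Inl f) * f i)) \<in> shift ` line ` K" by simp
    then have eC: "\<forall>f\<in>C. e (Inl f) = 0" using C(4)[rule_format, of "\<lambda>f. e (Inl f)"] by blast
    have "(\<Sum>f\<in>C. scl (e (Inl f)) (p f)) = 0"
      by (rule sum.neutral) (use eC in \<open>simp add: fun_eq_iff\<close>)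
    then have eE: "(\<Sum>x\<in>E. scl (e (Inr x)) (q x)) \<in> nK" using e by (simp add: sum_split)
    have "e (Inr (s, \<mu>)) = 0" if x: "(s, \<mu>) \<in> E" for s \<mu>
    proof -
      have s: "s < b0" and deg: "mdeg d \<mu> = n" using x by (auto simp: E_def monomials_of_degree_def)
      have lk: "Poly_Mapping.lookup (act (q y) s) \<mu> = (if y = (s, \<mu>) then 1 else 0)" if y: "y \<in> E" for y
      proof -
        have "act (q y) s - (if s = fst y then Poly_Mapping.single (snd y) 1 else 0) \<in> J (Suc n)"
          using q y s by blast
        from deg_ideal_lookup[OF this, of \<mu>] deg
        have "Poly_Mapping.lookup (act (q y) s) \<mu>
            = Poly_Mapping.lookup (if s = fst y then Poly_Mapping.single (snd y) 1 else 0) \<mu>"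
          by (simp add: lookup_minus)
        then show ?thesis by (cases y) (auto simp: lookup_single when_def)
      qed
      have act_sum: "act (\<Sum>x\<in>A. scl (e (Inr x)) (q x)) s
          = (\<Sum>x\<in>A. Poly_Mapping.single 0 (e (Inr x)) * act (q x) s)" for A
        unfolding act_def sum_fun_apply sum_distrib_left
        by (subst sum.swap) (simp add: mult.left_commute)
      have "0 = Poly_Mapping.lookup (act (\<Sum>x\<in>E. scl (e (Inr x)) (q x)) s) \<mu>"
        using deg_ideal_lookup[OF act_nK[OF eE s], of \<mu>] deg by simp
      also have "\<dots> = (\<Sum>y\<in>E. e (Inr y) * Poly_Mapping.lookup (act (q y) s) \<mu>)"
        by (simp add: act_sum lookup_sum lookup_const_times)
      also have "\<dots> = (\<Sum>y\<in>E. if y = (s, \<mu>) then e (Inr y) else 0)"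
        by (rule sum.cong) (simp_all add: lk)
      also have "\<dots> = e (Inr (s, \<mu>))" using x finE by simp
      finally show ?thesis by simp
    qed
    with eC show "\<forall>j\<in>?J. e j = 0" by auto
  qed simp
  moreover have "card ?J = card C + card E" using C(2) finE by (rule card_Plus)
  moreover have "card E = b0 * (card (monomials_of_degree d n) - 1)"
  proof -
    have "Poly_Mapping.single 0 n \<in> monomials_of_degree d n"
      using d_pos by (simp add: monomials_of_degree_def mdeg_single)
    then show ?thesis using card_monomials_of_degree(1) by (simp add: E_def card_cartesian_product)
  qed
  ultimately show ?thesis using C(3) by simp
qed

end

section \<open>Growth of the ranks in a minimal resolution\<close>

context truncated begin

definition vec :: "nat \<Rightarrow> (nat \<Rightarrow> 'k mpoly) \<Rightarrow> nat \<Rightarrow> 'k mpoly set"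
  where "vec r q = (\<lambda>t. if t < r then proj (q t) else \<zero>\<^bsub>R\<^esub>)"

lemma vec_closed: "(\<And>t. t < r \<Longrightarrow> q t \<in> J 0) \<Longrightarrow> vec r q \<in> carrier (std_free R r)"
proof -
  assume q: "\<And>t. t < r \<Longrightarrow> q t \<in> J 0"
  have "finite {t. vec r q t \<noteq> \<zero>\<^bsub>R\<^esub>}"
    by (rule finite_subset[of _ "{..<r}"]) (auto simp: vec_def)
  then show ?thesis using q by (auto simp: carrier_free_module_on vec_def intro: proj_closed)
qed

lemma vec_lft:
  assumes "f \<in> carrier (std_free R r)" shows "vec r (\<lambda>t. lft (f t)) = f"
proof
  fix t
  show "vec r (\<lambda>t. lft (f t)) t = f t"
    using lft(2)[OF free_module_on_coeff[OF R_cring assms, of t]] assms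
    by (cases "t < r") (simp_all add: vec_def carrier_free_module_on)
qed

lemma lin_ext_vec:
  assumes g: "g \<in> {..<b1} \<rightarrow> carrier (std_free R b0)" and q: "\<And>t. t < b1 \<Longrightarrow> q t \<in> J 0"
  shows "lin_ext R (std_free R b0) g (vec b1 q) s = proj (\<Sum>t<b1. lft (g t s) * q t)"
proof -
  interpret cring R by (rule R_cring)
  note L = free_module_on_module[OF R_cring, of "{..<b0}"]
  interpret L: module R "std_free R b0" by (rule L)
  have c: "vec b1 q \<in> carrier (std_free R b1)" by (rule vec_closed[OF q])
  have gc: "g t \<in> carrier (std_free R b0)" if "t < b1" for t using g that by auto
  have gs: "g t s \<in> carrier R" if "t < b1" for t by (rule free_module_on_coeff[OF R_cring gc[OF that]])
  have "lin_ext R (std_free R b0) g (vec b1 q)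
      = (\<Oplus>\<^bsub>std_free R b0\<^esub>t\<in>{..<b1}. vec b1 q t \<odot>\<^bsub>std_free R b0\<^esub> g t)"
    by (rule lin_ext_eq_finsum[OF L c g]) (auto simp: vec_def)
  then have "lin_ext R (std_free R b0) g (vec b1 q) s
      = (\<Oplus>\<^bsub>std_free R b0\<^esub>t\<in>{..<b1}. vec b1 q t \<odot>\<^bsub>std_free R b0\<^esub> g t) s"
    by (rule fun_cong)
  also have "\<dots> = (\<Oplus>\<^bsub>R\<^esub>t\<in>{..<b1}. (vec b1 q t \<odot>\<^bsub>std_free R b0\<^esub> g t) s)"
  proof (rule finsum_free_module_on[OF R_cring])
    show "(\<lambda>t. vec b1 q t \<odot>\<^bsub>std_free R b0\<^esub> g t) \<in> {..<b1} \<rightarrow> carrier (std_free R b0)"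
      by (rule Pi_I, rule L.smult_closed[OF free_module_on_coeff[OF R_cring c] gc]) simp
  qed simp
  also have "\<dots> = (\<Oplus>\<^bsub>R\<^esub>t\<in>{..<b1}. proj (lft (g t s) * q t))"
  proof (rule finsum_cong')
    show "(\<lambda>t. proj (lft (g t s) * q t)) \<in> {..<b1} \<rightarrow> carrier R"
      by (rule Pi_I, rule proj_closed, rule deg_ideal_mult_left) (simp_all add: lft(1)[OF gs] q)
    fix t assume "t \<in> {..<b1}"
    then have t: "t < b1" by simp
    have "(vec b1 q t \<odot>\<^bsub>std_free R b0\<^esub> g t) s = proj (q t) \<otimes>\<^bsub>R\<^esub> proj (lft (g t s))"
      using t by (simp add: vec_def lft(2)[OF gs[OF t]])
    also have "\<dots> = proj (q t * lft (g t s))" by (rule proj_hom(2)[OF q[OF t] lft(1)[OF gs[OF t]], symmetric])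
    finally show "(vec b1 q t \<odot>\<^bsub>std_free R b0\<^esub> g t) s = proj (lft (g t s) * q t)" by (simp only: mult.commute)
  qed simp
  also have "\<dots> = proj (\<Sum>t<b1. lft (g t s) * q t)"
    by (rule proj_sum[symmetric]) (simp_all add: deg_ideal_mult_left lft(1)[OF gs] q)
  finally show ?thesis .
qed

lemma vec_eq_zero:
  assumes "f \<in> carrier (std_free R r)" "\<And>s. s < r \<Longrightarrow> f s = \<zero>\<^bsub>R\<^esub>"
  shows "f = \<zero>\<^bsub>std_free R r\<^esub>"
proof
  fix s show "f s = \<zero>\<^bsub>std_free R r\<^esub> s" using assms by (cases "s < r") (simp_all add: carrier_free_module_on)
qed

lemma lin_ext_closed:
  assumes g: "g \<in> {..<b1} \<rightarrow> carrier (std_free R b0)" and f: "f \<in> carrier (std_free R b1)"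
  shows "lin_ext R (std_free R b0) g f \<in> carrier (std_free R b0)"
  by (rule hom_into[OF lin_ext_hom[OF free_module_on_module[OF R_cring] g] f])

text \<open>
  A matrix with entries in \<open>\<mm>\<close> maps \<open>\<mm>\<^sup>n\<^sup>-\<^sup>1\<close> into \<open>\<mm>\<^sup>n = 0\<close>.
\<close>

lemma lin_ext_top_degree:
  assumes g: "g \<in> {..<b1} \<rightarrow> {f \<in> carrier (std_free R b0). \<forall>s. f s \<in> max_J}"
    and f: "f \<in> carrier (std_free R b1)" "\<And>t. f t \<in> proj ` J (n - 1)"
  shows "lin_ext R (std_free R b0) g f = \<zero>\<^bsub>std_free R b0\<^esub>"
proof -
  have g0: "g \<in> {..<b1} \<rightarrow> carrier (std_free R b0)" using g by auto
  have "\<forall>t. \<exists>q. q \<in> J (n - 1) \<and> proj q = f t" using f(2) by (metis imageE)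
  from choice[OF this] obtain q where q: "\<forall>t. q t \<in> J (n - 1) \<and> proj (q t) = f t" by (rule exE)
  have q0: "q t \<in> J 0" for t by (rule deg_ideal_mono[OF conjunct1[OF spec[OF q]]]) simp
  have fq: "vec b1 q = f"
  proof
    fix t show "vec b1 q t = f t" using f(1) q by (simp add: vec_def carrier_free_module_on)
  qed
  show ?thesis
  proof (rule vec_eq_zero[OF lin_ext_closed[OF g0 f(1)]])
    fix s
    have lq: "lft (g t s) * q t \<in> J n" if "t < b1" for t
    proof -
      have gt: "g t \<in> carrier (std_free R b0)" "g t s \<in> max_J" using g that by auto
      have "lft (g t s) \<in> J 1" by (rule max_J_lft[OF gt(2) free_module_on_coeff[OF R_cring gt(1)]])
      from deg_ideal_mult[OF this, of "q t" "n - 1"] show ?thesis using q n_pos by simp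
    qed
    have sn: "(\<Sum>t<b1. lft (g t s) * q t) \<in> J n" by (rule deg_ideal_sum) (simp add: lq)
    have "lin_ext R (std_free R b0) g f s = proj (\<Sum>t<b1. lft (g t s) * q t)"
      using lin_ext_vec[OF g0, of q s] q0 by (simp add: fq)
    also have "\<dots> = \<zero>\<^bsub>R\<^esub>" using sn proj_eq_zero[OF deg_ideal_mono[OF sn]] by simp
    finally show "lin_ext R (std_free R b0) g f s = \<zero>\<^bsub>R\<^esub>" .
  qed
qed

text \<open>
  The count of generators in terms of \<open>R\<close>. If \<open>v \<in> K\<close>, exactness expresses the class of \<open>v\<close> by the
  generators with coefficients \<open>p\<^sub>i\<close>, whose constant terms \<open>\<gamma>\<^sub>i\<close> are the scalars wanted: what remains is the
  sum of a vector in \<open>\<nn>\<^sup>n\<close> and of the generators multiplied by \<open>p\<^sub>i - \<gamma>\<^sub>i \<in> \<nn>\<close>.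
\<close>

lemma rank_growth:
  assumes d: "0 < d"
    and g: "g \<in> {..<b1} \<rightarrow> {f \<in> carrier (std_free R b0). \<forall>s. f s \<in> max_J}"
    and g': "g' \<in> {..<c} \<rightarrow> carrier (std_free R b1)"
    and surj: "\<And>f. f \<in> carrier (std_free R b0) \<Longrightarrow> (\<And>s. f s \<in> proj ` J (n - 1)) \<Longrightarrow>
      f \<in> lin_ext R (std_free R b0) g ` carrier (std_free R b1)"
    and exact: "a_kernel (std_free R b1) (std_free R b0) (lin_ext R (std_free R b0) g)
      = lin_ext R (std_free R b1) g' ` carrier (std_free R c)"
  shows "b1 + b0 * (card (monomials_of_degree d n) - 1) \<le> c"
proof -
  let ?D = "lin_ext R (std_free R b0) g" and ?D' = "lin_ext R (std_free R b1) g'"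
  have g0: "g \<in> {..<b1} \<rightarrow> carrier (std_free R b0)" using g by auto
  have gc: "lft (g t s) \<in> J 1" if "t < b1" for s t
  proof -
    have gt: "g t \<in> carrier (std_free R b0)" "g t s \<in> max_J" using g that by auto
    show ?thesis by (rule max_J_lft[OF gt(2) free_module_on_coeff[OF R_cring gt(1)]])
  qed
  have g'c: "lft (g' i t) \<in> J 0" if "i < c" for i t
    by (rule lft(1)[OF free_module_on_coeff[OF R_cring, of _ "{..<b1}"]]) (use g' that in auto)
  have lc: "lft (f t) \<in> J 0" if "f \<in> carrier (std_free R r)" for f r t
    by (rule lft(1)[OF free_module_on_coeff[OF R_cring that]])
  interpret P: poly_matrix d n b0 b1 "\<lambda>s t. lft (g t s)"
  proof
    fix w :: "nat \<Rightarrow> 'k mpoly" assume w: "\<And>s. w s \<in> J (n - 1)"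
    have w0: "w s \<in> J 0" for s by (rule deg_ideal_mono[OF w]) simp
    have "vec b0 w s \<in> proj ` J (n - 1)" for s
    proof (cases "s < b0")
      case True
      then show ?thesis using w by (simp add: vec_def)
    next
      case False
      then show ?thesis using imageI[OF deg_ideal_zero, of proj d "n - 1"] by (simp add: vec_def proj_zero)
    qed
    from surj[OF vec_closed[OF w0] this] obtain h
      where h: "vec b0 w = ?D h" "h \<in> carrier (std_free R b1)" by (rule imageE)
    define v where "v t = (if t < b1 then lft (h t) else 0)" for t
    have v0: "v t \<in> J 0" for t using lc[OF h(2)] by (simp add: v_def deg_ideal_zero)
    have hv: "vec b1 v = h" by (rule trans[OF _ vec_lft[OF h(2)]]) (simp add: vec_def v_def fun_eq_iff)
    have "(\<Sum>t<b1. lft (g t s) * v t) - w s \<in> J n" if s: "s < b0" for s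
    proof -
      have s0: "(\<Sum>t<b1. lft (g t s) * v t) \<in> J 0"
        by (rule deg_ideal_sum, rule deg_ideal_mult_left[OF deg_ideal_mono[OF gc] v0]) simp_all
      have "proj (\<Sum>t<b1. lft (g t s) * v t) = ?D h s"
        using lin_ext_vec[OF g0, of v s] v0 by (simp add: hv)
      also have "\<dots> = proj (w s)" using s fun_cong[OF h(1), of s] by (simp add: vec_def)
      finally show ?thesis using proj_eq_iff[OF s0 w0] by simp
    qed
    then show "\<exists>v. (\<forall>t. v t \<in> J 0) \<and> (\<forall>t\<ge>b1. v t = 0) \<and>
        (\<forall>s<b0. (\<Sum>t<b1. lft (g t s) * v t) - w s \<in> J n)"
      by (intro exI[of _ v]) (simp add: v0, simp add: v_def)
  qed (simp_all add: d n_pos gc[simplified])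
  have kernel: "f \<in> a_kernel (std_free R b1) (std_free R b0) ?D \<longleftrightarrow>
      f \<in> carrier (std_free R b1) \<and> ?D f = \<zero>\<^bsub>std_free R b0\<^esub>" for f
    by (simp add: a_kernel_def')
  define tt where "tt i t = (if t < b1 then lft (g' i t) else 0)" for i t
  have tt: "tt i \<in> P.K" if i: "i < c" for i
  proof -
    have g'i: "g' i \<in> carrier (std_free R b1)" using g' i by auto
    have vg: "vec b1 (tt i) = g' i" by (rule trans[OF _ vec_lft[OF g'i]]) (simp add: vec_def tt_def fun_eq_iff)
    have t0: "tt i t \<in> J 0" for t using g'c[OF i] by (simp add: tt_def deg_ideal_zero)
    have "?D' (free_gen R i) = g' i"
      by (rule lin_ext_gen[OF free_module_on_module[OF R_cring] g']) (simp add: i)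
    moreover have "free_gen R i \<in> carrier (std_free R c)"
      by (rule free_gen_closed[OF R_cring]) (simp add: i)
    ultimately have "g' i \<in> ?D' ` carrier (std_free R c)" by (metis imageI)
    then have Dg: "?D (g' i) = \<zero>\<^bsub>std_free R b0\<^esub>" using kernel[of "g' i"] exact by simp
    have "P.act (tt i) s \<in> J n" for s
    proof -
      have s0: "P.act (tt i) s \<in> J 0" unfolding P.act_def
        by (rule deg_ideal_sum, rule deg_ideal_mult_left[OF deg_ideal_mono[OF gc] t0]) simp_all
      have "proj (P.act (tt i) s) = \<zero>\<^bsub>R\<^esub>"
        using lin_ext_vec[OF g0, of "tt i" s] t0 Dg by (simp add: vg P.act_def)
      then show ?thesis using proj_eq_zero[OF s0] by simp
    qed
    then show ?thesis using t0 by (simp add: P.K_def tt_def)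
  qed
  show ?thesis
  proof (rule P.card_generators_ge[where t = tt])
    fix v assume v: "v \<in> P.K"
    have v0: "v t \<in> J 0" for t using v by (simp add: P.K_def)
    have vb: "v t = 0" if "b1 \<le> t" for t using v that by (simp add: P.K_def)
    have "?D (vec b1 v) s = \<zero>\<^bsub>R\<^esub>" if s: "s < b0" for s
    proof -
      have "P.act v s \<in> J n" using v s by (simp add: P.K_def)
      with proj_eq_zero[OF deg_ideal_mono[OF this]] have "proj (P.act v s) = \<zero>\<^bsub>R\<^esub>" by simp
      then show ?thesis using lin_ext_vec[OF g0, of v s] v0 by (simp add: P.act_def)
    qed
    from vec_eq_zero[OF lin_ext_closed[OF g0 vec_closed[OF v0]] this]
    have "vec b1 v \<in> ?D' ` carrier (std_free R c)"
      unfolding exact[symmetric] kernel using vec_closed[of b1 v] v0 by simp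
    then obtain h where h: "vec b1 v = ?D' h" "h \<in> carrier (std_free R c)" by (rule imageE)
    define p where "p i = lft (h i)" for i
    have p0: "p i \<in> J 0" for i unfolding p_def by (rule lc[OF h(2)])
    define \<gamma> where "\<gamma> i = Poly_Mapping.lookup (p i) 0" for i
    have p1: "p i - Poly_Mapping.single 0 (\<gamma> i) \<in> J 1" for i unfolding \<gamma>_def by (rule const_decompose[OF p0])
    have hp: "vec c p = h" unfolding p_def by (rule vec_lft[OF h(2)])
    have e: "v - (\<Sum>i<c. P.scl (\<gamma> i) (tt i)) = (\<lambda>t. v t - (\<Sum>i<c. tt i t * p i))
        + (\<Sum>i<c. (\<lambda>t. (p i - Poly_Mapping.single 0 (\<gamma> i)) * tt i t))"
      by (simp add: fun_eq_iff sum_fun_apply left_diff_distrib right_diff_distrib sum_subtractf mult.commute)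
    have 1: "(\<lambda>t. v t - (\<Sum>i<c. tt i t * p i)) \<in> P.nK"
    proof (rule P.nK_of_degree)
      show b: "v t - (\<Sum>i<c. tt i t * p i) = 0" if "b1 \<le> t" for t
        using that vb by (simp add: tt_def)
      show "v t - (\<Sum>i<c. tt i t * p i) \<in> J n" for t
      proof (cases "t < b1")
        case True
        have s0: "(\<Sum>i<c. lft (g' i t) * p i) \<in> J 0"
          by (rule deg_ideal_sum, rule deg_ideal_mult_left[OF g'c p0]) simp
        have "proj (v t) = ?D' h t" using True fun_cong[OF h(1), of t] by (simp add: vec_def)
        also have "\<dots> = proj (\<Sum>i<c. lft (g' i t) * p i)"
          using lin_ext_vec[OF g', of p t] p0 by (simp add: hp)
        finally have "v t - (\<Sum>i<c. lft (g' i t) * p i) \<in> J n" using proj_eq_iff[OF v0 s0] by simp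
        then show ?thesis using True by (simp add: tt_def)
      next
        case False
        then show ?thesis using b[of t] deg_ideal_zero by simp
      qed
    qed
    have 2: "(\<Sum>i<c. (\<lambda>t. (p i - Poly_Mapping.single 0 (\<gamma> i)) * tt i t)) \<in> P.nK"
      unfolding P.nK_def
    proof (rule P.vs.span_sum)
      fix i assume "i \<in> {..<c}"
      then have "i < c" by simp
      from P.nK_mult[OF p1 tt[OF this], unfolded P.nK_def]
      show "(\<lambda>t. (p i - Poly_Mapping.single 0 (\<gamma> i)) * tt i t)
        \<in> P.vs.span {\<lambda>t. mpoly_var i * v t |i v. i < d \<and> v \<in> P.K}" .
    qed
    have "v - (\<Sum>i<c. P.scl (\<gamma> i) (tt i)) \<in> P.nK"
      unfolding e using P.vs.span_add 1 2 unfolding P.nK_def by blast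
    then show "\<exists>\<gamma>. v - (\<Sum>i<c. P.scl (\<gamma> i) (tt i)) \<in> P.nK" by (intro exI[of _ \<gamma>])
  qed
qed

end

text \<open>
  The binomial coefficient is smallest for \<open>n = 2\<close>, where it is \<open>d (d + 1) / 2\<close>.
\<close>

lemma binomial_gt:
  assumes "1 < d" "1 < n" shows "d < (d + n - 1) choose (d - 1)"
proof -
  have "d < d * Suc d div 2"
  proof -
    have "2 * Suc d \<le> d * Suc d" using assms(1) by (intro mult_right_mono) simp_all
    then have "2 * Suc d div 2 \<le> d * Suc d div 2" by (rule div_le_mono)
    moreover have "2 * Suc d div 2 = Suc d" by (rule nonzero_mult_div_cancel_left) simp
    ultimately show ?thesis by linarith
  qed
  also have "d * Suc d div 2 = Suc d choose 2" by (simp add: choose_two mult.commute)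
  also have "\<dots> = Suc d choose (d - 1)" using binomial_symmetric[of 2 "Suc d"] assms(1) by simp
  also have "\<dots> \<le> (d + n - 1) choose (d - 1)" by (rule binomial_right_mono) (use assms(2) in simp)
  finally show ?thesis .
qed

theorem proposition4p5:
  fixes d n :: nat
    and R :: "'k::field mpoly set ring"
    and M :: "('k mpoly set, 'm) module"
  assumes "d > 1" and "n > 1"
    and "R = truncated_mpoly_ring d n"
    and "fin_gen_module R M"
    and "\<not> free_module R M"
  shows "\<forall>i\<ge>2.
    int (betti R M (i + 1)) - int (betti R M i) \<ge> int ((d + n - 1) choose (d - 1)) - 1 \<and>
    int ((d + n - 1) choose (d - 1)) - 1 > int d - 1"
proof -
  interpret truncated d n R by unfold_locales (use assms(2,3) in simp_all)
  interpret L: local_noetherian R max_J res by (rule local_noetherian_R)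
  have M: "module R M" using assms(4) by (simp add: fin_gen_module_def)
  obtain r g e where G: "free_resolution R M (\<lambda>i. std_free R (r i)) (\<lambda>i. lin_ext R (std_free R (r i)) (g i)) e"
    and g: "\<And>i. g i \<in> {..<r (Suc i)} \<rightarrow> {f \<in> carrier (std_free R (r i)). \<forall>s. f s \<in> max_J}"
    using L.minimal_resolution_exists[OF assms(4)] by (elim exE conjE) (rule that, assumption, erule spec)
  let ?D = "\<lambda>i. lin_ext R (std_free R (r i)) (g i)"
  note betti = L.betti_eq_rank[OF M G g]
  have exact: "a_kernel (std_free R (r (Suc i))) (std_free R (r i)) (?D i)
      = ?D (Suc i) ` carrier (std_free R (r (Suc (Suc i))))" for i
    using G unfolding free_resolution_def by blast
  have F: "module R (std_free R r)" for r by (rule free_module_on_module[OF R_cring])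
  have g0: "g i \<in> {..<r (Suc i)} \<rightarrow> carrier (std_free R (r i))" for i using g[of i] by auto
  have top: "f \<in> ?D (Suc i) ` carrier (std_free R (r (Suc (Suc i))))"
    if "f \<in> carrier (std_free R (r (Suc i)))" "\<And>s. f s \<in> proj ` J (n - 1)" for f i
    unfolding exact[symmetric] a_kernel_def' using that(1) lin_ext_top_degree[OF g that] by simp
  have zero_image: "P ` carrier (std_free R 0) = {\<zero>\<^bsub>N\<^esub>}" if "P \<in> module_hom R (std_free R 0) N" "module R N"
    for P :: "(nat \<Rightarrow> 'k mpoly set) \<Rightarrow> nat \<Rightarrow> 'k mpoly set" and N
  proof -
    have "carrier (std_free R 0) = {\<zero>\<^bsub>std_free R 0\<^esub>}" by (auto simp: carrier_free_module_on fun_eq_iff)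
    then show ?thesis using hom_zero[OF F that(2,1)] by simp
  qed
  \<comment> \<open>A resolution that stops in positive degree would also stop one step earlier, until M is free.\<close>
  have pos: "r (Suc i) \<noteq> 0" for i
  proof (induct i)
    case 0
    show ?case
    proof
      assume r0: "r (Suc 0) = 0"
      have e: "e \<in> module_hom R (std_free R (r 0)) M" "e ` carrier (std_free R (r 0)) = carrier M"
        "a_kernel (std_free R (r 0)) M e = ?D 0 ` carrier (std_free R (r 1))"
        using G by (simp_all add: free_resolution_def)
      have "?D 0 \<in> module_hom R (std_free R 0) (std_free R (r 0))"
        using lin_ext_hom[OF F g0[of 0]] r0 by simp
      then have ker: "a_kernel (std_free R (r 0)) M e = {\<zero>\<^bsub>std_free R (r 0)\<^esub>}"
        using zero_image[OF _ F] e(3) r0 by simp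
      interpret G0: module R "std_free R (r 0)" by (rule F)
      have "inj_on e (carrier (std_free R (r 0)))"
      proof (rule inj_onI)
        fix x y assume xy: "x \<in> carrier (std_free R (r 0))" "y \<in> carrier (std_free R (r 0))" "e x = e y"
        have "e (x \<ominus>\<^bsub>std_free R (r 0)\<^esub> y) = e x \<ominus>\<^bsub>M\<^esub> e y" by (rule hom_minus_eq[OF F M e(1) xy(1,2)])
        also have "\<dots> = \<zero>\<^bsub>M\<^esub>"
        proof -
          interpret M: module R M by (rule M)
          show ?thesis using hom_into[OF e(1) xy(2)] xy(3) by (simp add: a_minus_def M.M.r_neg)
        qed
        finally have "x \<ominus>\<^bsub>std_free R (r 0)\<^esub> y \<in> a_kernel (std_free R (r 0)) M e"
          unfolding a_kernel_def' using G0.M.minus_closed[OF xy(1,2)] by simp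
        then have "x \<ominus>\<^bsub>std_free R (r 0)\<^esub> y = \<zero>\<^bsub>std_free R (r 0)\<^esub>" unfolding ker by (rule singletonD)
        then show "x = y"
          using G0.M.minus_equality[of x "\<ominus>\<^bsub>std_free R (r 0)\<^esub> y"] xy(1,2)
          by (simp add: a_minus_def G0.M.minus_minus)
      qed
      then have "bij_betw e (carrier (std_free R (r 0))) (carrier M)" using e(2) by (simp add: bij_betw_def)
      moreover have "free_module R (std_free R (r 0))" using G by (simp add: free_resolution_def)
      ultimately show False using free_module_transport[OF _ M e(1)] assms(5) by blast
    qed
  next
    case (Suc i)
    show ?case
    proof
      assume r0: "r (Suc (Suc i)) = 0"
      have hom: "?D (Suc i) \<in> module_hom R (std_free R 0) (std_free R (r (Suc i)))"
        using lin_ext_hom[OF F g0[of "Suc i"]] r0 by simp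
      \<comment> \<open>A nonzero element of degree n - 1, which every matrix with entries in the maximal ideal kills.\<close>
      define w :: "nat \<Rightarrow> 'k mpoly" where "w t = (if t = 0 then Poly_Mapping.single (Poly_Mapping.single 0 (n - 1)) 1 else 0)" for t
      have w: "w t \<in> J (n - 1)" for t
        using assms(1) by (simp add: w_def deg_ideal_zero deg_ideal_single mdeg_single)
      have w0: "w t \<in> J 0" for t by (rule deg_ideal_mono[OF w]) simp
      have "vec (r (Suc i)) w t \<in> proj ` J (n - 1)" for t
      proof (cases "t < r (Suc i)")
        case True
        then show ?thesis using w by (simp add: vec_def)
      next
        case False
        then show ?thesis using imageI[OF deg_ideal_zero, of proj d "n - 1"] by (simp add: vec_def proj_zero)
      qed
      from top[OF vec_closed[OF w0] this]
      have "vec (r (Suc i)) w \<in> {\<zero>\<^bsub>std_free R (r (Suc i))\<^esub>}" unfolding r0 zero_image[OF hom F] .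
      then have "vec (r (Suc i)) w = \<zero>\<^bsub>std_free R (r (Suc i))\<^esub>" by (rule singletonD)
      from fun_cong[OF this, of 0] have "proj (w 0) = \<zero>\<^bsub>R\<^esub>" using Suc by (simp add: vec_def)
      then have "w 0 \<in> J n" using proj_eq_zero[OF w0] by simp
      from deg_ideal_lookup[OF this, of "Poly_Mapping.single 0 (n - 1)"] show False
        using assms(1,2) by (simp add: w_def mdeg_single)
    qed
  qed
  have growth: "r (Suc (Suc i)) + (((d + n - 1) choose (d - 1)) - 1) \<le> r (Suc (Suc (Suc i)))" for i
  proof -
    have d: "0 < d" using assms(1) by simp
    have "r (Suc (Suc i)) + r (Suc i) * (card (monomials_of_degree d n) - 1) \<le> r (Suc (Suc (Suc i)))"
      by (rule rank_growth[OF d g g0 top exact])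
    moreover have "1 * (card (monomials_of_degree d n) - 1) \<le> r (Suc i) * (card (monomials_of_degree d n) - 1)"
      by (rule mult_right_mono) (use pos[of i] in simp_all)
    ultimately show ?thesis unfolding card_monomials_of_degree(2)[OF d, of n] mult_1 by linarith
  qed
  show ?thesis
  proof (intro allI impI)
    fix i :: nat assume "2 \<le> i"
    then obtain j where j: "i = Suc (Suc j)" by (metis add_2_eq_Suc le_Suc_ex)
    show "int (betti R M (i + 1)) - int (betti R M i) \<ge> int ((d + n - 1) choose (d - 1)) - 1 \<and>
      int ((d + n - 1) choose (d - 1)) - 1 > int d - 1"
      using growth[of j] binomial_gt[OF assms(1,2)] betti[of "Suc j"] betti[of "Suc (Suc j)"]
      by (simp add: j)
  qed
qed

end
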